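(* There exists a $C^\infty$-smooth diffeomorphism $T$ of the $3$-dimensional compact Riemannian manifold $X = \mathbb{S}^2\times\mathbb{S}^1$ with a natural measure $\mu$, such that $\mathrm{ID}(\mu) < 1$ (in particular $\mathrm{ID}(\mu)$ exists) and for a prevalent set of Lipschitz observables $h\colon X\to\mathbb{R}$, there exists a positive $\nu_{h,1}$-measure set of non-predictable points. In particular, the set of Lipschitz observables $h\colon X\to\mathbb{R}$ for which $\nu_{h,1}$-almost every point of $\mathbb{R}$ is predictable is not prevalent.
   Context: $X$ is regarded as smoothly embedded in some $\mathbb{R}^N$. **Natural measure.** For a diffeomorphism $T$ of $X$, a compact set $\Lambda\subset X$ with $T(\Lambda)\subset\Lambda$ is an attractor if $B(\Lambda) = \{x\in X: \lim_{n\to\infty}\mathrm{dist}(T^nx,\Lambda) = 0\}$ is an open set containing $\Lambda$. A $T$-invariant Borel probability measure $\mu$ on $\Lambda$ is natural if $\frac1n\sum_{i=0}^{n-1}\delta_{T^ix}\to\mu$ weak-$^*$ for almost every $x\in B(\Lambda)$ with respect to the volume measure on $X$. **Information dimension.** For a Borel probability measure $\mu$ in $\mathbb{R}^N$ with compact support, $\underline{\mathrm{ID}}(\mu)$ and $\overline{\mathrm{ID}}(\mu)$ are the $\liminf$ and $\limsup$ as $\varepsilon\to0$ of $\int_{\operatorname{supp}\mu}\frac{\log\mu(B(x,\varepsilon))}{\log\varepsilon}\,d\mu(x)$; if they coincide, the common value is $\mathrm{ID}(\mu)$. **Predictability (for $k=1$).** For $h\colon X\to\mathbb{R}$, the $1$-delay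 coordinate map is $\phi = h$, and $\nu = \nu_{h,1} = h_*\mu$. For $y \in \operatorname{supp}\nu$ and $\varepsilon > 0$ put $$\chi_\varepsilon(y) = \frac{1}{\mu(h^{-1}(B(y,\varepsilon)))}\int_{h^{-1}(B(y,\varepsilon))} h(Tx)\,d\mu(x),$$ $$\sigma_\varepsilon(y) = \Big(\frac{1}{\mu(h^{-1}(B(y,\varepsilon)))}\int_{h^{-1}(B(y,\varepsilon))} |h(Tx)-\chi_\varepsilon(y)|^2\,d\mu(x)\Big)^{1/2},$$ and $\sigma(y) = \lim_{\varepsilon\to0}\sigma_\varepsilon(y)$ if the limit exists ($B(y,\varepsilon)$ is the open ball). The point $y$ is predictable if $\sigma(y)$ exists and equals $0$. **Prevalence.** $\mathrm{Lip}(X)$ is the space of Lipschitz functions $h\colon X\to\mathbb{R}$ with norm $\|h\|_\infty + \mathrm{Lip}(h)$, where $\mathrm{Lip}(h)$ is the Lipschitz constant. A Borel subset $S$ of a normed space $V$ is prevalent if there is a Borel measure $\lambda$ on $V$, positive and finite on some compact set in $V$, such that for every $v\in V$ one has $v+e\in S$ for $\lambda$-almost every $e\in V$. A non-Borel subset is prevalent if it contains a prevalent Borel subset. Prevalence of sets of observables is meant in $\mathrm{Lip}(X)$. *)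

theory Defs
  imports "HOL-Probability.Probability"
begin

section \<open>The manifold and its volume\<close>

definition S2xS1 :: "((real^3) \<times> complex) set" where
  "S2xS1 = sphere 0 1 \<times> sphere 0 1"

text \<open>
  The Riemannian metric on \<open>S2xS1\<close> is the one induced by the inner product of
  \<open>(real^3) \<times> complex\<close>, i.e. the product of the two round metrics. Its volume is thus the product
  of the area of the unit sphere, which is \<open>sin \<theta> d\<theta> d\<phi>\<close> in spherical coordinates (polar angle
  \<open>\<theta>\<close>, azimuth \<open>\<phi>\<close>), and the arc length of the unit circle. Both factors, and the product, are
  Borel measures on the ambient space that vanish off the submanifold.
\<close>

definition sphere_coords :: "real \<times> real \<Rightarrow> real^3" where
  "sphere_coords = (\<lambda>(\<theta>, \<phi>). vector [sin \<theta> * cos \<phi>, sin \<theta> * sin \<phi>, cos \<theta>])"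

definition S2_area :: "(real^3) measure" where
  "S2_area = distr (density (restrict_space lborel ({0..pi} \<times> {0..2*pi}))
                     (\<lambda>(\<theta>, \<phi>). ennreal (sin \<theta>))) borel sphere_coords"

definition S1_length :: "complex measure" where
  "S1_length = distr (restrict_space lborel {0..2*pi}) borel cis"

definition S2xS1_volume :: "((real^3) \<times> complex) measure" where
  "S2xS1_volume = S2_area \<Otimes>\<^sub>M S1_length"

lemma sphere_coords_measurable [measurable]: "sphere_coords \<in> borel_measurable borel"
proof -
  have "continuous_on UNIV (\<lambda>p::real\<times>real. vector
          [sin (fst p) * cos (snd p), sin (fst p) * sin (snd p), cos (fst p)] :: real^3)"
    unfolding vector_def
    by (subst continuous_on_componentwise)
       (auto simp: forall_3 Basis_vec_def inner_axis intro!: continuous_intros)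
  then show ?thesis
    by (simp add: sphere_coords_def case_prod_unfold borel_measurable_continuous_onI)
qed

lemma sets_S2xS1_volume [simp, measurable_cong]: "sets S2xS1_volume = sets borel"
proof -
  have "sets S2xS1_volume = sets ((borel :: (real^3) measure) \<Otimes>\<^sub>M (borel :: complex measure))"
    unfolding S2xS1_volume_def by (intro sets_pair_measure_cong) (simp_all add: S2_area_def S1_length_def)
  then show ?thesis by (simp only: borel_prod)
qed

lemma space_S2xS1_volume [simp]: "space S2xS1_volume = UNIV"
  using sets_eq_imp_space_eq[OF sets_S2xS1_volume] by simp

lemma compact_S2xS1: "compact S2xS1"
  unfolding S2xS1_def by (intro compact_Times compact_sphere)

section \<open>Smooth diffeomorphisms\<close>

primrec Ck_on ::
    "nat \<Rightarrow> ('a::euclidean_space \<Rightarrow> 'b::euclidean_space) \<Rightarrow> 'a set \<Rightarrow> bool" where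
  "Ck_on 0 f U \<longleftrightarrow> continuous_on U f"
| "Ck_on (Suc k) f U \<longleftrightarrow>
     f differentiable_on U \<and> (\<forall>v. Ck_on k (\<lambda>x. frechet_derivative f (at x) v) U)"

text \<open>
  On an embedded submanifold \<open>X\<close>, a map is smooth iff near each point of \<open>X\<close> it is the
  restriction of a smooth map defined on an open subset of the ambient space.
\<close>

definition smooth_map_on ::
    "'a::euclidean_space set \<Rightarrow> ('a \<Rightarrow> 'b::euclidean_space) \<Rightarrow> bool" where
  "smooth_map_on X f \<longleftrightarrow>
     (\<forall>x\<in>X. \<exists>U F. open U \<and> x \<in> U \<and> (\<forall>k. Ck_on k F U) \<and> (\<forall>y\<in>X \<inter> U. F y = f y))"

definition smooth_diffeo_on :: "'a::euclidean_space set \<Rightarrow> ('a \<Rightarrow> 'a) \<Rightarrow> bool" where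
  "smooth_diffeo_on X T \<longleftrightarrow>
     bij_betw T X X \<and> smooth_map_on X T \<and> smooth_map_on X (inv_into X T)"

section \<open>Attractors and natural measures\<close>

text \<open>
  Maps \<open>T\<close> and observables are total functions on the ambient space, but only their values on
  \<open>X\<close> matter; in particular all preimages under \<open>T\<close> are taken in \<open>X\<close>.
\<close>

definition basin :: "'a::metric_space set \<Rightarrow> ('a \<Rightarrow> 'a) \<Rightarrow> 'a set \<Rightarrow> 'a set" where
  "basin X T \<Lambda> = {x\<in>X. (\<lambda>n. infdist ((T ^^ n) x) \<Lambda>) \<longlonglongrightarrow> 0}"

definition attractor :: "'a::metric_space set \<Rightarrow> ('a \<Rightarrow> 'a) \<Rightarrow> 'a set \<Rightarrow> bool" where
  "attractor X T \<Lambda> \<longleftrightarrow> \<Lambda> \<subseteq> X \<and> compact \<Lambda> \<and> T ` \<Lambda> \<subseteq> \<Lambda> \<and>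
     openin (top_of_set X) (basin X T \<Lambda>) \<and> \<Lambda> \<subseteq> basin X T \<Lambda>"

definition invariant_measure :: "'a::metric_space set \<Rightarrow> ('a \<Rightarrow> 'a) \<Rightarrow> 'a measure \<Rightarrow> bool" where
  "invariant_measure X T \<mu> \<longleftrightarrow>
     (\<forall>A\<in>sets borel. emeasure \<mu> (T -` A \<inter> X) = emeasure \<mu> A)"

definition natural_measure_on ::
    "'a::euclidean_space measure \<Rightarrow> 'a set \<Rightarrow> ('a \<Rightarrow> 'a) \<Rightarrow> 'a set \<Rightarrow> 'a measure \<Rightarrow> bool" where
  "natural_measure_on vol X T \<Lambda> \<mu> \<longleftrightarrow>
     sets \<mu> = sets borel \<and> prob_space \<mu> \<and> emeasure \<mu> \<Lambda> = 1 \<and> invariant_measure X T \<mu> \<and>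
     (AE x in vol. x \<in> basin X T \<Lambda> \<longrightarrow>
        (\<forall>f :: 'a \<Rightarrow> real. continuous_on X f \<longrightarrow>
           (\<lambda>n. (1 / real n) * (\<Sum>i<n. f ((T ^^ i) x))) \<longlonglongrightarrow> (LINT z:X|\<mu>. f z)))"

definition natural_measure ::
    "'a::euclidean_space measure \<Rightarrow> 'a set \<Rightarrow> ('a \<Rightarrow> 'a) \<Rightarrow> 'a measure \<Rightarrow> bool" where
  "natural_measure vol X T \<mu> \<longleftrightarrow> (\<exists>\<Lambda>. attractor X T \<Lambda> \<and> natural_measure_on vol X T \<Lambda> \<mu>)"

section \<open>Information dimension\<close>

definition msupport :: "'a::metric_space measure \<Rightarrow> 'a set" where
  "msupport \<mu> = {x. \<forall>\<epsilon>>0. emeasure \<mu> (ball x \<epsilon>) > 0}"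

definition ID_integral :: "'a::euclidean_space measure \<Rightarrow> real \<Rightarrow> real" where
  "ID_integral \<mu> \<epsilon> = (LINT x:msupport \<mu>|\<mu>. ln (measure \<mu> (ball x \<epsilon>)) / ln \<epsilon>)"

definition lower_ID :: "'a::euclidean_space measure \<Rightarrow> ereal" where
  "lower_ID \<mu> = Liminf (at_right 0) (\<lambda>\<epsilon>. ereal (ID_integral \<mu> \<epsilon>))"

definition upper_ID :: "'a::euclidean_space measure \<Rightarrow> ereal" where
  "upper_ID \<mu> = Limsup (at_right 0) (\<lambda>\<epsilon>. ereal (ID_integral \<mu> \<epsilon>))"

definition has_ID :: "'a::euclidean_space measure \<Rightarrow> ereal \<Rightarrow> bool" where
  "has_ID \<mu> d \<longleftrightarrow> lower_ID \<mu> = d \<and> upper_ID \<mu> = d"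

section \<open>Predictability for one-delay observables\<close>

definition pred_mean ::
    "'a set \<Rightarrow> ('a \<Rightarrow> 'a) \<Rightarrow> 'a measure \<Rightarrow> ('a \<Rightarrow> real) \<Rightarrow> real \<Rightarrow> real \<Rightarrow> real" where
  "pred_mean X T \<mu> h \<epsilon> y =
     (1 / measure \<mu> {x\<in>X. h x \<in> ball y \<epsilon>}) *
     (LINT x:{x\<in>X. h x \<in> ball y \<epsilon>}|\<mu>. h (T x))"

definition pred_dev ::
    "'a set \<Rightarrow> ('a \<Rightarrow> 'a) \<Rightarrow> 'a measure \<Rightarrow> ('a \<Rightarrow> real) \<Rightarrow> real \<Rightarrow> real \<Rightarrow> real" where
  "pred_dev X T \<mu> h \<epsilon> y = sqrt (
     (1 / measure \<mu> {x\<in>X. h x \<in> ball y \<epsilon>}) *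
     (LINT x:{x\<in>X. h x \<in> ball y \<epsilon>}|\<mu>. \<bar>h (T x) - pred_mean X T \<mu> h \<epsilon> y\<bar>\<^sup>2))"

text \<open>
  The law \<open>distr \<mu> borel h\<close> of the observable is the push-forward \<open>\<nu>\<close> of \<open>\<mu>\<close> under \<open>h\<close>.
  Predictability is only defined for points of its support.
\<close>

definition predictable_points ::
    "'a set \<Rightarrow> ('a \<Rightarrow> 'a) \<Rightarrow> 'a measure \<Rightarrow> ('a \<Rightarrow> real) \<Rightarrow> real set" where
  "predictable_points X T \<mu> h =
     {y \<in> msupport (distr \<mu> borel h). ((\<lambda>\<epsilon>. pred_dev X T \<mu> h \<epsilon> y) \<longlongrightarrow> 0) (at_right 0)}"

definition nonpredictable_points ::
    "'a set \<Rightarrow> ('a \<Rightarrow> 'a) \<Rightarrow> 'a measure \<Rightarrow> ('a \<Rightarrow> real) \<Rightarrow> real set" where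
  "nonpredictable_points X T \<mu> h = msupport (distr \<mu> borel h) - predictable_points X T \<mu> h"

section \<open>Prevalence\<close>

definition borel_prevalent :: "'v::real_normed_vector set \<Rightarrow> bool" where
  "borel_prevalent S \<longleftrightarrow> S \<in> sets borel \<and>
     (\<exists>\<rho>. sets \<rho> = sets borel \<and>
        (\<exists>K. compact K \<and> 0 < emeasure \<rho> K \<and> emeasure \<rho> K < \<infinity>) \<and>
        (\<forall>v. AE e in \<rho>. v + e \<in> S))"

text \<open>
  A Borel superset of a \<open>borel_prevalent\<close> set is \<open>borel_prevalent\<close>, so for Borel sets the two
  notions agree.
\<close>

definition prevalent :: "'v::real_normed_vector set \<Rightarrow> bool" where
  "prevalent S \<longleftrightarrow> (\<exists>B\<subseteq>S. borel_prevalent B)"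

section \<open>The normed space of Lipschitz observables\<close>

text \<open>
  Elements are functions on the ambient space that are Lipschitz on \<open>S2xS1\<close> and, so as to be
  determined by their restriction to \<open>S2xS1\<close>, vanish off it.
\<close>

typedef lip_obs =
  "{h :: (real^3) \<times> complex \<Rightarrow> real. (\<exists>L. L-lipschitz_on S2xS1 h) \<and> (\<forall>x. x \<notin> S2xS1 \<longrightarrow> h x = 0)}"
  morphisms obs Abs_lip_obs
  by (rule exI[of _ "\<lambda>_. 0"]) (auto simp: lipschitz_on_def)

setup_lifting type_definition_lip_obs

definition lip_sup :: "lip_obs \<Rightarrow> real" where
  "lip_sup h = (SUP x\<in>S2xS1. \<bar>obs h x\<bar>)"

definition lip_const :: "lip_obs \<Rightarrow> real" where
  "lip_const h = Inf {L. L-lipschitz_on S2xS1 (obs h)}"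

lemma obs_lipschitz: "\<exists>L. L-lipschitz_on S2xS1 (obs h)"
  using obs[of h] by simp

lemma obs_outside: "x \<notin> S2xS1 \<Longrightarrow> obs h x = 0"
  using obs[of h] by blast

lemma continuous_on_obs: "continuous_on S2xS1 (obs h)"
  using obs_lipschitz[of h] lipschitz_on_continuous_on by blast

lemma borel_measurable_obs [measurable]: "obs h \<in> borel_measurable borel"
proof -
  have "(\<lambda>x. indicator S2xS1 x *\<^sub>R obs h x) \<in> borel_measurable borel"
    by (rule borel_measurable_continuous_on_indicator)
       (auto intro: continuous_on_obs compact_S2xS1 borel_compact)
  also have "(\<lambda>x. indicator S2xS1 x *\<^sub>R obs h x) = obs h"
    by (rule ext) (metis indicator_simps obs_outside scale_one scale_zero_left)
  finally show ?thesis .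
qed

lemma S2xS1_nonempty: "S2xS1 \<noteq> {}"
proof -
  have "(axis 1 1, 1) \<in> S2xS1" by (simp add: S2xS1_def)
  then show ?thesis by blast
qed

lemma lip_sup_upper: "\<bar>obs h x\<bar> \<le> lip_sup h"
proof -
  have "compact ((\<lambda>x. \<bar>obs h x\<bar>) ` S2xS1)"
    by (intro compact_continuous_image continuous_intros continuous_on_obs compact_S2xS1)
  then have bdd: "bdd_above ((\<lambda>x. \<bar>obs h x\<bar>) ` S2xS1)"
    by (simp add: bounded_imp_bdd_above compact_imp_bounded)
  have *: "\<bar>obs h x\<bar> \<le> lip_sup h" if "x \<in> S2xS1" for x
    unfolding lip_sup_def by (rule cSUP_upper[OF that bdd])
  show ?thesis
  proof (cases "x \<in> S2xS1")
    case False
    obtain z where "z \<in> S2xS1" using S2xS1_nonempty by blast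
    then have "0 \<le> lip_sup h" using *[of z] by linarith
    then show ?thesis using False by (simp add: obs_outside)
  qed (rule *)
qed

lemma lip_sup_least: "(\<And>x. x \<in> S2xS1 \<Longrightarrow> \<bar>obs h x\<bar> \<le> c) \<Longrightarrow> lip_sup h \<le> c"
  unfolding lip_sup_def by (rule cSUP_least[OF S2xS1_nonempty])

lemma lip_const_lower: "L-lipschitz_on S2xS1 (obs h) \<Longrightarrow> lip_const h \<le> L"
  unfolding lip_const_def
  by (rule cInf_lower) (auto intro!: bdd_belowI[of _ 0] dest: lipschitz_on_nonneg)

lemma lip_const_lipschitz: "(lip_const h)-lipschitz_on S2xS1 (obs h)"
proof (rule lipschitz_onI)
  let ?A = "{L. L-lipschitz_on S2xS1 (obs h)}"
  have ne: "?A \<noteq> {}" using obs_lipschitz[of h] by blast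
  show "0 \<le> lip_const h"
    unfolding lip_const_def by (rule cInf_greatest[OF ne]) (auto dest: lipschitz_on_nonneg)
  fix x y assume xy: "x \<in> S2xS1" "y \<in> S2xS1"
  show "dist (obs h x) (obs h y) \<le> lip_const h * dist x y"
  proof (cases "x = y")
    case False
    then have d: "dist x y > 0" by simp
    have "dist (obs h x) (obs h y) / dist x y \<le> lip_const h"
      unfolding lip_const_def
    proof (rule cInf_greatest[OF ne])
      fix L assume "L \<in> ?A"
      then have "dist (obs h x) (obs h y) \<le> L * dist x y"
        using xy by (auto dest: lipschitz_onD)
      then show "dist (obs h x) (obs h y) / dist x y \<le> L"
        using d by (simp add: field_simps)
    qed
    then show ?thesis using d by (simp add: field_simps)
  qed simp
qed

instantiation lip_obs :: real_vector
begin

lift_definition zero_lip_obs :: lip_obs is "\<lambda>_. 0"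
  by (auto simp: lipschitz_on_def)

lift_definition plus_lip_obs :: "lip_obs \<Rightarrow> lip_obs \<Rightarrow> lip_obs" is "\<lambda>f g x. f x + g x"
  by (auto intro: lipschitz_on_add)

lift_definition uminus_lip_obs :: "lip_obs \<Rightarrow> lip_obs" is "\<lambda>f x. - f x"
  by (auto simp: lipschitz_on_minus_iff)

lift_definition minus_lip_obs :: "lip_obs \<Rightarrow> lip_obs \<Rightarrow> lip_obs" is "\<lambda>f g x. f x - g x"
  by (auto intro: lipschitz_on_diff)

lift_definition scaleR_lip_obs :: "real \<Rightarrow> lip_obs \<Rightarrow> lip_obs" is "\<lambda>c f x. c * f x"
  by (auto intro: lipschitz_on_cmult_real)

instance
  by standard (transfer; auto simp: algebra_simps fun_eq_iff)+

end

instantiation lip_obs :: real_normed_vector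
begin

definition norm_lip_obs :: "lip_obs \<Rightarrow> real" where
  "norm_lip_obs h = lip_sup h + lip_const h"

definition dist_lip_obs :: "lip_obs \<Rightarrow> lip_obs \<Rightarrow> real" where
  "dist_lip_obs f g = norm (f - g)"

definition sgn_lip_obs :: "lip_obs \<Rightarrow> lip_obs" where
  "sgn_lip_obs h = inverse (norm h) *\<^sub>R h"

definition uniformity_lip_obs :: "(lip_obs \<times> lip_obs) filter" where
  "uniformity_lip_obs = (INF e\<in>{0<..}. principal {(x, y). dist x y < e})"

definition open_lip_obs :: "lip_obs set \<Rightarrow> bool" where
  "open_lip_obs U \<longleftrightarrow> (\<forall>x\<in>U. eventually (\<lambda>(x', y). x' = x \<longrightarrow> y \<in> U) uniformity)"

instance
proof
  fix f g :: lip_obs and c :: real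
  have sup0: "0 \<le> lip_sup h" for h
    using lip_sup_upper[of h undefined] by linarith
  have lip0: "0 \<le> lip_const h" for h
    using lip_const_lipschitz[of h] by (rule lipschitz_on_nonneg)
  show "(norm f = 0) = (f = 0)"
  proof
    assume "norm f = 0"
    then have "lip_sup f = 0" using sup0[of f] lip0[of f] by (simp add: norm_lip_obs_def)
    then have "obs f x = 0" for x using lip_sup_upper[of f x] by simp
    then have "obs f = obs 0" by (simp add: fun_eq_iff zero_lip_obs.rep_eq)
    then show "f = 0" by (simp add: obs_inject)
  next
    assume f: "f = 0"
    have "lip_sup f \<le> 0" by (rule lip_sup_least) (simp add: f zero_lip_obs.rep_eq)
    moreover have "lip_const f \<le> 0"
      by (rule lip_const_lower) (simp add: f zero_lip_obs.rep_eq lipschitz_on_def)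
    ultimately show "norm f = 0" using sup0[of f] lip0[of f] by (simp add: norm_lip_obs_def)
  qed
  have "lip_sup (f + g) \<le> lip_sup f + lip_sup g"
  proof (rule lip_sup_least)
    fix x
    show "\<bar>obs (f + g) x\<bar> \<le> lip_sup f + lip_sup g"
      using lip_sup_upper[of f x] lip_sup_upper[of g x] by (simp add: plus_lip_obs.rep_eq)
  qed
  moreover have "lip_const (f + g) \<le> lip_const f + lip_const g"
    by (rule lip_const_lower, unfold plus_lip_obs.rep_eq)
       (intro lipschitz_on_add lip_const_lipschitz)
  ultimately show "norm (f + g) \<le> norm f + norm g" by (simp add: norm_lip_obs_def)
  have le: "norm (c *\<^sub>R f) \<le> \<bar>c\<bar> * norm f" for c and f :: lip_obs
  proof -
    have "lip_sup (c *\<^sub>R f) \<le> \<bar>c\<bar> * lip_sup f"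
      by (rule lip_sup_least)
         (simp add: scaleR_lip_obs.rep_eq abs_mult mult_left_mono lip_sup_upper)
    moreover have "lip_const (c *\<^sub>R f) \<le> \<bar>c\<bar> * lip_const f"
      by (rule lip_const_lower, unfold scaleR_lip_obs.rep_eq)
         (intro lipschitz_on_cmult_real lip_const_lipschitz)
    ultimately show ?thesis by (simp add: norm_lip_obs_def distrib_left)
  qed
  show "norm (c *\<^sub>R f) = \<bar>c\<bar> * norm f"
  proof (cases "c = 0")
    case True
    have "lip_sup (c *\<^sub>R f) \<ge> 0" "lip_const (c *\<^sub>R f) \<ge> 0" by (rule sup0, rule lip0)
    then have "0 \<le> norm (c *\<^sub>R f)" by (simp add: norm_lip_obs_def)
    then show ?thesis using le[of c f] True by simp
  next
    case False
    have "norm f \<le> \<bar>inverse c\<bar> * norm (c *\<^sub>R f)"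
      using le[of "inverse c" "c *\<^sub>R f"] False by simp
    then have "\<bar>c\<bar> * norm f \<le> norm (c *\<^sub>R f)"
      using False by (simp add: field_simps)
    then show ?thesis using le[of c f] by simp
  qed
qed (rule dist_lip_obs_def sgn_lip_obs_def uniformity_lip_obs_def open_lip_obs_def)+

end

end

(*
  The first factor has coordinates (zeta, z) with |zeta|^2 + z^2 = 1, the second factor is the unit circle of w.
  T lets z decay slowly (1/z^2 grows by about 1 per step) and moves w by a circle map depending on z which for
  z = 0 is the projective action of a parabolic matrix on rays, with fixed points w = 1 and w = -1. For z ~= 0 this
  map is conjugate to the rotation by arctan |z|, so an orbit runs around the w-circle ever more slowly, through
  sojourns near w = 1 and w = -1 of lengths proportional to the square root of time; hence it spends half of its time
  near each of them. The argument of zeta is moved by a disc automorphism depending on w, parabolic for w = 1 (all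
  orbits converge to the fixed point) and an irrational rotation for w = -1. So almost every orbit equidistributes to
  mu = (point mass + length measure of a circle)/2, of information dimension 1/2.

  On this circle T is an irrational rotation, and a generic h is not injective there: if the next value were a
  function of the current one, this function would map an interval continuously to itself, and the orbit of a point over
  one of its fixed points, which is dense, would lie in one level set of h. This yields an interval of values y with two
  preimages whose next values differ. Almost all y in this interval have finite lower density for the law of h,
  and then both preimages keep a positive share of the conditional distribution.
*)
theory Submission
  imports Defs
begin

section \<open>Calculus of \<open>Ck_on\<close>\<close>

text \<open>\<open>mu\<close> is a mixture of two mutually singular invariant measures, and yet it
  has to be the limit of almost every time average. If the sojourns near two invariant sets grew
  geometrically, the averages would oscillate. So the heights are made to decay like
  \<open>1 / sqrt n\<close>: the rotation angles \<open>arctan (k n)\<close> tend to 0, which makes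
  \<open>w\<close> almost stationary over any fixed number of steps, while \<open>n * k n\<close>
  tends to infinity, which makes the phase equidistribute. Over a window of fixed length the orbit
  then mostly follows the dynamics of a limit fibre, from an uncontrolled starting point; therefore
  the averages on both fibres are proved uniformly in the starting point. Half of the mass at a
  point brings the dimension below 1, and the circle with the other half defeats prediction. The
  Lipschitz condition gives each preimage of a value mass at least a multiple of
  \<open>\<epsilon>\<close>, so an upper bound of the same order for the whole window, along one
  sequence of scales, is all that non-predictability asks of the law.\<close>

lemma has_derivative_cong_open:
  assumes "open U" "x \<in> U" "\<And>y. y \<in> U \<Longrightarrow> f y = g y"
  shows "(f has_derivative D) (at x) \<longleftrightarrow> (g has_derivative D) (at x)"
  using has_derivative_transform_within_open[OF _ assms(1,2), of f D UNIV g]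
    has_derivative_transform_within_open[OF _ assms(1,2), of g D UNIV f] assms(3) by auto

lemma Ck_on_cong:
  assumes "open U" "\<And>x. x \<in> U \<Longrightarrow> f x = g x"
  shows "Ck_on k f U \<longleftrightarrow> Ck_on k g U"
  using assms(2)
proof (induction k arbitrary: f g)
  case 0
  then show ?case by (auto cong: continuous_on_cong)
next
  case (Suc k)
  have "f differentiable_on U \<longleftrightarrow> g differentiable_on U"
    using has_derivative_cong_open[OF assms(1) _ Suc.prems]
    by (auto simp: differentiable_on_eq_differentiable_at[OF assms(1)] differentiable_def)
  moreover have "Ck_on k (\<lambda>x. frechet_derivative f (at x) v) U
      \<longleftrightarrow> Ck_on k (\<lambda>x. frechet_derivative g (at x) v) U" for v
    using has_derivative_cong_open[OF assms(1) _ Suc.prems]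
    by (intro Suc.IH) (auto simp: frechet_derivative_def)
  ultimately show ?case by simp
qed

lemma Ck_on_Suc_has_derivative:
  assumes "Ck_on (Suc k) f U" "open U" "x \<in> U"
  shows "(f has_derivative frechet_derivative f (at x)) (at x)"
  using assms by (auto simp: differentiable_on_eq_differentiable_at frechet_derivative_works)

lemma Ck_on_SucI:
  assumes "open U" "\<And>x. x \<in> U \<Longrightarrow> (f has_derivative f' x) (at x)"
    and "\<And>v. Ck_on k (\<lambda>x. f' x v) U"
  shows "Ck_on (Suc k) f U"
proof -
  have "f differentiable_on U"
    using assms(2) by (auto simp: differentiable_on_eq_differentiable_at[OF assms(1)] differentiable_def)
  moreover have "Ck_on k (\<lambda>x. frechet_derivative f (at x) v) U" for v
    using assms(3)[of v] Ck_on_cong[OF assms(1), of "\<lambda>x. f' x v" "\<lambda>x. frechet_derivative f (at x) v" k]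
    by (simp add: frechet_derivative_at[OF assms(2), symmetric])
  ultimately show ?thesis by simp
qed

lemma Ck_on_Suc_imp: "Ck_on (Suc k) f U \<Longrightarrow> Ck_on k f U"
proof (induction k arbitrary: f)
  case 0
  then show ?case by (simp add: differentiable_imp_continuous_on)
next
  case (Suc k)
  then show ?case using Suc.IH by (subst Ck_on.simps(2)) (auto simp del: Ck_on.simps simp: Ck_on.simps(2)[of "Suc k" f])
qed

lemma Ck_on_subset: "Ck_on k f U \<Longrightarrow> V \<subseteq> U \<Longrightarrow> Ck_on k f V"
  by (induction k arbitrary: f) (auto intro: continuous_on_subset differentiable_on_subset)

lemma Ck_on_const: "open U \<Longrightarrow> Ck_on k (\<lambda>_. c) U"
  by (induction k arbitrary: c) (auto intro!: Ck_on_SucI[where f' = "\<lambda>_ _. 0"])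

lemma Ck_on_bounded_linear:
  assumes "open U" "bounded_linear l" "Ck_on k f U"
  shows "Ck_on k (\<lambda>x. l (f x)) U"
  using assms(3)
proof (induction k arbitrary: f)
  case 0
  then show ?case using bounded_linear.continuous_on[OF assms(2)] by simp
next
  case (Suc k)
  show ?case
    by (rule Ck_on_SucI[OF assms(1)
          bounded_linear.has_derivative[OF assms(2) Ck_on_Suc_has_derivative[OF Suc.prems assms(1)]]])
       (use Suc in auto)
qed

lemma Ck_on_ident: "open U \<Longrightarrow> Ck_on k (\<lambda>x. x) U"
  by (cases k) (auto intro!: Ck_on_SucI[where f' = "\<lambda>_ v. v"] Ck_on_const)

lemma Ck_on_linear:
  assumes "open U" "bounded_linear l" shows "Ck_on k l U"
  using Ck_on_bounded_linear[OF assms Ck_on_ident[OF assms(1)]] .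

lemma Ck_on_add:
  assumes "open U" "Ck_on k f U" "Ck_on k g U"
  shows "Ck_on k (\<lambda>x. f x + g x) U"
  using assms(2,3)
proof (induction k arbitrary: f g)
  case 0
  then show ?case by (simp add: continuous_on_add)
next
  case (Suc k)
  show ?case
    by (rule Ck_on_SucI[OF assms(1) has_derivative_add[OF Ck_on_Suc_has_derivative[OF Suc.prems(1) assms(1)]
            Ck_on_Suc_has_derivative[OF Suc.prems(2) assms(1)]]])
       (use Suc in auto)
qed

lemma Ck_on_sum:
  assumes "open U" "\<And>i. i \<in> I \<Longrightarrow> Ck_on k (f i) U"
  shows "Ck_on k (\<lambda>x. \<Sum>i\<in>I. f i x) U"
  using assms(2) by (induction I rule: infinite_finite_induct) (auto intro!: Ck_on_const Ck_on_add assms(1))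

lemma Ck_on_bilinear:
  assumes "open U" "bounded_bilinear b" "Ck_on k f U" "Ck_on k g U"
  shows "Ck_on k (\<lambda>x. b (f x) (g x)) U"
  using assms(3,4)
proof (induction k arbitrary: f g)
  case 0
  then show ?case using bounded_bilinear.continuous_on[OF assms(2)] by simp
next
  case (Suc k)
  show ?case
    by (rule Ck_on_SucI[OF assms(1) bounded_bilinear.FDERIV[OF assms(2)
            Ck_on_Suc_has_derivative[OF Suc.prems(1) assms(1)]
            Ck_on_Suc_has_derivative[OF Suc.prems(2) assms(1)]]])
       (use Suc in \<open>auto intro!: Ck_on_add assms(1) Suc.IH intro: Ck_on_Suc_imp\<close>)
qed

lemmas Ck_on_mult = Ck_on_bilinear[OF _ bounded_bilinear_mult]
lemmas Ck_on_scaleR = Ck_on_bilinear[OF _ bounded_bilinear_scaleR]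

lemma Ck_on_minus: "open U \<Longrightarrow> Ck_on k f U \<Longrightarrow> Ck_on k (\<lambda>x. - f x) U"
  by (rule Ck_on_bounded_linear[OF _ bounded_linear_minus[OF bounded_linear_ident]])

lemma Ck_on_diff:
  "open U \<Longrightarrow> Ck_on k f U \<Longrightarrow> Ck_on k g U \<Longrightarrow> Ck_on k (\<lambda>x. f x - g x) U"
  using Ck_on_add[of U k f "\<lambda>x. - g x"] Ck_on_minus[of U k g] by simp

lemma Ck_on_power:
  fixes f :: "'a::euclidean_space \<Rightarrow> 'b::{euclidean_space,real_normed_field}"
  shows "open U \<Longrightarrow> Ck_on k f U \<Longrightarrow> Ck_on k (\<lambda>x. f x ^ n) U"
  by (induction n) (auto intro!: Ck_on_const Ck_on_mult)

lemma Ck_on_inverse: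
  fixes f :: "'a::euclidean_space \<Rightarrow> 'b::{euclidean_space,real_normed_field}"
  assumes "open U" "Ck_on k f U" "\<And>x. x \<in> U \<Longrightarrow> f x \<noteq> 0"
  shows "Ck_on k (\<lambda>x. inverse (f x)) U"
  using assms(2)
proof (induction k)
  case 0
  then show ?case using assms(3) by (auto intro!: continuous_intros)
next
  case (Suc k)
  show ?case
    by (rule Ck_on_SucI[OF assms(1) Deriv.has_derivative_inverse[OF assms(3)
            Ck_on_Suc_has_derivative[OF Suc.prems(1) assms(1)]]])
       (use Suc.prems in \<open>auto intro!: Ck_on_minus Ck_on_mult assms(1) Suc.IH Ck_on_Suc_imp[OF Suc.prems]\<close>)
qed

lemma Ck_on_divide:
  fixes f g :: "'a::euclidean_space \<Rightarrow> 'b::{euclidean_space,real_normed_field}"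
  assumes "open U" "Ck_on k f U" "Ck_on k g U" "\<And>x. x \<in> U \<Longrightarrow> g x \<noteq> 0"
  shows "Ck_on k (\<lambda>x. f x / g x) U"
  unfolding divide_inverse using assms by (intro Ck_on_mult Ck_on_inverse)

lemma Ck_on_sqrt:
  assumes "open U" "Ck_on k f U" "\<And>x. x \<in> U \<Longrightarrow> f x > 0"
  shows "Ck_on k (\<lambda>x. sqrt (f x)) U"
  using assms(2)
proof (induction k)
  case 0
  then show ?case by (auto intro!: continuous_intros)
next
  case (Suc k)
  have "Ck_on k (\<lambda>x. frechet_derivative f (at x) v * (inverse (sqrt (f x)) / 2)) U" for v
    using Suc.prems assms(1,3)
    by (intro Ck_on_mult Ck_on_divide Ck_on_inverse Ck_on_const Suc.IH Ck_on_Suc_imp[OF Suc.prems])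
       (auto simp: order_less_imp_not_eq2)
  then show ?case
    by (intro Ck_on_SucI[OF assms(1) has_derivative_real_sqrt[OF assms(3)
            Ck_on_Suc_has_derivative[OF Suc.prems(1) assms(1)]]]) auto
qed

text \<open>In the derivative \<open>g' (f x) (f' x v)\<close> of the composition both the base
  point and the direction depend on \<open>x\<close>, while \<open>Ck_on\<close> speaks of fixed
  directions. Expanding \<open>f' x v\<close> in the basis leaves products of coordinates of
  \<open>f'\<close> with \<open>g' (f x) b\<close> for fixed \<open>b\<close>, to which the
  induction hypothesis applies.\<close>

lemma Ck_on_compose:
  assumes "open U" "open V" "f ` U \<subseteq> V" "Ck_on k f U" "Ck_on k g V"
  shows "Ck_on k (\<lambda>x. g (f x)) U"
  using assms(4,5)
proof (induction k arbitrary: g)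
  case 0
  then show ?case using assms(3) by (auto intro: continuous_on_compose2)
next
  case (Suc k)
  let ?f' = "\<lambda>x. frechet_derivative f (at x)" and ?g' = "\<lambda>x. frechet_derivative g (at x)"
  have "(g has_derivative ?g' (f x)) (at (f x))" if "x \<in> U" for x
    using Ck_on_Suc_has_derivative[OF Suc.prems(2) assms(2)] assms(3) that by auto
  then have d: "((\<lambda>x. g (f x)) has_derivative (\<lambda>v. ?g' (f x) (?f' x v))) (at x)" if "x \<in> U" for x
    using has_derivative_compose[OF Ck_on_Suc_has_derivative[OF Suc.prems(1) assms(1) that]] that by blast
  show ?case
  proof (rule Ck_on_SucI[OF assms(1) d])
    fix v
    have "Ck_on k (\<lambda>x. \<Sum>b\<in>Basis. (?f' x v \<bullet> b) *\<^sub>R ?g' (f x) b) U"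
    proof (intro Ck_on_sum Ck_on_scaleR assms(1))
      fix b :: 'b
      show "Ck_on k (\<lambda>x. ?f' x v \<bullet> b) U"
        using Suc.prems(1) by (intro Ck_on_bounded_linear[OF assms(1) bounded_linear_inner_left]) simp
      show "Ck_on k (\<lambda>x. ?g' (f x) b) U"
        using Suc.prems by (intro Suc.IH Ck_on_Suc_imp[OF Suc.prems(1)]) simp
    qed
    moreover have "?g' (f x) (?f' x v) = (\<Sum>b\<in>Basis. (?f' x v \<bullet> b) *\<^sub>R ?g' (f x) b)" if "x \<in> U" for x
    proof -
      have "linear (?g' (f x))"
        using Ck_on_Suc_has_derivative[OF Suc.prems(2) assms(2), of "f x"] assms(3) that
        by (auto intro: has_derivative_linear)
      then have "?g' (f x) (\<Sum>b\<in>Basis. (?f' x v \<bullet> b) *\<^sub>R b) = (\<Sum>b\<in>Basis. (?f' x v \<bullet> b) *\<^sub>R ?g' (f x) b)"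
        by (simp add: linear_sum linear_scale)
      then show ?thesis by (simp add: euclidean_representation)
    qed
    ultimately show "Ck_on k (\<lambda>x. ?g' (f x) (?f' x v)) U"
      by (subst Ck_on_cong[OF assms(1)]) auto
  qed
qed

lemma smooth_map_on_compose:
  assumes f: "smooth_map_on X f" "f ` X \<subseteq> Y" and g: "smooth_map_on Y g"
  shows "smooth_map_on X (g \<circ> f)"
  unfolding smooth_map_on_def
proof
  fix x assume x: "x \<in> X"
  from f(1) x obtain U F where U: "open U" "x \<in> U" "\<And>k. Ck_on k F U" "\<And>y. y \<in> X \<inter> U \<Longrightarrow> F y = f y"
    unfolding smooth_map_on_def by metis
  from g f(2) x obtain V G where V: "open V" "f x \<in> V" "\<And>k. Ck_on k G V" "\<And>y. y \<in> Y \<inter> V \<Longrightarrow> G y = g y"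
    unfolding smooth_map_on_def by (metis image_subset_iff)
  let ?W = "U \<inter> F -` V"
  have W: "open ?W"
    using U(3)[of 0] U(1) V(1) by (simp add: continuous_open_preimage)
  have "Ck_on k (\<lambda>x. G (F x)) ?W" for k
    by (rule Ck_on_compose[OF W V(1) _ Ck_on_subset[OF U(3)] V(3)]) auto
  moreover have "x \<in> ?W" using U V(2) x by auto
  moreover have "G (F y) = (g \<circ> f) y" if "y \<in> X \<inter> ?W" for y
    using U(4)[of y] V(4)[of "f y"] that f(2) by auto
  ultimately show "\<exists>U F. open U \<and> x \<in> U \<and> (\<forall>k. Ck_on k F U) \<and> (\<forall>y\<in>X \<inter> U. F y = (g \<circ> f) y)"
    using W by blast
qed

lemma smooth_map_onI:
  assumes "open U" "X \<subseteq> U" "\<And>k. Ck_on k f U"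
  shows "smooth_map_on X f"
  unfolding smooth_map_on_def using assms by blast

lemma smooth_map_on_cong: "(\<And>x. x \<in> X \<Longrightarrow> f x = g x) \<Longrightarrow> smooth_map_on X f \<Longrightarrow> smooth_map_on X g"
  unfolding smooth_map_on_def by (metis IntD1)

lemma smooth_diffeo_onI:
  assumes "smooth_map_on X f" "smooth_map_on X g" "f ` X \<subseteq> X" "g ` X \<subseteq> X"
    and gf: "\<And>x. x \<in> X \<Longrightarrow> g (f x) = x" and fg: "\<And>x. x \<in> X \<Longrightarrow> f (g x) = x"
  shows "smooth_diffeo_on X f"
proof -
  have bij: "bij_betw f X X"
    using assms(3,4) gf fg by (intro bij_betwI[where g = g]) auto
  moreover have "g x = inv_into X f x" if "x \<in> X" for x
    using that assms(4) fg bij by (metis bij_betw_inv_into_left image_subset_iff)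
  ultimately show ?thesis
    unfolding smooth_diffeo_on_def using assms(1) smooth_map_on_cong[OF _ assms(2)] by blast
qed

lemma smooth_diffeo_on_compose:
  assumes "smooth_diffeo_on X f" "smooth_diffeo_on X g"
  shows "smooth_diffeo_on X (g \<circ> f)"
proof -
  have fX: "bij_betw f X X" "bij_betw g X X" using assms by (auto simp: smooth_diffeo_on_def)
  show ?thesis
  proof (rule smooth_diffeo_onI[where g = "inv_into X f \<circ> inv_into X g"])
    have i: "inv_into X f ` X \<subseteq> X" "inv_into X g ` X \<subseteq> X" "f ` X \<subseteq> X" "g ` X \<subseteq> X"
      using fX bij_betw_inv_into[of f X X] bij_betw_inv_into[of g X X] by (auto simp: bij_betw_def)
    show "smooth_map_on X (g \<circ> f)" "smooth_map_on X (inv_into X f \<circ> inv_into X g)"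
      using assms i by (auto simp: smooth_diffeo_on_def intro!: smooth_map_on_compose[where Y = X])
    show "(g \<circ> f) ` X \<subseteq> X" "(inv_into X f \<circ> inv_into X g) ` X \<subseteq> X" using i by (auto simp: image_subset_iff)
    show "(inv_into X f \<circ> inv_into X g) ((g \<circ> f) x) = x" if "x \<in> X" for x
      using that fX i by (simp add: bij_betw_inv_into_left image_subset_iff)
    show "(g \<circ> f) ((inv_into X f \<circ> inv_into X g) x) = x" if "x \<in> X" for x
      using that fX i by (simp add: bij_betw_inv_into_right image_subset_iff)
  qed
qed

lemma smooth_map_on_imp_continuous_on:
  assumes "smooth_map_on X f" shows "continuous_on X f"
  unfolding continuous_on_topological
proof (intro ballI allI impI)
  fix x B assume x: "x \<in> X" and B: "open B" "f x \<in> B"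
  from assms x obtain U F where U: "open U" "x \<in> U" "\<And>k. Ck_on k F U" "\<And>y. y \<in> X \<inter> U \<Longrightarrow> F y = f y"
    unfolding smooth_map_on_def by metis
  have "open (U \<inter> F -` B)"
    using U(3)[of 0] U(1) B(1) by (simp add: continuous_open_preimage)
  moreover have "x \<in> U \<inter> F -` B" using U x B by auto
  moreover have "\<forall>y\<in>X. y \<in> U \<inter> F -` B \<longrightarrow> f y \<in> B" using U(4) by auto
  ultimately show "\<exists>A. open A \<and> x \<in> A \<and> (\<forall>y\<in>X. y \<in> A \<longrightarrow> f y \<in> B)" by blast
qed

section \<open>Equidistribution on the circle\<close>

abbreviation circle :: "complex set" where "circle \<equiv> sphere 0 1"

definition circle_measure :: "complex measure" where
  "circle_measure = distr (uniform_measure lborel {0..<2*pi}) borel cis"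

lemma measurable_cis [measurable]: "cis \<in> borel_measurable borel"
  by (intro borel_measurable_continuous_onI continuous_intros)

lemma sets_circle_measure [simp, measurable_cong]: "sets circle_measure = sets borel"
  by (simp add: circle_measure_def)

lemma space_circle_measure [simp]: "space circle_measure = UNIV"
  by (simp add: circle_measure_def)

lemma emeasure_circle_measure:
  assumes [measurable]: "A \<in> sets borel"
  shows "emeasure circle_measure A = emeasure lborel ({0..<2*pi} \<inter> cis -` A) / ennreal (2*pi)"
proof -
  have [measurable]: "cis -` A \<in> sets borel"
    using measurable_sets[OF measurable_cis assms] by simp
  show ?thesis
    by (simp add: circle_measure_def emeasure_distr)
qed

lemma prob_space_circle_measure: "prob_space circle_measure"
  unfolding circle_measure_def
  by (intro prob_space.prob_space_distr prob_space_uniform_measure) auto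

interpretation circle: prob_space circle_measure
  by (rule prob_space_circle_measure)

lemma emeasure_lborel_translate:
  fixes c :: real
  assumes [measurable]: "S \<in> sets borel"
  shows "emeasure lborel ((\<lambda>t. c + t) -` S) = emeasure lborel S"
proof -
  have "emeasure lborel S = emeasure (distr lborel borel ((+) c)) S" by (simp add: lborel_distr_plus)
  also have "\<dots> = emeasure lborel ((\<lambda>t. c + t) -` S)" by (simp add: emeasure_distr)
  finally show ?thesis by simp
qed

text \<open>A rotation by \<open>a\<close> shifts the parameter interval to
  \<open>{a..<a + 2*pi}\<close>; the piece beyond \<open>2*pi\<close> is brought back by a period
  and fills up \<open>{0..<a}\<close>.\<close>

lemma circle_measure_rotate:
  assumes "norm u = 1"
  shows "distr circle_measure borel (\<lambda>z. u * z) = circle_measure"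
proof (rule measure_eqI)
  fix A assume "A \<in> sets (distr circle_measure borel (\<lambda>z. u * z))"
  then have A[measurable]: "A \<in> sets borel" by simp
  obtain a where a: "u = cis a" "0 \<le> a" "a < 2*pi"
    using Arg2pi_eq[of u] Arg2pi_ge_0[of u] Arg2pi_lt_2pi[of u] assms by (simp add: cis_conv_exp that)
  have B[measurable]: "cis -` A \<in> sets borel"
    using measurable_sets[OF measurable_cis A] by simp
  have uA[measurable]: "(\<lambda>z. u * z) -` A \<in> sets borel"
  proof -
    have "(\<lambda>z. u * z) \<in> borel_measurable borel" by measurable
    from measurable_sets[OF this A] show ?thesis by simp
  qed
  let ?B = "cis -` A"
  have per: "t + 2*pi \<in> ?B \<longleftrightarrow> t \<in> ?B" for t
    by (simp add: cis_mult[symmetric])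
  have "emeasure lborel ({0..<2*pi} \<inter> cis -` ((\<lambda>z. u * z) -` A))
      = emeasure lborel ((\<lambda>t. a + t) -` ({a..<a + 2*pi} \<inter> ?B))"
    by (rule arg_cong[where f = "emeasure lborel"]) (auto simp: a cis_mult)
  also have "\<dots> = emeasure lborel ({a..<a + 2*pi} \<inter> ?B)"
    by (rule emeasure_lborel_translate) measurable
  also have "{a..<a + 2*pi} \<inter> ?B = ({a..<2*pi} \<inter> ?B) \<union> ({2*pi..<a+2*pi} \<inter> ?B)"
    using a by auto
  also have "emeasure lborel \<dots> = emeasure lborel ({a..<2*pi} \<inter> ?B) + emeasure lborel ({2*pi..<a+2*pi} \<inter> ?B)"
    by (subst plus_emeasure) auto
  also have "emeasure lborel ({2*pi..<a+2*pi} \<inter> ?B) = emeasure lborel ((\<lambda>t. 2*pi + t) -` ({2*pi..<a+2*pi} \<inter> ?B))"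
    by (rule emeasure_lborel_translate[symmetric]) measurable
  also have "(\<lambda>t. 2*pi + t) -` ({2*pi..<a+2*pi} \<inter> ?B) = {0..<a} \<inter> ?B"
    using per by (auto simp: add.commute)
  also have "emeasure lborel ({a..<2*pi} \<inter> ?B) + emeasure lborel ({0..<a} \<inter> ?B)
      = emeasure lborel (({a..<2*pi} \<inter> ?B) \<union> ({0..<a} \<inter> ?B))"
    by (subst plus_emeasure) auto
  also have "({a..<2*pi} \<inter> ?B) \<union> ({0..<a} \<inter> ?B) = {0..<2*pi} \<inter> ?B"
    using a by auto
  finally show "emeasure (distr circle_measure borel (\<lambda>z. u * z)) A = emeasure circle_measure A"
    by (simp add: emeasure_distr emeasure_circle_measure)
qed simp

lemma emeasure_circle: "emeasure circle_measure circle = 1"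
proof -
  have "{0..<2*pi} \<inter> cis -` circle = {0..<2*pi}" by auto
  then show ?thesis by (simp add: emeasure_circle_measure ennreal_divide_self)
qed

lemma AE_circle: "AE z in circle_measure. z \<in> circle"
  using circle.AE_in_set_eq_1[of circle] emeasure_circle by (simp add: measure_def)

text \<open>A set integral, because the integrands are only known to be continuous on the circle and
  may be arbitrary off it.\<close>

definition circle_mean :: "(complex \<Rightarrow> 'a::{banach,second_countable_topology}) \<Rightarrow> 'a" where
  "circle_mean f = (LINT z:circle|circle_measure. f z)"

lemma set_integrable_circle:
  fixes f :: "complex \<Rightarrow> 'a::euclidean_space"
  assumes "continuous_on circle f"
  shows "set_integrable circle_measure circle f"
  unfolding set_integrable_def
proof -
  have m: "(\<lambda>z. indicator circle z *\<^sub>R f z) \<in> borel_measurable circle_measure"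
    using borel_measurable_continuous_on_indicator[OF _ assms] by simp
  have "bounded (f ` circle)"
    by (intro compact_imp_bounded compact_continuous_image assms compact_sphere)
  then obtain B where B: "\<And>z. z \<in> circle \<Longrightarrow> norm (f z) \<le> B" unfolding bounded_iff by blast
  show "integrable circle_measure (\<lambda>z. indicator circle z *\<^sub>R f z)"
  proof (rule circle.integrable_const_bound[OF _ m])
    show "AE z in circle_measure. norm (indicator circle z *\<^sub>R f z) \<le> max B 0"
      using B by (auto simp: indicator_def intro!: AE_I2 max.coboundedI1)
  qed
qed

lemma circle_mean_add:
  fixes f g :: "complex \<Rightarrow> 'a::euclidean_space"
  assumes "continuous_on circle f" "continuous_on circle g"
  shows "circle_mean (\<lambda>z. f z + g z) = circle_mean f + circle_mean g"
  unfolding circle_mean_def using assms by (intro set_integral_add set_integrable_circle)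

lemma circle_mean_const: "circle_mean (\<lambda>_. c) = (c::'a::euclidean_space)"
  using emeasure_circle by (simp add: circle_mean_def set_lebesgue_integral_def measure_def)

lemma circle_mean_mono:
  assumes "continuous_on circle f" "continuous_on circle g" "\<And>z. norm z = 1 \<Longrightarrow> f z \<le> (g z :: real)"
  shows "circle_mean f \<le> circle_mean g"
  unfolding circle_mean_def using assms by (intro set_integral_mono set_integrable_circle) auto

lemma circle_mean_bounded_linear:
  fixes f :: "complex \<Rightarrow> 'a::euclidean_space" and l :: "'a \<Rightarrow> 'b::euclidean_space"
  assumes "bounded_linear l" "continuous_on circle f"
  shows "circle_mean (\<lambda>z. l (f z)) = l (circle_mean f)"
proof -
  interpret bounded_linear l by fact
  have "circle_mean (\<lambda>z. l (f z)) = (LINT z|circle_measure. l (indicator circle z *\<^sub>R f z))"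
    by (simp add: circle_mean_def set_lebesgue_integral_def scale)
  also have "\<dots> = l (circle_mean f)"
    using integral_bounded_linear[OF assms(1) set_integrable_circle[OF assms(2), unfolded set_integrable_def]]
    by (simp add: circle_mean_def set_lebesgue_integral_def)
  finally show ?thesis .
qed

lemma circle_mean_rotate:
  fixes f :: "complex \<Rightarrow> 'a::euclidean_space"
  assumes "norm u = 1" "continuous_on circle f"
  shows "circle_mean (\<lambda>z. f (u * z)) = circle_mean f"
proof -
  have m: "(\<lambda>z. indicator circle z *\<^sub>R f z) \<in> borel_measurable borel"
    using borel_measurable_continuous_on_indicator[OF _ assms(2)] by simp
  have "circle_mean f = (LINT z|distr circle_measure borel (\<lambda>z. u * z). indicator circle z *\<^sub>R f z)"
    by (simp add: circle_measure_rotate assms(1) circle_mean_def set_lebesgue_integral_def)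
  also have "\<dots> = (LINT z|circle_measure. indicator circle (u * z) *\<^sub>R f (u * z))"
    by (rule integral_distr[OF _ m]) measurable
  also have "\<dots> = circle_mean (\<lambda>z. f (u * z))"
    using assms(1) by (simp add: circle_mean_def set_lebesgue_integral_def indicator_def norm_mult)
  finally show ?thesis by simp
qed

text \<open>The rotation by \<open>cis (pi / j)\<close> preserves the mean and changes the sign of
  \<open>z ^ j\<close>.\<close>

lemma circle_mean_power:
  assumes "j > 0" shows "circle_mean (\<lambda>z. z ^ j) = 0"
proof -
  have "circle_mean (\<lambda>z. z ^ j) = circle_mean (\<lambda>z. (cis (pi / j) * z) ^ j)"
    by (rule circle_mean_rotate[symmetric]) (auto intro!: continuous_intros)
  also have "\<dots> = circle_mean (\<lambda>z. - (z ^ j))"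
  proof -
    have "cis (pi / real j) ^ j = -1" using assms by (simp add: Complex.DeMoivre)
    then show ?thesis by (simp add: power_mult_distrib)
  qed
  also have "\<dots> = - circle_mean (\<lambda>z. z ^ j)"
    by (rule circle_mean_bounded_linear[OF bounded_linear_minus[OF bounded_linear_ident]]) (auto intro!: continuous_intros)
  finally show ?thesis by simp
qed

text \<open>On the circle these are the real trigonometric polynomials: a negative power is the
  conjugate of a positive one, so real parts of nonnegative powers with complex coefficients
  generate all of them.\<close>

inductive trig_poly :: "(complex \<Rightarrow> real) \<Rightarrow> bool" where
  mono: "trig_poly (\<lambda>z. Re (a * z ^ j))"
| add: "trig_poly f \<Longrightarrow> trig_poly g \<Longrightarrow> trig_poly (\<lambda>z. f z + g z)"

text \<open>\<open>Re p * Re q = (Re (p * q) + Re (p * cnj q)) / 2\<close>. On the circle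
  \<open>p * cnj q\<close> is again a multiple of a power of \<open>z\<close>, and it is conjugated
  under \<open>Re\<close> if the exponent would be negative.\<close>

lemma trig_poly_mult_mono:
  "\<exists>h. trig_poly h \<and> (\<forall>z. norm z = 1 \<longrightarrow> h z = Re (a * z ^ i) * Re (b * z ^ j))"
proof -
  have "\<exists>c k. \<forall>z. norm z = 1 \<longrightarrow> Re (a * z ^ i * cnj (b * z ^ j)) = Re (c * z ^ k)"
  proof (cases "i \<ge> j")
    case True
    have "Re (a * z ^ i * cnj (b * z ^ j)) = Re (a * cnj b * z ^ (i - j))" if "norm z = 1" for z
    proof -
      have "z ^ i * cnj (z ^ j) = z ^ (i - j) * (z ^ j * cnj (z ^ j))"
        using True by (simp add: mult.assoc[symmetric] power_add[symmetric])
      also have "z ^ j * cnj (z ^ j) = 1"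
        using that complex_norm_square[of "z ^ j"] by (simp add: norm_power)
      finally show ?thesis by (simp add: mult.assoc mult.left_commute)
    qed
    then show ?thesis by blast
  next
    case False
    have "Re (a * z ^ i * cnj (b * z ^ j)) = Re (cnj a * b * z ^ (j - i))" if "norm z = 1" for z
    proof -
      have "z ^ j * cnj (z ^ i) = z ^ (j - i) * (z ^ i * cnj (z ^ i))"
        using False by (simp add: mult.assoc[symmetric] power_add[symmetric])
      also have "z ^ i * cnj (z ^ i) = 1"
        using that complex_norm_square[of "z ^ i"] by (simp add: norm_power)
      finally have e: "z ^ j * cnj (z ^ i) = z ^ (j - i)" by simp
      have "Re (a * z ^ i * cnj (b * z ^ j)) = Re (cnj (a * z ^ i * cnj (b * z ^ j)))" by (simp only: cnj.simps)
      also have "cnj (a * z ^ i * cnj (b * z ^ j)) = cnj a * b * (z ^ j * cnj (z ^ i))"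
        by (simp add: mult_ac)
      finally show ?thesis by (simp only: e)
    qed
    then show ?thesis by blast
  qed
  then obtain c k where ck: "\<And>z. norm z = 1 \<Longrightarrow> Re (a * z ^ i * cnj (b * z ^ j)) = Re (c * z ^ k)" by blast
  have "Re (a * b / 2 * z ^ (i + j)) + Re (c / 2 * z ^ k) = Re (a * z ^ i) * Re (b * z ^ j)" if "norm z = 1" for z
  proof -
    have "Re p * Re q = Re (p * q / 2) + Re (p * cnj q / 2)" for p q by (simp add: field_simps)
    from this[of "a * z ^ i" "b * z ^ j"] show ?thesis
      using ck[OF that] by (simp add: power_add mult_ac)
  qed
  then show ?thesis
    using trig_poly.add[OF trig_poly.mono[of "a * b / 2" "i + j"] trig_poly.mono[of "c / 2" k]] by blast
qed

lemma trig_poly_mult: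
  assumes "trig_poly f" "trig_poly g"
  shows "\<exists>h. trig_poly h \<and> (\<forall>z. norm z = 1 \<longrightarrow> h z = f z * g z)"
  using assms
proof (induction f)
  case (mono a i)
  show ?case using mono
  proof (induction g)
    case (mono b j)
    show ?case by (rule trig_poly_mult_mono)
  next
    case (add g1 g2)
    then obtain h1 h2 where "trig_poly h1" "trig_poly h2"
      "\<forall>z. norm z = 1 \<longrightarrow> h1 z = Re (a * z ^ i) * g1 z" "\<forall>z. norm z = 1 \<longrightarrow> h2 z = Re (a * z ^ i) * g2 z" by blast
    then show ?case by (intro exI[of _ "\<lambda>z. h1 z + h2 z"] conjI trig_poly.add) (auto simp: distrib_left)
  qed
next
  case (add f1 f2)
  then obtain h1 h2 where "trig_poly h1" "trig_poly h2"
    "\<forall>z. norm z = 1 \<longrightarrow> h1 z = f1 z * g z" "\<forall>z. norm z = 1 \<longrightarrow> h2 z = f2 z * g z" by blast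
  then show ?case by (intro exI[of _ "\<lambda>z. h1 z + h2 z"] conjI trig_poly.add) (auto simp: distrib_right)
qed

lemma real_polynomial_trig_poly:
  assumes "real_polynomial_function f"
  shows "\<exists>h. trig_poly h \<and> (\<forall>z. norm z = 1 \<longrightarrow> h z = f z)"
  using assms
proof induction
  case (linear f)
  \<comment> \<open>A real-linear functional on the plane is the real part of a multiplication:
    \<open>Re ((a - \<i> * b) * z) = a * Re z + b * Im z\<close>.\<close>
  have e: "f z = Re ((of_real (f 1) - \<i> * of_real (f \<i>)) * z ^ 1)" for z
  proof -
    have "z = Re z *\<^sub>R 1 + Im z *\<^sub>R \<i>" by (simp add: complex_eq_iff)
    then have "f z = f (Re z *\<^sub>R 1 + Im z *\<^sub>R \<i>)" by metis
    also have "\<dots> = Re z * f 1 + Im z * f \<i>"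
      using linear by (simp add: linear_add linear_scale bounded_linear.linear)
    finally show ?thesis by simp
  qed
  show ?case
    by (intro exI[of _ "\<lambda>z. Re ((of_real (f 1) - \<i> * of_real (f \<i>)) * z ^ 1)"] conjI trig_poly.mono
        allI impI e[symmetric])
next
  case (const c)
  show ?case by (intro exI[of _ "\<lambda>z. Re (of_real c * z ^ 0)"] conjI trig_poly.mono) simp
next
  case (add f g)
  then obtain h1 h2 where "trig_poly h1" "trig_poly h2"
    "\<forall>z. norm z = 1 \<longrightarrow> h1 z = f z" "\<forall>z. norm z = 1 \<longrightarrow> h2 z = g z" by blast
  then show ?case by (intro exI[of _ "\<lambda>z. h1 z + h2 z"] conjI trig_poly.add) auto
next
  case (mult f g)
  then obtain h1 h2 where "trig_poly h1" "trig_poly h2"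
    "\<forall>z. norm z = 1 \<longrightarrow> h1 z = f z" "\<forall>z. norm z = 1 \<longrightarrow> h2 z = g z" by blast
  moreover from this(1,2) obtain h where "trig_poly h" "\<forall>z. norm z = 1 \<longrightarrow> h z = h1 z * h2 z"
    using trig_poly_mult by blast
  ultimately show ?case by (intro exI[of _ h] conjI) auto
qed

lemma trig_poly_approx:
  assumes "continuous_on circle f" "\<epsilon> > 0"
  obtains g where "trig_poly g" "\<And>z. norm z = 1 \<Longrightarrow> \<bar>f z - g z\<bar> < \<epsilon>"
proof -
  obtain p where p: "real_polynomial_function p" "\<And>z. z \<in> circle \<Longrightarrow> \<bar>f z - p z\<bar> < \<epsilon>"
    using Stone_Weierstrass_real_polynomial_function[OF compact_sphere assms(1,2)] by auto
  with real_polynomial_trig_poly[OF p(1)] show ?thesis using that by (metis dist_0_norm mem_sphere)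
qed

lemma continuous_on_trig_poly: "trig_poly g \<Longrightarrow> continuous_on S g"
  by (induction rule: trig_poly.induct) (auto intro!: continuous_intros)

text \<open>The Weyl criterion, uniformly over a family of sequences.\<close>

lemma trig_poly_equidistribution:
  fixes e :: "'s \<Rightarrow> nat \<Rightarrow> complex"
  assumes chars: "\<And>j. j > 0 \<Longrightarrow> uniform_limit S (\<lambda>n s. (\<Sum>i<n. e s i ^ j) / of_nat n) (\<lambda>_. 0) sequentially"
    and "trig_poly g"
  shows "uniform_limit S (\<lambda>n s. (\<Sum>i<n. g (e s i)) / real n) (\<lambda>_. circle_mean g) sequentially"
  using assms(2)
proof induction
  case (mono a j)
  have bl: "bounded_linear (\<lambda>w. Re (a * w))"
    by (intro bounded_linear_compose[OF bounded_linear_Re] bounded_linear_mult_right)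
  show ?case
  proof (cases "j = 0")
    case True
    have "\<forall>\<^sub>F n in sequentially. \<forall>s\<in>S. (\<Sum>i<n. Re (a * e s i ^ j)) / real n = Re a"
      using eventually_gt_at_top[of "0::nat"] by eventually_elim (simp add: True)
    then show ?thesis
      unfolding uniform_limit_iff
      by (intro allI impI, elim eventually_mono) (simp add: True circle_mean_const)
  next
    case False
    have "circle_mean (\<lambda>z. Re (a * z ^ j)) = Re (a * circle_mean (\<lambda>z. z ^ j))"
      by (rule circle_mean_bounded_linear[OF bl]) (auto intro!: continuous_intros)
    also have "\<dots> = 0" using False by (simp add: circle_mean_power)
    finally have z: "circle_mean (\<lambda>z. Re (a * z ^ j)) = 0" .
    have "uniform_limit S (\<lambda>n s. Re (a * ((\<Sum>i<n. e s i ^ j) / of_nat n))) (\<lambda>s. Re (a * 0)) sequentially"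
      by (rule bounded_linear.uniform_limit[OF bl chars]) (use False in simp)
    moreover have "Re (a * ((\<Sum>i<n. e s i ^ j) / of_nat n)) = (\<Sum>i<n. Re (a * e s i ^ j)) / real n" for n s
    proof -
      have "a * ((\<Sum>i<n. e s i ^ j) / of_nat n) = (\<Sum>i<n. a * e s i ^ j) / of_real (real n)"
        by (simp add: sum_distrib_left)
      then show ?thesis by (simp only: Re_divide_of_real Re_sum)
    qed
    ultimately show ?thesis unfolding z by (simp only: mult_zero_right zero_complex.sel)
  qed
next
  case (add f g)
  have "uniform_limit S (\<lambda>n s. (\<Sum>i<n. f (e s i)) / real n + (\<Sum>i<n. g (e s i)) / real n)
      (\<lambda>_. circle_mean f + circle_mean g) sequentially"
    by (intro uniform_limit_add add.IH)
  then show ?case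
    using add.hyps by (simp add: sum.distrib add_divide_distrib circle_mean_add continuous_on_trig_poly)
qed

text \<open>The approximation by trigonometric polynomials is uniform on the circle, so uniformity
  in the parameter \<open>s\<close> survives. The parameter is the starting point for the rotation
  by \<open>lam\<close>; for a slowly rotating orbit it ranges over a single point.\<close>

lemma circle_equidistribution:
  fixes e :: "'s \<Rightarrow> nat \<Rightarrow> complex"
  assumes chars: "\<And>j. j > 0 \<Longrightarrow> uniform_limit S (\<lambda>n s. (\<Sum>i<n. e s i ^ j) / of_nat n) (\<lambda>_. 0) sequentially"
    and norm: "\<And>s i. s \<in> S \<Longrightarrow> norm (e s i) = 1"
    and f: "continuous_on circle f"
  shows "uniform_limit S (\<lambda>n s. (\<Sum>i<n. f (e s i)) / real n) (\<lambda>_. circle_mean f) sequentially"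
  unfolding uniform_limit_iff
proof (intro allI impI)
  fix \<epsilon> :: real assume \<epsilon>: "\<epsilon> > 0"
  obtain g where g: "trig_poly g" "\<And>z. norm z = 1 \<Longrightarrow> \<bar>f z - g z\<bar> < \<epsilon> / 4"
    using trig_poly_approx[OF f, of "\<epsilon> / 4"] \<epsilon> by auto
  have fg: "\<bar>circle_mean f - circle_mean g\<bar> \<le> \<epsilon> / 4"
  proof -
    have c: "continuous_on circle g" using g(1) by (rule continuous_on_trig_poly)
    have "circle_mean f \<le> circle_mean (\<lambda>z. g z + \<epsilon> / 4)"
      using f c
    proof (intro circle_mean_mono continuous_intros)
      show "f z \<le> g z + \<epsilon> / 4" if "norm z = 1" for z using g(2)[OF that] by linarith
    qed
    moreover have "circle_mean g \<le> circle_mean (\<lambda>z. f z + \<epsilon> / 4)"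
      using f c
    proof (intro circle_mean_mono continuous_intros)
      show "g z \<le> f z + \<epsilon> / 4" if "norm z = 1" for z using g(2)[OF that] by linarith
    qed
    ultimately show ?thesis
      unfolding circle_mean_add[OF f continuous_on_const] circle_mean_add[OF c continuous_on_const] circle_mean_const
      by linarith
  qed
  have "\<forall>\<^sub>F n in sequentially. \<forall>s\<in>S. dist ((\<Sum>i<n. g (e s i)) / real n) (circle_mean g) < \<epsilon> / 4"
    using uniform_limitD[OF trig_poly_equidistribution[OF chars g(1)], of "\<epsilon> / 4"] \<epsilon> by simp
  then show "\<forall>\<^sub>F n in sequentially. \<forall>s\<in>S. dist ((\<Sum>i<n. f (e s i)) / real n) (circle_mean f) < \<epsilon>"
    using eventually_gt_at_top[of 0]
  proof eventually_elim
    case (elim n)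
    show ?case
    proof
      fix s assume s: "s \<in> S"
      have "\<bar>(\<Sum>i<n. f (e s i)) - (\<Sum>i<n. g (e s i))\<bar> \<le> (\<Sum>i<n. \<bar>f (e s i) - g (e s i)\<bar>)"
        by (simp add: sum_subtractf[symmetric] sum_abs)
      also have "\<dots> \<le> (\<Sum>i<n. \<epsilon> / 4)"
        using g(2) norm[OF s] by (intro sum_mono) (simp add: less_imp_le)
      finally have "\<bar>(\<Sum>i<n. f (e s i)) / real n - (\<Sum>i<n. g (e s i)) / real n\<bar> \<le> \<epsilon> / 4"
        using elim(2) by (simp add: diff_divide_distrib[symmetric] abs_divide pos_divide_le_eq mult.commute)
      moreover have "\<bar>(\<Sum>i<n. g (e s i)) / real n - circle_mean g\<bar> < \<epsilon> / 4"
        using elim(1) s by (simp add: dist_real_def)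
      ultimately show "dist ((\<Sum>i<n. f (e s i)) / real n) (circle_mean f) < \<epsilon>"
        using fg \<epsilon> unfolding dist_real_def by linarith
    qed
  qed
qed

text \<open>This is \<open>(2 + i) / (2 - i)\<close>, a point of the circle with rational
  coordinates and infinite order. Together with \<open>par 1 = i / (2 + i)\<close> it makes
  \<open>mob lam (par 1)\<close> on the circle the parabolic map
  \<open>((2 + i) t - i) / ((2 - i) + i t)\<close>.\<close>

definition lam :: complex where "lam = Complex (3/5) (4/5)"

lemma norm_lam [simp]: "norm lam = 1"
  by (simp add: lam_def cmod_def power2_eq_square)

text \<open>The numerators of \<open>lam ^ n\<close> are congruent to 3 and 4 modulo 5.\<close>

lemma lam_power_neq_1:
  assumes "n > 0" shows "lam ^ n \<noteq> 1"
proof -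
  have *: "\<exists>p q. 5 ^ Suc n * lam ^ Suc n = Complex (of_int (5 * p + 3)) (of_int (5 * q + 4))" for n
  proof (induction n)
    case 0
    show ?case by (intro exI[of _ 0]) (simp add: lam_def complex_eq_iff)
  next
    case (Suc n)
    then obtain p q where pq: "5 ^ Suc n * lam ^ Suc n = Complex (of_int (5 * p + 3)) (of_int (5 * q + 4))"
      by blast
    have "5 ^ Suc (Suc n) * lam ^ Suc (Suc n) = (5 * lam) * (5 ^ Suc n * lam ^ Suc n)" by simp
    also have "\<dots> = Complex (of_int (5 * (3*p-4*q-2) + 3)) (of_int (5 * (4*p+3*q+4) + 4))"
      unfolding pq by (simp add: lam_def complex_eq_iff)
    finally show ?case by blast
  qed
  obtain m where m: "n = Suc m" using assms gr0_conv_Suc by blast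
  obtain p q where pq: "5 ^ n * lam ^ n = Complex (of_int (5 * p + 3)) (of_int (5 * q + 4))"
    unfolding m using *[of m] by blast
  show ?thesis
  proof
    assume "lam ^ n = 1"
    with pq have "complex_of_real (5 ^ n) = Complex (of_int (5 * p + 3)) (of_int (5 * q + 4))" by simp
    then have "5 * q + 4 = 0" by (simp add: complex_eq_iff)
    then show False by presburger
  qed
qed

text \<open>For the \<open>j\<close>-th character the orbit sum is geometric and bounded by
  \<open>2 / norm (lam ^ j - 1)\<close>, whatever its length and starting point.\<close>

lemma rotation_equidistribution:
  assumes "continuous_on circle f"
  shows "uniform_limit circle (\<lambda>n u. (\<Sum>i<n. f (lam ^ i * u)) / real n) (\<lambda>_. circle_mean f) sequentially"
proof (rule circle_equidistribution[OF _ _ assms])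
  fix j :: nat assume j: "j > 0"
  let ?C = "2 / norm (lam ^ j - 1)"
  have ne: "lam ^ j \<noteq> 1" using j by (rule lam_power_neq_1)
  have bound: "norm ((\<Sum>i<n. (lam ^ i * u) ^ j) / of_nat n) \<le> ?C / n" if "norm u = 1" for n u
  proof -
    have "(\<Sum>i<n. (lam ^ i * u) ^ j) = u ^ j * (\<Sum>i<n. (lam ^ j) ^ i)"
      by (simp add: sum_distrib_left power_mult_distrib power_mult[symmetric] mult.commute)
    also have "\<dots> = u ^ j * (((lam ^ j) ^ n - 1) / (lam ^ j - 1))"
      using ne by (simp add: geometric_sum)
    finally have "norm (\<Sum>i<n. (lam ^ i * u) ^ j) = norm ((lam ^ j) ^ n - 1) / norm (lam ^ j - 1)"
      using that by (simp add: norm_mult norm_divide norm_power)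
    also have "\<dots> \<le> ?C"
      using norm_triangle_ineq4[of "(lam ^ j) ^ n" 1] by (intro divide_right_mono) (auto simp: norm_power)
    finally show ?thesis using divide_right_mono[of _ ?C "real n"] by (simp only: norm_divide norm_of_nat)
  qed
  have "(\<lambda>n. ?C / real n) \<longlonglongrightarrow> 0" by (rule lim_const_over_n)
  then show "uniform_limit circle (\<lambda>n u. (\<Sum>i<n. (lam ^ i * u) ^ j) / of_nat n) (\<lambda>_. 0) sequentially"
    unfolding uniform_limit_iff
  proof (intro allI impI)
    fix \<epsilon> :: real assume "\<epsilon> > 0"
    with \<open>(\<lambda>n. ?C / real n) \<longlonglongrightarrow> 0\<close> have "\<forall>\<^sub>F n in sequentially. ?C / real n < \<epsilon>"
      by (rule order_tendstoD)
    then show "\<forall>\<^sub>F n in sequentially. \<forall>u\<in>circle. dist ((\<Sum>i<n. (lam ^ i * u) ^ j) / of_nat n) 0 < \<epsilon>"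
    proof eventually_elim
      case (elim n)
      then show ?case using bound[of _ n] by (fastforce intro: le_less_trans)
    qed
  qed
qed (simp add: norm_mult norm_power)

section \<open>The diffeomorphism\<close>

type_synonym pt3 = "(real^3) \<times> complex"

definition pt :: "complex \<Rightarrow> real \<Rightarrow> complex \<Rightarrow> pt3" where
  "pt \<zeta> z w = (vector [Re \<zeta>, Im \<zeta>, z], w)"

definition lon :: "pt3 \<Rightarrow> complex" where "lon x = Complex (fst x $ 1) (fst x $ 2)"
definition ht :: "pt3 \<Rightarrow> real" where "ht x = fst x $ 3"

lemma pt_sel [simp]: "lon (pt \<zeta> z w) = \<zeta>" "ht (pt \<zeta> z w) = z" "snd (pt \<zeta> z w) = w"
  by (simp_all add: pt_def lon_def ht_def)

lemma pt_collapse [simp]: "pt (lon x) (ht x) (snd x) = x"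
  by (auto simp: pt_def lon_def ht_def prod_eq_iff vec_eq_iff forall_3)

lemma mem_S2xS1: "x \<in> S2xS1 \<longleftrightarrow> (norm (lon x))\<^sup>2 + (ht x)\<^sup>2 = 1 \<and> norm (snd x) = 1"
proof -
  have "norm (fst x) = 1 \<longleftrightarrow> (norm (fst x))\<^sup>2 = 1" by (simp add: abs_square_eq_1)
  also have "(norm (fst x))\<^sup>2 = (norm (lon x))\<^sup>2 + (ht x)\<^sup>2"
    by (simp add: norm_vec_def L2_set_def sum_3 lon_def ht_def cmod_def)
  finally show ?thesis by (cases x) (simp add: S2xS1_def)
qed

lemma S2xS1_ht_le_1: assumes "x \<in> S2xS1" shows "\<bar>ht x\<bar> \<le> 1" "norm (lon x) \<le> 1"
proof -
  have "(ht x)\<^sup>2 \<le> 1\<^sup>2" "(norm (lon x))\<^sup>2 \<le> 1\<^sup>2"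
    using assms by (simp_all add: mem_S2xS1) (smt (verit) zero_le_power2)+
  then show "\<bar>ht x\<bar> \<le> 1" "norm (lon x) \<le> 1"
    by (simp_all add: abs_square_le_1)
qed

lemma pt_eq: "pt \<zeta> z w = Re \<zeta> *\<^sub>R (axis 1 1, 0) + Im \<zeta> *\<^sub>R (axis 2 1, 0) + z *\<^sub>R (axis 3 1, 0) + (0, w)"
  by (simp add: pt_def prod_eq_iff vec_eq_iff forall_3 axis_def)

lemma bounded_linear_lon: "bounded_linear lon"
proof -
  have eq: "lon = (\<lambda>x. (fst x $ 1) *\<^sub>R 1 + (fst x $ 2) *\<^sub>R \<i>)"
    by (auto simp: lon_def complex_eq_iff)
  show ?thesis
    unfolding eq by (intro bounded_linear_intros bounded_linear_vec_nth[THEN bounded_linear_compose])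
qed

lemma bounded_linear_ht: "bounded_linear ht"
  unfolding ht_def by (intro bounded_linear_intros bounded_linear_vec_nth[THEN bounded_linear_compose])

lemma Ck_on_pt:
  assumes "open U" "Ck_on k f U" "Ck_on k g U" "Ck_on k h U"
  shows "Ck_on k (\<lambda>x. pt (f x) (g x) (h x)) U"
proof -
  have bl: "bounded_linear (\<lambda>w. (0, w) :: pt3)"
    by (intro bounded_linear_Pair bounded_linear_zero bounded_linear_ident)
  show ?thesis
    unfolding pt_eq using assms
    by (intro Ck_on_add Ck_on_scaleR Ck_on_const Ck_on_bounded_linear[OF _ bounded_linear_Re]
        Ck_on_bounded_linear[OF _ bounded_linear_Im] Ck_on_bounded_linear[OF _ bl])
qed

lemmas Ck_on_coords = Ck_on_linear[OF _ bounded_linear_lon] Ck_on_linear[OF _ bounded_linear_ht]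
  Ck_on_linear[OF _ bounded_linear_snd] Ck_on_bounded_linear[OF _ bounded_linear_Re]
  Ck_on_bounded_linear[OF _ bounded_linear_Im] Ck_on_bounded_linear[OF _ bounded_linear_cnj]
  Ck_on_bounded_linear[OF _ bounded_linear_of_real]
lemmas Ck_on_intros = Ck_on_pt Ck_on_coords Ck_on_const Ck_on_add Ck_on_diff Ck_on_minus Ck_on_mult
  Ck_on_power Ck_on_divide Ck_on_sqrt Ck_on_scaleR

lemmas continuous_coords [continuous_intros] =
  bounded_linear.continuous_on[OF bounded_linear_lon] bounded_linear.continuous_on[OF bounded_linear_ht]

lemma continuous_on_pt [continuous_intros]:
  assumes "continuous_on S f" "continuous_on S g" "continuous_on S h"
  shows "continuous_on S (\<lambda>x. pt (f x) (g x) (h x))"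
  unfolding pt_eq
  by (intro continuous_on_add continuous_on_scaleR continuous_on_Re continuous_on_Im continuous_on_Pair
      continuous_on_const assms)

section \<open>Moving the longitude by disc automorphisms\<close>

text \<open>
  For \<open>\<bar>l\<bar> = 1\<close> and \<open>\<bar>\<zeta>\<bar> = 1\<close> this is the disc automorphism \<open>l (\<zeta> - A) / (1 - cnj A \<zeta>)\<close>; on the
  circle \<open>\<bar>\<zeta>\<bar> = r\<close> the parameter is scaled by \<open>r\<close>, which makes the map smooth at \<open>\<zeta> = 0\<close>.
\<close>

definition mob :: "complex \<Rightarrow> complex \<Rightarrow> complex \<Rightarrow> complex" where
  "mob l A \<zeta> = l * (\<zeta> - \<zeta> * cnj \<zeta> * A) / (1 - cnj A * \<zeta>)"

lemma norm_mult_less_1: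
  fixes A \<zeta> :: complex
  shows "norm A < 1 \<Longrightarrow> norm \<zeta> \<le> 1 \<Longrightarrow> norm (\<zeta> * A) < 1"
  unfolding norm_mult by (rule le_less_trans[OF mult_left_le_one_le]) auto

lemma mob_denom:
  assumes "norm A < 1" "norm \<zeta> \<le> 1" shows "1 - cnj A * \<zeta> \<noteq> 0"
proof
  assume "1 - cnj A * \<zeta> = 0"
  then have "\<zeta> * cnj A = 1" by (simp add: mult.commute)
  moreover have "norm (\<zeta> * cnj A) < 1" using assms by (intro norm_mult_less_1) auto
  ultimately show False by simp
qed

text \<open>The numerator is \<open>l * \<zeta>\<close> times the conjugate of the denominator. This
  makes every circle about 0 invariant, as a map of the sphere at fixed height requires.\<close>

lemma mob_factor: "mob l A \<zeta> = l * \<zeta> * cnj (1 - cnj A * \<zeta>) / (1 - cnj A * \<zeta>)"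
  by (simp add: mob_def algebra_simps)

lemma norm_mob:
  assumes "norm l = 1" "norm A < 1" "norm \<zeta> \<le> 1"
  shows "norm (mob l A \<zeta>) = norm \<zeta>"
  unfolding mob_factor using assms mob_denom[OF assms(2,3)]
  by (simp add: norm_mult norm_divide del: complex_cnj_diff complex_cnj_mult)

text \<open>With \<open>\<zeta> = r s\<close> and \<open>norm s = 1\<close>, the map is
  \<open>r\<close> times the disc automorphism of \<open>s\<close> with parameter
  \<open>r A\<close>. The image has the same modulus, so the inverse automorphism, with factor
  \<open>cnj l\<close> and parameter \<open>- l * r A\<close>, is of the same form.\<close>

lemma mob_inverse:
  assumes "norm l = 1" "norm A < 1" "norm \<zeta> \<le> 1"
  shows "mob (cnj l) (- l * A) (mob l A \<zeta>) = \<zeta>"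
proof -
  define D where "D = 1 - cnj A * \<zeta>"
  have D: "D \<noteq> 0" using mob_denom assms unfolding D_def by blast
  have l: "l * cnj l = 1" using assms(1) complex_norm_square[of l] by simp
  let ?R = "\<zeta> * cnj \<zeta>"
  have R: "mob l A \<zeta> * cnj (mob l A \<zeta>) = ?R"
    using norm_mob[OF assms] by (metis complex_norm_square)
  \<comment> \<open>This factor appears in the numerator and in the denominator of the composition
    and is cancelled at the end.\<close>
  have K: "1 - ?R * (A * cnj A) \<noteq> 0"
  proof
    assume "1 - ?R * (A * cnj A) = 0"
    then have "complex_of_real ((norm (\<zeta> * A))\<^sup>2) = 1"
      unfolding complex_norm_square by (simp add: mult_ac)
    then have "norm (\<zeta> * A) = 1" by (simp only: of_real_eq_1_iff) (simp add: abs_square_eq_1)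
    then show False using norm_mult_less_1[OF assms(2,3)] by simp
  qed
  have "cnj l * (mob l A \<zeta> - ?R * (- l * A)) = \<zeta> * (1 - ?R * (A * cnj A)) / D"
  proof -
    have "cnj l * (mob l A \<zeta> - ?R * (- l * A)) = (l * cnj l) * ((\<zeta> - ?R * A) / D + ?R * A)"
      by (simp add: mob_def D_def algebra_simps)
    also have "\<dots> = (\<zeta> - ?R * A + ?R * A * D) / D"
      unfolding l using D by (simp add: add_divide_distrib)
    also have "\<zeta> - ?R * A + ?R * A * D = \<zeta> * (1 - ?R * (A * cnj A))"
      by (simp add: D_def algebra_simps)
    finally show ?thesis .
  qed
  moreover have "1 - cnj (- l * A) * mob l A \<zeta> = (1 - ?R * (A * cnj A)) / D"
  proof -
    have "1 - cnj (- l * A) * mob l A \<zeta> = 1 + (l * cnj l) * (cnj A * (\<zeta> - ?R * A) / D)"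
      by (simp add: mob_def D_def mult_ac)
    also have "\<dots> = (D + cnj A * (\<zeta> - ?R * A)) / D"
      unfolding l using D by (simp add: add_divide_distrib)
    also have "D + cnj A * (\<zeta> - ?R * A) = 1 - ?R * (A * cnj A)"
      by (simp add: D_def algebra_simps)
    finally show ?thesis .
  qed
  ultimately show ?thesis
    unfolding mob_def[of "cnj l"] R using D K by (simp add: mult.assoc)
qed

text \<open>At \<open>w = 1\<close> the map \<open>mob lam (par w)\<close> is parabolic with fixed point 1, at \<open>w = -1\<close> it is the rotation by \<open>lam\<close>.\<close>

definition par :: "complex \<Rightarrow> complex" where
  "par w = complex_of_real ((1 + Re w) / 2) * Complex (1/5) (2/5)"

lemma norm_par: assumes "norm w = 1" shows "norm (par w) < 1"
proof -
  have "\<bar>Re w\<bar> \<le> 1" using abs_Re_le_cmod[of w] assms by simp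
  then have "\<bar>(1 + Re w) / 2\<bar> \<le> 1" by (simp add: abs_le_iff)
  moreover have "norm (Complex (1/5) (2/5)) < 1" by (simp add: cmod_def power2_eq_square)
  ultimately show ?thesis
    unfolding par_def norm_mult norm_of_real by (smt (verit) mult_left_le_one_le norm_ge_zero)
qed

definition T1 :: "pt3 \<Rightarrow> pt3" where
  "T1 x = pt (mob lam (par (snd x)) (lon x)) (ht x) (snd x)"

definition T1' :: "pt3 \<Rightarrow> pt3" where
  "T1' x = pt (mob (cnj lam) (- lam * par (snd x)) (lon x)) (ht x) (snd x)"

lemma smooth_mob:
  assumes "\<And>k U. open U \<Longrightarrow> Ck_on k A U" "continuous_on UNIV A" "\<And>x. x \<in> S2xS1 \<Longrightarrow> norm (A x) < 1"
  shows "smooth_map_on S2xS1 (\<lambda>x. pt (mob l (A x) (lon x)) (ht x) (snd x))"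
proof (rule smooth_map_onI)
  let ?U = "{x. 1 - cnj (A x) * lon x \<noteq> 0}"
  show U: "open ?U"
    by (intro open_Collect_neq continuous_intros assms(2))
  show "S2xS1 \<subseteq> ?U" using mob_denom assms(3) S2xS1_ht_le_1 by blast
  show "Ck_on k (\<lambda>x. pt (mob l (A x) (lon x)) (ht x) (snd x)) ?U" for k
    unfolding mob_def by (intro Ck_on_intros U assms(1)) auto
qed

lemma smooth_diffeo_T1: "smooth_diffeo_on S2xS1 T1"
proof (rule smooth_diffeo_onI[where g = T1'])
  have ck: "Ck_on k (\<lambda>x::pt3. par (snd x)) U" if "open U" for k U
    unfolding par_def using that by (intro Ck_on_intros) auto
  have np: "norm (par (snd x)) < 1" "norm (- lam * par (snd x)) < 1" if "x \<in> S2xS1" for x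
    using that norm_par[of "snd x"] by (auto simp: mem_S2xS1 norm_mult)
  show "smooth_map_on S2xS1 T1"
    unfolding T1_def using np by (intro smooth_mob ck) (auto simp: par_def intro!: continuous_intros)
  show "smooth_map_on S2xS1 T1'"
    unfolding T1'_def using np by (intro smooth_mob Ck_on_mult Ck_on_const ck) (auto simp: par_def intro!: continuous_intros)
  show "T1 ` S2xS1 \<subseteq> S2xS1" "T1' ` S2xS1 \<subseteq> S2xS1"
    using np S2xS1_ht_le_1 by (auto simp: T1_def T1'_def mem_S2xS1 norm_mob)
  show "T1' (T1 x) = x" if "x \<in> S2xS1" for x
    using that np S2xS1_ht_le_1 by (simp add: T1_def T1'_def mob_inverse[simplified])
  show "T1 (T1' x) = x" if "x \<in> S2xS1" for x
  proof -
    have "lam * cnj lam = 1" using complex_norm_square[of lam] by simp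
    then have [simp]: "cnj lam * (lam * v) = v" for v
      by (simp add: mult.assoc[symmetric] mult.commute)
    have "mob lam (par (snd x)) (mob (cnj lam) (- lam * par (snd x)) (lon x)) = lon x"
      using mob_inverse[of "cnj lam" "- lam * par (snd x)" "lon x"] np[OF that] S2xS1_ht_le_1[OF that] by simp
    then show ?thesis by (simp add: T1_def T1'_def)
  qed
qed

text \<open>Under \<open>z \<mapsto> z / rad z\<close> the quantity \<open>1 / z^2\<close> grows by
  exactly \<open>1 - z^2\<close>. So small heights decay like \<open>1 / sqrt n\<close>, and the
  heights 0, 1 and -1 are fixed.\<close>

definition rad :: "real \<Rightarrow> real" where "rad z = sqrt (1 + z\<^sup>2 - z^4)"

lemma rad_arg_pos: assumes "\<bar>z\<bar> \<le> (1::real)" shows "1 + z\<^sup>2 - z^4 > 0"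
proof -
  have "z^4 = z\<^sup>2 * z\<^sup>2" by (simp flip: power_add)
  moreover have "z\<^sup>2 \<le> 1" using assms by (simp add: abs_square_le_1)
  ultimately show ?thesis using mult_left_le[of "z\<^sup>2" "z\<^sup>2"] by simp
qed

lemma rad_pos: "\<bar>z\<bar> \<le> 1 \<Longrightarrow> rad z > 0" and rad_sq: "\<bar>z\<bar> \<le> 1 \<Longrightarrow> (rad z)\<^sup>2 = 1 + z\<^sup>2 - z^4"
  using rad_arg_pos[of z] by (simp_all add: rad_def)

section \<open>The circle map depending on the height\<close>

text \<open>In the coordinates \<open>Im w + \<i> \<bar>z\<bar> Re w\<close> before and \<open>Im w + \<i> \<bar>z / rad z\<bar> Re w\<close> after, \<open>lin z\<close> is multiplication by \<open>1 + \<i> \<bar>z\<bar>\<close>.\<close>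

definition lin :: "real \<Rightarrow> complex \<Rightarrow> complex" where
  "lin z w = Complex (rad z * (Re w + Im w)) (Im w - z\<^sup>2 * Re w)"

text \<open>The adjugate of the matrix of \<open>lin z\<close>, whose determinant is
  \<open>rad z * (1 + z\<^sup>2)\<close>.\<close>

definition lin' :: "real \<Rightarrow> complex \<Rightarrow> complex" where
  "lin' z w = Complex (Re w - rad z * Im w) (z\<^sup>2 * Re w + rad z * Im w)"

lemma lin'_lin: "lin' z (lin z w) = (rad z * (1 + z\<^sup>2)) *\<^sub>R w"
  and lin_lin': "lin z (lin' z w) = (rad z * (1 + z\<^sup>2)) *\<^sub>R w"
  by (simp_all add: lin_def lin'_def complex_eq_iff algebra_simps)

lemma lin_scaleR: "lin z (c *\<^sub>R w) = c *\<^sub>R lin z w" and lin'_scaleR: "lin' z (c *\<^sub>R w) = c *\<^sub>R lin' z w"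
  by (simp_all add: lin_def lin'_def complex_eq_iff algebra_simps)

lemma lin_nonzero:
  assumes "\<bar>z\<bar> \<le> 1" "w \<noteq> 0" shows "lin z w \<noteq> 0" "lin' z w \<noteq> 0"
proof -
  have "1 + z\<^sup>2 > 0" by (simp add: add_pos_nonneg)
  then have c: "rad z * (1 + z\<^sup>2) \<noteq> 0" using rad_pos[OF assms(1)] by simp
  have [simp]: "lin z 0 = 0" "lin' z 0 = 0" by (simp_all add: lin_def lin'_def complex_eq_iff)
  show "lin z w \<noteq> 0" "lin' z w \<noteq> 0"
    using lin'_lin[of z w] lin_lin'[of z w] c assms(2) by (metis \<open>lin z 0 = 0\<close> \<open>lin' z 0 = 0\<close> scaleR_eq_0_iff)+
qed

definition T2 :: "pt3 \<Rightarrow> pt3" where "T2 x = pt (lon x) (ht x) (sgn (lin (ht x) (snd x)))"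
definition T2' :: "pt3 \<Rightarrow> pt3" where "T2' x = pt (lon x) (ht x) (sgn (lin' (ht x) (snd x)))"

lemma sgn_complex_eq: "sgn (w::complex) = w / complex_of_real (sqrt ((Re w)\<^sup>2 + (Im w)\<^sup>2))"
  by (simp add: sgn_eq cmod_def)

text \<open>The conjugacy with a rotation involves \<open>\<bar>z\<bar>\<close>, but the matrix of
  \<open>lin z\<close> contains \<open>z\<close> only through \<open>z^2\<close> and
  \<open>rad z\<close>, so the map is smooth across height 0. Since \<open>sgn\<close> discards
  positive factors, the adjugate serves as the inverse.\<close>

lemma smooth_diffeo_T2: "smooth_diffeo_on S2xS1 T2"
proof (rule smooth_diffeo_onI[where g = T2'])
  have nz: "lin (ht x) (snd x) \<noteq> 0" "lin' (ht x) (snd x) \<noteq> 0" if "x \<in> S2xS1" for x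
  proof -
    have "snd x \<noteq> 0" using that by (auto simp: mem_S2xS1)
    then show "lin (ht x) (snd x) \<noteq> 0" "lin' (ht x) (snd x) \<noteq> 0"
      using lin_nonzero S2xS1_ht_le_1[OF that] by blast+
  qed
  have cl: "continuous_on UNIV (\<lambda>x::pt3. lin (ht x) (snd x))" "continuous_on UNIV (\<lambda>x::pt3. lin' (ht x) (snd x))"
    unfolding lin_def lin'_def rad_def Complex_eq by (intro continuous_intros)+
  let ?V = "{x. 1 + (ht x)\<^sup>2 - (ht x)^4 > 0}"
  have V: "open ?V" by (intro open_Collect_less continuous_intros)
  have ckr: "Ck_on k (\<lambda>x. rad (ht x)) (?V \<inter> W)" if "open W" for k W
    unfolding rad_def using V that by (intro Ck_on_intros) auto
  have ckl: "Ck_on k (\<lambda>x. lin (ht x) (snd x)) (?V \<inter> W)" "Ck_on k (\<lambda>x. lin' (ht x) (snd x)) (?V \<inter> W)" if "open W" for k W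
    unfolding lin_def lin'_def Complex_eq using V that by (intro Ck_on_intros ckr; auto)+
  have *: "smooth_map_on S2xS1 (\<lambda>x. pt (lon x) (ht x) (sgn (f x)))"
    if f: "\<And>k W. open W \<Longrightarrow> Ck_on k f (?V \<inter> W)" "continuous_on UNIV f" "\<And>x. x \<in> S2xS1 \<Longrightarrow> f x \<noteq> 0"
    for f :: "pt3 \<Rightarrow> complex"
  proof (rule smooth_map_onI)
    let ?W = "{x. f x \<noteq> 0}"
    have W: "open ?W" using f(2) by (intro open_Collect_neq continuous_intros)
    then show "open (?V \<inter> ?W)" using V by blast
    show "S2xS1 \<subseteq> ?V \<inter> ?W" using f(3) rad_arg_pos S2xS1_ht_le_1 by blast
    have p: "(Re (f x))\<^sup>2 + (Im (f x))\<^sup>2 > 0" if "f x \<noteq> 0" for x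
      using that by (simp add: complex_neq_0)
    show "Ck_on k (\<lambda>x. pt (lon x) (ht x) (sgn (f x))) (?V \<inter> ?W)" for k
      unfolding sgn_complex_eq
      using V W p f(1)[OF W, of k] by (intro Ck_on_intros) (auto dest: p simp: complex_neq_0)
  qed
  show "smooth_map_on S2xS1 T2" "smooth_map_on S2xS1 T2'"
    unfolding T2_def T2'_def using ckl cl nz by (intro *; blast)+
  show "T2 ` S2xS1 \<subseteq> S2xS1" "T2' ` S2xS1 \<subseteq> S2xS1"
    using nz by (auto simp: T2_def T2'_def mem_S2xS1 norm_sgn)
  have sg: "sgn (c *\<^sub>R w) = w" if "c > 0" "norm w = 1" for c and w :: complex
    using that by (simp add: sgn_scaleR sgn_div_norm)
  have pos: "inverse (norm (lin (ht x) (snd x))) * (rad (ht x) * (1 + (ht x)\<^sup>2)) > 0"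
    "inverse (norm (lin' (ht x) (snd x))) * (rad (ht x) * (1 + (ht x)\<^sup>2)) > 0" if "x \<in> S2xS1" for x
    using nz[OF that] rad_pos[of "ht x"] S2xS1_ht_le_1[OF that] by (auto intro!: mult_pos_pos add_pos_nonneg)
  show "T2' (T2 x) = x" if "x \<in> S2xS1" for x
  proof -
    have "lin' (ht x) (sgn (lin (ht x) (snd x))) = (inverse (norm (lin (ht x) (snd x))) * (rad (ht x) * (1 + (ht x)\<^sup>2))) *\<^sub>R snd x"
      by (simp add: sgn_div_norm lin'_scaleR lin'_lin)
    then show ?thesis using sg[OF pos(1)[OF that]] that by (simp add: T2_def T2'_def mem_S2xS1)
  qed
  show "T2 (T2' x) = x" if "x \<in> S2xS1" for x
  proof -
    have "lin (ht x) (sgn (lin' (ht x) (snd x))) = (inverse (norm (lin' (ht x) (snd x))) * (rad (ht x) * (1 + (ht x)\<^sup>2))) *\<^sub>R snd x"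
      by (simp add: sgn_div_norm lin_scaleR lin_lin')
    then show ?thesis using sg[OF pos(2)[OF that]] that by (simp add: T2_def T2'_def mem_S2xS1)
  qed
qed

text \<open>The factor that puts the point back on the sphere after its height has changed from
  \<open>z\<close> to \<open>z / rad z\<close>. Its square is
  \<open>(1 - (z / rad z)^2) / (1 - z^2)\<close>, with \<open>1 - z^2\<close> cancelled so that the
  formula is smooth at the poles.\<close>

definition stretch :: "real \<Rightarrow> real" where
  "stretch z = sqrt ((1 + z\<^sup>2) / (1 + z\<^sup>2 - z^4))"

text \<open>The value of \<open>rad\<close> at the preimage of \<open>z\<close> under \<open>\<lambda>z. z / rad z\<close>, from solving a quadratic equation.\<close>

definition rad_inv :: "real \<Rightarrow> real" where
  "rad_inv z = sqrt (2 / (1 - z\<^sup>2 + sqrt ((1 - z\<^sup>2)\<^sup>2 + 4 * z^4)))"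

definition T3 :: "pt3 \<Rightarrow> pt3" where
  "T3 x = pt (of_real (stretch (ht x)) * lon x) (ht x / rad (ht x)) (snd x)"

definition T3' :: "pt3 \<Rightarrow> pt3" where
  "T3' x = pt (lon x / of_real (stretch (ht x * rad_inv (ht x)))) (ht x * rad_inv (ht x)) (snd x)"

lemma rad_inv_disc: "(1 - z\<^sup>2)\<^sup>2 + 4 * z^4 > (0::real)"
proof (cases "z = 0")
  case False
  then have "z^4 > 0" by simp
  then show ?thesis by (simp add: add_nonneg_pos)
qed simp

lemma rad_inv_denom: "1 - z\<^sup>2 + sqrt ((1 - z\<^sup>2)\<^sup>2 + 4 * z^4) > (0::real)"
proof (cases "z = 0")
  case False
  then have "z^4 > 0" by simp
  then have "\<bar>1 - z\<^sup>2\<bar> < sqrt ((1 - z\<^sup>2)\<^sup>2 + 4 * z^4)" by (intro real_less_rsqrt) simp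
  then show ?thesis by linarith
qed simp

lemma rad_inv_pos: "rad_inv z > 0"
  unfolding rad_inv_def using rad_inv_denom[of z] by simp

lemma rad_inv_rad:
  assumes "\<bar>z\<bar> \<le> 1" shows "rad_inv (z / rad z) = rad z"
proof -
  define y where "y = z\<^sup>2"
  define R where "R = 1 + y - y\<^sup>2"
  have y4: "z^4 = y\<^sup>2" by (simp add: y_def power_mult[symmetric])
  have R: "R > 0" "(rad z)\<^sup>2 = R"
    using rad_arg_pos[OF assms] rad_sq[OF assms] unfolding R_def y4 y_def by simp_all
  have Z: "(z / rad z)\<^sup>2 = y / R" "(z / rad z)^4 = (y / R)\<^sup>2"
    using R(2) y4 power_mult[of "rad z" 2 2] by (simp_all add: power_divide y_def)
  \<comment> \<open>Together with \<open>(1 - y^2)^2 + 4 y^2 = (1 + y^2)^2\<close> this makes the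
    inner root in \<open>rad_inv\<close> rational in \<open>y\<close>.\<close>
  have "1 - y / R = (1 - y\<^sup>2) / R" using R(1) by (simp add: field_simps R_def)
  moreover have "(1 - y / R)\<^sup>2 + 4 * (y / R)\<^sup>2 = ((1 + y\<^sup>2) / R)\<^sup>2"
    unfolding calculation power_divide by (simp add: field_simps R(1) less_imp_neq[OF R(1), symmetric]) algebra
  moreover have "(1 + y\<^sup>2) / R > 0" using R(1) by (simp add: add_pos_nonneg)
  ultimately have "1 - y / R + sqrt ((1 - y / R)\<^sup>2 + 4 * (y / R)\<^sup>2) = 2 / R"
    using R(1) by (simp flip: add_divide_distrib)
  then have "rad_inv (z / rad z) = sqrt R" unfolding rad_inv_def Z by simp
  then show ?thesis using R(2) rad_pos[OF assms] by (metis less_imp_le real_sqrt_unique)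
qed

text \<open>\<open>g\<close> is the positive root of \<open>z^4 g^2 + (1 - z^2) g - 1 = 0\<close>.
  It is written as \<open>2 / (a + s)\<close> instead of \<open>(s - a) / (2 z^4)\<close>, which
  makes sense, and is smooth, at \<open>z = 0\<close>.\<close>

lemma rad_inv_equation:
  fixes z defines "g \<equiv> (rad_inv z)\<^sup>2"
  shows "1 + z\<^sup>2 * g - (z\<^sup>2 * g)\<^sup>2 = g"
proof -
  define a s where "a = 1 - z\<^sup>2" and "s = sqrt ((1 - z\<^sup>2)\<^sup>2 + 4 * z^4)"
  have s2: "s\<^sup>2 = a\<^sup>2 + 4 * z^4" using rad_inv_disc[of z] by (simp add: s_def a_def)
  have as: "a + s > 0" using rad_inv_denom[of z] by (simp add: a_def s_def)
  have "g = 2 / (a + s)" using as by (simp add: g_def rad_inv_def a_def s_def)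
  then have g: "g * (a + s) = 2" using as nonzero_eq_divide_eq[of "a + s" g 2] by simp
  have "((z\<^sup>2 * g)\<^sup>2 + a * g - 1) * (a + s)\<^sup>2 = z^4 * (g * (a + s))\<^sup>2 + a * (g * (a + s)) * (a + s) - (a + s)\<^sup>2"
    by (simp add: power2_eq_square power4_eq_xxxx algebra_simps)
  also have "\<dots> = 0"
    unfolding g power2_sum s2 by (simp add: power2_eq_square algebra_simps)
  finally have "(z\<^sup>2 * g)\<^sup>2 + a * g - 1 = 0" using as by simp
  then show ?thesis by (simp add: a_def algebra_simps)
qed

lemma height_T3':
  assumes "\<bar>z\<bar> \<le> 1"
  shows "rad (z * rad_inv z) = rad_inv z" "\<bar>z * rad_inv z\<bar> \<le> 1"
proof -
  define g where "g = (rad_inv z)\<^sup>2"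
  have e: "1 + z\<^sup>2 * g - (z\<^sup>2 * g)\<^sup>2 = g" using rad_inv_equation[of z] by (simp add: g_def)
  have "(z * rad_inv z)\<^sup>2 = z\<^sup>2 * g" "(z * rad_inv z)^4 = (z\<^sup>2 * g)\<^sup>2"
    by (simp_all add: g_def power_mult_distrib power_mult[symmetric])
  then have "rad (z * rad_inv z) = sqrt g" unfolding rad_def using e by simp
  then show "rad (z * rad_inv z) = rad_inv z" using rad_inv_pos[of z] by (simp add: g_def)
  have "g > 0" using rad_inv_pos[of z] by (simp add: g_def)
  moreover have "z\<^sup>2 \<le> 1" using assms by (simp add: abs_square_le_1)
  ultimately have "g - z\<^sup>2 * g \<ge> 0" by (simp add: mult_left_le_one_le)
  then have "(z\<^sup>2 * g)\<^sup>2 \<le> 1" using e by linarith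
  then have "z\<^sup>2 * g \<le> 1" using \<open>g > 0\<close> by (simp add: abs_square_le_1)
  then show "\<bar>z * rad_inv z\<bar> \<le> 1" using \<open>(z * rad_inv z)\<^sup>2 = z\<^sup>2 * g\<close> by (metis abs_square_le_1)
qed

lemma stretch_pos: "\<bar>z\<bar> \<le> 1 \<Longrightarrow> stretch z > 0"
  unfolding stretch_def using rad_arg_pos[of z] by (simp add: add_pos_nonneg)

lemma stretch_sq: "\<bar>z\<bar> \<le> 1 \<Longrightarrow> (stretch z)\<^sup>2 = (1 + z\<^sup>2) / (1 + z\<^sup>2 - z^4)"
  unfolding stretch_def using rad_arg_pos[of z] by (simp add: add_nonneg_nonneg)

lemma T3_sphere:
  assumes "\<bar>z\<bar> \<le> 1"
  shows "(stretch z)\<^sup>2 * (1 - z\<^sup>2) + (z / rad z)\<^sup>2 = 1"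
proof -
  have p: "1 + z\<^sup>2 - z^4 \<noteq> 0" using rad_arg_pos[OF assms] by simp
  have "(stretch z)\<^sup>2 * (1 - z\<^sup>2) + (z / rad z)\<^sup>2 = ((1 + z\<^sup>2) * (1 - z\<^sup>2) + z\<^sup>2) / (1 + z\<^sup>2 - z^4)"
    by (simp add: stretch_sq[OF assms] power_divide rad_sq[OF assms] flip: add_divide_distrib)
  also have "(1 + z\<^sup>2) * (1 - z\<^sup>2) + z\<^sup>2 = 1 + z\<^sup>2 - z^4"
    by (simp add: algebra_simps power2_eq_square power4_eq_xxxx)
  finally show ?thesis using p by simp
qed

lemma smooth_diffeo_T3: "smooth_diffeo_on S2xS1 T3"
proof (rule smooth_diffeo_onI[where g = T3'])
  show "smooth_map_on S2xS1 T3"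
  proof (rule smooth_map_onI)
    let ?V = "{x. 1 + (ht x)\<^sup>2 - (ht x)^4 > 0}"
    show V: "open ?V" by (intro open_Collect_less continuous_intros)
    show "S2xS1 \<subseteq> ?V" using rad_arg_pos S2xS1_ht_le_1 by blast
    have "(1 + (ht x)\<^sup>2) / (1 + (ht x)\<^sup>2 - (ht x)^4) > 0" if "x \<in> ?V" for x
      using that by (simp add: add_pos_nonneg)
    then show "Ck_on k T3 ?V" for k
      unfolding T3_def[abs_def] stretch_def rad_def using V by (intro Ck_on_intros; force)
  qed
  have ck: "Ck_on k (\<lambda>x. ht x * rad_inv (ht x)) U" if "open U" for k U
    unfolding rad_inv_def using that rad_inv_disc rad_inv_denom
    by (intro Ck_on_intros; fastforce simp: less_imp_neq[THEN not_sym])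
  show "smooth_map_on S2xS1 T3'"
  proof (rule smooth_map_onI)
    define y :: "pt3 \<Rightarrow> real" where "y = (\<lambda>x. ht x * rad_inv (ht x))"
    let ?V = "{x. 1 + (y x)\<^sup>2 - (y x)^4 > 0}"
    have y: "Ck_on k y U" if "open U" for k U using ck[OF that] by (simp add: y_def)
    have T3'_eq: "T3' = (\<lambda>x. pt (lon x / of_real (stretch (y x))) (y x) (snd x))"
      by (simp add: T3'_def[abs_def] y_def)
    have "continuous_on UNIV y" using y[of UNIV 0] by simp
    then show V: "open ?V" by (intro open_Collect_less continuous_intros)
    show "S2xS1 \<subseteq> ?V" using rad_arg_pos height_T3' S2xS1_ht_le_1 unfolding y_def by blast
    have p: "(1 + (y x)\<^sup>2) / (1 + (y x)\<^sup>2 - (y x)^4) > 0" if "x \<in> ?V" for x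
      using that by (simp add: add_pos_nonneg)
    show "Ck_on k T3' ?V" for k
      unfolding T3'_eq stretch_def
      using V p by (intro Ck_on_intros y; force)
  qed
  show "T3 ` S2xS1 \<subseteq> S2xS1"
  proof
    fix x assume "x \<in> T3 ` S2xS1"
    then obtain u where u: "u \<in> S2xS1" "x = T3 u" by blast
    have "(norm (lon u))\<^sup>2 = 1 - (ht u)\<^sup>2" using u(1) by (simp add: mem_S2xS1)
    then show "x \<in> S2xS1"
      using u T3_sphere[OF S2xS1_ht_le_1(1)[OF u(1)]]
      by (simp add: mem_S2xS1 T3_def norm_mult power_mult_distrib)
  qed
  show "T3' ` S2xS1 \<subseteq> S2xS1"
  proof
    fix x assume "x \<in> T3' ` S2xS1"
    then obtain u where u: "u \<in> S2xS1" "x = T3' u" by blast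
    define z where "z = ht u * rad_inv (ht u)"
    have z: "\<bar>z\<bar> \<le> 1" "z / rad z = ht u"
      using height_T3'[OF S2xS1_ht_le_1(1)[OF u(1)]] rad_inv_pos[of "ht u"] by (simp_all add: z_def)
    have "(stretch z)\<^sup>2 * (1 - z\<^sup>2) = (norm (lon u))\<^sup>2"
      using T3_sphere[OF z(1)] z(2) u(1) by (simp add: mem_S2xS1)
    then have "(norm (lon u) / stretch z)\<^sup>2 = 1 - z\<^sup>2"
      using stretch_pos[OF z(1)] by (simp add: power_divide field_simps)
    then show "x \<in> S2xS1"
      using u stretch_pos[OF z(1)] by (simp add: mem_S2xS1 T3'_def norm_divide z_def[symmetric] abs_of_pos)
  qed
  show "T3' (T3 x) = x" if "x \<in> S2xS1" for x
  proof -
    have "\<bar>ht x\<bar> \<le> 1" using that S2xS1_ht_le_1 by blast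
    then have "ht x / rad (ht x) * rad_inv (ht x / rad (ht x)) = ht x" "stretch (ht x) \<noteq> 0"
      using rad_inv_rad rad_pos[of "ht x"] stretch_pos[of "ht x"] by auto
    then show ?thesis by (simp add: T3_def T3'_def)
  qed
  show "T3 (T3' x) = x" if "x \<in> S2xS1" for x
  proof -
    have "\<bar>ht x\<bar> \<le> 1" using that S2xS1_ht_le_1 by blast
    note h = height_T3'[OF this]
    show ?thesis
      using rad_inv_pos[of "ht x"] stretch_pos[OF h(2)] by (simp add: T3_def T3'_def h(1))
  qed
qed

definition T :: "pt3 \<Rightarrow> pt3" where "T = T3 \<circ> (T2 \<circ> T1)"

lemma smooth_diffeo_T: "smooth_diffeo_on S2xS1 T"
  unfolding T_def by (intro smooth_diffeo_on_compose smooth_diffeo_T1 smooth_diffeo_T2 smooth_diffeo_T3)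

lemma T_eq: "T x = pt (of_real (stretch (ht x)) * mob lam (par (snd x)) (lon x))
    (ht x / rad (ht x)) (sgn (lin (ht x) (snd x)))"
  by (simp add: T_def T1_def T2_def T3_def)

lemma continuous_on_T: "continuous_on S2xS1 T"
  using smooth_diffeo_T smooth_map_on_imp_continuous_on unfolding smooth_diffeo_on_def by blast

lemma T_mem: "x \<in> S2xS1 \<Longrightarrow> T x \<in> S2xS1"
  using smooth_diffeo_T unfolding smooth_diffeo_on_def bij_betw_def by blast

lemma T_iterate_mem: "x \<in> S2xS1 \<Longrightarrow> (T ^^ n) x \<in> S2xS1"
  by (induction n) (simp_all add: T_mem)

lemma continuous_on_T_iterate: "continuous_on S2xS1 (T ^^ n)"
proof (induction n)
  case (Suc n)
  have "continuous_on ((T ^^ n) ` S2xS1) T"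
    by (rule continuous_on_subset[OF continuous_on_T]) (auto simp: T_iterate_mem)
  from continuous_on_compose[OF Suc this] show ?case by simp
qed (simp add: continuous_on_id)

section \<open>Slow rotation\<close>

lemma cesaro_null:
  fixes f :: "nat \<Rightarrow> real"
  assumes "f \<longlonglongrightarrow> 0"
  shows "(\<lambda>n. (\<Sum>i<n. f i) / real n) \<longlonglongrightarrow> 0"
proof (rule LIMSEQ_I)
  fix r :: real assume r: "r > 0"
  from LIMSEQ_D[OF assms, of "r / 2"] r obtain N where N: "\<And>n. n \<ge> N \<Longrightarrow> \<bar>f n\<bar> < r / 2" by auto
  define C where "C = (\<Sum>i<N. \<bar>f i\<bar>)"
  have "(\<lambda>n. C / real n) \<longlonglongrightarrow> 0" by (rule lim_const_over_n)
  from LIMSEQ_D[OF this, of "r / 2"] r obtain M where M: "\<And>n. n \<ge> M \<Longrightarrow> \<bar>C / real n\<bar> < r / 2" by auto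
  show "\<exists>no. \<forall>n\<ge>no. norm ((\<Sum>i<n. f i) / real n - 0) < r"
  proof (intro exI allI impI)
    fix n assume n: "n \<ge> Suc (max N M)"
    have "\<bar>\<Sum>i<n. f i\<bar> \<le> (\<Sum>i<n. \<bar>f i\<bar>)" by (rule sum_abs)
    also have "\<dots> = (\<Sum>i\<in>{..<N} \<union> {N..<n}. \<bar>f i\<bar>)" using n by (intro sum.cong) auto
    also have "\<dots> = C + (\<Sum>i\<in>{N..<n}. \<bar>f i\<bar>)"
      unfolding C_def by (rule sum.union_disjoint) auto
    also have "(\<Sum>i\<in>{N..<n}. \<bar>f i\<bar>) \<le> (\<Sum>i\<in>{N..<n}. r / 2)"
      using N by (intro sum_mono) (simp add: less_imp_le)
    also have "\<dots> \<le> real n * (r / 2)" using r by simp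
    finally have "\<bar>\<Sum>i<n. f i\<bar> \<le> C + real n * (r / 2)" by simp
    then have "\<bar>\<Sum>i<n. f i\<bar> / real n \<le> (C + real n * (r / 2)) / real n" by (rule divide_right_mono) simp
    also have "\<dots> = C / real n + r / 2" using n by (simp add: add_divide_distrib)
    also have "\<bar>C / real n\<bar> < r / 2" by (rule M) (use n in simp)
    then have "C / real n + r / 2 < r" using abs_ge_self[of "C / real n"] by linarith
    finally show "norm ((\<Sum>i<n. f i) / real n - 0) < r" by simp
  qed
qed

text \<open>Summation by parts: the difference is
  \<open>- b 0 a 0 - \<Sum> (b (n+1) - b n) a (n+1)\<close>, and the increments of \<open>b\<close>
  telescope to \<open>b N - b 0\<close>.\<close>

lemma abel_bound:
  fixes a :: "nat \<Rightarrow> complex" and b :: "nat \<Rightarrow> real"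
  assumes "\<And>n. norm (a n) \<le> 1" "\<And>n. 0 \<le> b n" "\<And>n. b n \<le> b (Suc n)"
  shows "norm ((\<Sum>n<N. b n *\<^sub>R (a (Suc n) - a n)) - b N *\<^sub>R a N) \<le> b N"
proof (induction N)
  case 0
  show ?case using mult_left_le[OF assms(1)[of 0] assms(2)[of 0]] assms(2)[of 0] by simp
next
  case (Suc N)
  have "(\<Sum>n<Suc N. b n *\<^sub>R (a (Suc n) - a n)) - b (Suc N) *\<^sub>R a (Suc N)
      = ((\<Sum>n<N. b n *\<^sub>R (a (Suc n) - a n)) - b N *\<^sub>R a N) + (b N - b (Suc N)) *\<^sub>R a (Suc N)"
    by (simp add: algebra_simps)
  also have "norm \<dots> \<le> b N + norm ((b N - b (Suc N)) *\<^sub>R a (Suc N))"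
    using Suc by (intro norm_triangle_le add_mono order_refl)
  also have "norm ((b N - b (Suc N)) *\<^sub>R a (Suc N)) \<le> b (Suc N) - b N"
    using mult_left_le[OF assms(1)[of "Suc N"], of "b (Suc N) - b N"] assms(3)[of N] by simp
  finally show ?case by simp
qed

lemma sgn_power_expansion:
  assumes "0 \<le> k" "k \<le> 1"
  shows "norm (sgn (Complex 1 k) ^ j - 1 - \<i> * of_real (real j * k)) \<le> (real j)\<^sup>2 * k\<^sup>2"
proof -
  define u where "u = sgn (Complex 1 k)"
  have n: "norm (Complex 1 k) = sqrt (1 + k\<^sup>2)" by (simp add: cmod_def)
  have nz: "Complex 1 k \<noteq> 0" by (simp add: complex_eq_iff)
  have u1: "norm u = 1" using nz by (simp add: u_def norm_sgn)
  have "1 + k\<^sup>2 \<le> (1 + k\<^sup>2)\<^sup>2" by (simp add: power2_sum)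
  then have s: "1 \<le> sqrt (1 + k\<^sup>2)" "sqrt (1 + k\<^sup>2) \<le> 1 + k\<^sup>2"
    by (auto intro: real_le_lsqrt)
  have "1 + \<i> * of_real k = sqrt (1 + k\<^sup>2) *\<^sub>R u"
  proof -
    have "sqrt (1 + k\<^sup>2) \<noteq> 0" using s(1) by linarith
    then show ?thesis using n by (simp only: u_def sgn_div_norm Complex_eq) simp
  qed
  then have "u - 1 - \<i> * of_real k = u - sqrt (1 + k\<^sup>2) *\<^sub>R u" by (metis diff_diff_add)
  then have "u - 1 - \<i> * of_real k = (1 - sqrt (1 + k\<^sup>2)) *\<^sub>R u" by (simp add: scaleR_diff_left)
  then have A: "norm (u - 1 - \<i> * of_real k) \<le> k\<^sup>2" using u1 s by simp
  have B: "norm (u - 1) \<le> 2 * k"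
  proof -
    have "norm (u - 1) \<le> norm (u - 1 - \<i> * of_real k) + norm (\<i> * of_real k)"
      using norm_triangle_ineq[of "u - 1 - \<i> * of_real k" "\<i> * of_real k"] by simp
    also have "\<dots> \<le> k\<^sup>2 + k" using A assms by (simp add: norm_mult)
    also have "k\<^sup>2 \<le> k" using assms by (simp add: power2_eq_square mult_left_le)
    finally show ?thesis by simp
  qed
  have "norm (u ^ j - 1 - \<i> * of_real (real j * k)) \<le> (real j)\<^sup>2 * k\<^sup>2"
  proof (induction j)
    case (Suc j)
    \<comment> \<open>The three terms contribute \<open>j^2 k^2\<close>, \<open>k^2\<close> and
      \<open>2 j k^2\<close>, which add up to \<open>(j + 1)^2 k^2\<close>.\<close>
    have "u ^ Suc j - 1 - \<i> * of_real (real (Suc j) * k)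
        = u * (u ^ j - 1 - \<i> * of_real (real j * k)) + ((u - 1 - \<i> * of_real k) + (u - 1) * (\<i> * of_real (real j * k)))"
      by (simp add: algebra_simps)
    also have "norm \<dots> \<le> (real j)\<^sup>2 * k\<^sup>2 + (k\<^sup>2 + (2 * k) * (real j * k))"
    proof (intro norm_triangle_le add_mono A)
      show "norm (u * (u ^ j - 1 - \<i> * of_real (real j * k))) \<le> (real j)\<^sup>2 * k\<^sup>2"
        using Suc u1 by (simp add: norm_mult)
      show "norm ((u - 1) * (\<i> * of_real (real j * k))) \<le> 2 * k * (real j * k)"
      proof -
        have "norm (\<i> * of_real (real j * k) :: complex) = real j * k" using assms by (simp add: norm_mult)
        then show ?thesis unfolding norm_mult[of "u - 1"] using B assms by (simp add: mult_right_mono)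
      qed
    qed
    also have "\<dots> = (real (Suc j))\<^sup>2 * k\<^sup>2" by (simp add: power2_eq_square algebra_simps)
    finally show ?case .
  qed simp
  then show ?thesis by (simp add: u_def)
qed

text \<open>For small angles \<open>a n = e n ^ j\<close> satisfies
  \<open>a (n+1) - a n \<approx> i j k n a n\<close>. Dividing by \<open>k n\<close> and summing by
  parts with the increasing weights \<open>1 / k n\<close> bounds the character sum by a multiple of
  \<open>1 / k N + \<Sum> k n\<close>, and both terms are \<open>o(N)\<close>.\<close>

lemma slow_rotation_chars:
  fixes k :: "nat \<Rightarrow> real" and e :: "nat \<Rightarrow> complex"
  assumes k: "\<And>n. 0 < k n" "\<And>n. k n \<le> 1" "\<And>n. k (Suc n) \<le> k n" "k \<longlonglongrightarrow> 0"
    and slow: "(\<lambda>n. 1 / (real n * k n)) \<longlonglongrightarrow> 0"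
    and e: "\<And>n. norm (e n) = 1" "\<And>n. e (Suc n) = e n * sgn (Complex 1 (k n))"
    and j: "j > 0"
  shows "(\<lambda>n. (\<Sum>i<n. e i ^ j) / of_nat n) \<longlonglongrightarrow> 0"
proof -
  define a where "a n = e n ^ j" for n
  define b where "b n = 1 / k n" for n
  have a: "norm (a n) = 1" for n using e(1) by (simp add: a_def norm_power)
  have b: "0 \<le> b n" "b n \<le> b (Suc n)" for n
    using k(1,3)[of n] k(1)[of "Suc n"] by (auto simp: b_def intro!: divide_left_mono)
  have step: "norm (\<i> * of_real (real j) * a n - b n *\<^sub>R (a (Suc n) - a n)) \<le> (real j)\<^sup>2 * k n" for n
  proof -
    have "\<i> * of_real (real j) * a n - b n *\<^sub>R (a (Suc n) - a n)
        = - (b n *\<^sub>R (a n * (sgn (Complex 1 (k n)) ^ j - 1 - \<i> * of_real (real j * k n))))"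
      using k(1)[of n] by (simp add: a_def b_def e(2) power_mult_distrib scaleR_conv_of_real field_simps)
    then have "norm (\<i> * of_real (real j) * a n - b n *\<^sub>R (a (Suc n) - a n))
        = b n * norm (sgn (Complex 1 (k n)) ^ j - 1 - \<i> * of_real (real j * k n))"
      using a[of n] b(1)[of n] by (simp add: norm_mult)
    also have "\<dots> \<le> b n * ((real j)\<^sup>2 * (k n)\<^sup>2)"
      using k(1,2)[of n] b(1)[of n] by (intro mult_left_mono sgn_power_expansion) auto
    also have "\<dots> = (real j)\<^sup>2 * k n" using k(1)[of n] by (simp add: b_def power2_eq_square)
    finally show ?thesis .
  qed
  have bound: "norm (\<Sum>i<N. a i) \<le> (2 * b N + (\<Sum>i<N. (real j)\<^sup>2 * k i)) / real j" for N
  proof -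
    have "norm (\<Sum>n<N. b n *\<^sub>R (a (Suc n) - a n)) \<le> norm ((\<Sum>n<N. b n *\<^sub>R (a (Suc n) - a n)) - b N *\<^sub>R a N) + norm (b N *\<^sub>R a N)"
      using norm_triangle_ineq[of "(\<Sum>n<N. b n *\<^sub>R (a (Suc n) - a n)) - b N *\<^sub>R a N" "b N *\<^sub>R a N"] by simp
    also have "\<dots> \<le> b N + b N"
      using abel_bound[of a b N] a b by (intro add_mono) auto
    finally have 1: "norm (\<Sum>n<N. b n *\<^sub>R (a (Suc n) - a n)) \<le> 2 * b N" by simp
    have "\<i> * of_real (real j) * (\<Sum>i<N. a i) = (\<Sum>n<N. b n *\<^sub>R (a (Suc n) - a n))
        + (\<Sum>n<N. \<i> * of_real (real j) * a n - b n *\<^sub>R (a (Suc n) - a n))"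
      by (simp only: sum_subtractf sum_distrib_left) simp
    also have "norm \<dots> \<le> 2 * b N + (\<Sum>n<N. (real j)\<^sup>2 * k n)"
      using step by (intro norm_triangle_le add_mono 1 order_trans[OF norm_sum] sum_mono)
    finally show ?thesis using j by (simp add: norm_mult pos_le_divide_eq mult.commute)
  qed
  have "(\<lambda>N. (2 / real j) * (1 / (real N * k N)) + real j * ((\<Sum>i<N. k i) / real N)) \<longlonglongrightarrow> (2 / real j) * 0 + real j * 0"
    by (intro tendsto_add tendsto_mult tendsto_const slow cesaro_null k(4))
  then have lim: "(\<lambda>N. (2 / real j) * (1 / (real N * k N)) + real j * ((\<Sum>i<N. k i) / real N)) \<longlonglongrightarrow> 0" by simp
  show ?thesis
  proof (rule Lim_null_comparison[OF _ lim], rule always_eventually, rule allI)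
    fix N
    have "norm ((\<Sum>i<N. e i ^ j) / of_nat N) = norm (\<Sum>i<N. a i) / real N"
      by (simp add: a_def norm_divide)
    also have "\<dots> \<le> ((2 * b N + (\<Sum>i<N. (real j)\<^sup>2 * k i)) / real j) / real N"
      by (intro divide_right_mono bound) simp
    also have "(\<Sum>i<N. (real j)\<^sup>2 * k i) = (real j)\<^sup>2 * (\<Sum>i<N. k i)" by (simp add: sum_distrib_left)
    also have "(2 * b N + (real j)\<^sup>2 * (\<Sum>i<N. k i)) / real j / real N
        = (2 / real j) * (1 / (real N * k N)) + real j * ((\<Sum>i<N. k i) / real N)"
      using j by (simp add: b_def add_divide_distrib power2_eq_square)
    finally show "norm ((\<Sum>i<N. e i ^ j) / of_nat N) \<le> (2 / real j) * (1 / (real N * k N)) + real j * ((\<Sum>i<N. k i) / real N)" .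
  qed
qed

lemma slow_rotation_equidistribution:
  fixes k :: "nat \<Rightarrow> real" and e :: "nat \<Rightarrow> complex"
  assumes k: "\<And>n. 0 < k n" "\<And>n. k n \<le> 1" "\<And>n. k (Suc n) \<le> k n" "k \<longlonglongrightarrow> 0"
    and slow: "(\<lambda>n. 1 / (real n * k n)) \<longlonglongrightarrow> 0"
    and e: "\<And>n. norm (e n) = 1" "\<And>n. e (Suc n) = e n * sgn (Complex 1 (k n))"
    and f: "continuous_on circle f"
  shows "(\<lambda>n. (\<Sum>i<n. f (e i)) / real n) \<longlonglongrightarrow> circle_mean f"
proof -
  have "uniform_limit {()} (\<lambda>n s. (\<Sum>i<n. f (e i)) / real n) (\<lambda>_. circle_mean f) sequentially"
  proof (rule circle_equidistribution[OF _ e(1) f])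
    fix j :: nat assume "j > 0"
    from tendstoD[OF slow_rotation_chars[OF k slow e this]]
    show "uniform_limit {()} (\<lambda>n s. (\<Sum>i<n. e i ^ j) / of_nat n) (\<lambda>_. 0) sequentially"
      unfolding uniform_limit_iff by simp
  qed
  then show ?thesis unfolding uniform_limit_iff tendsto_iff by simp
qed

text \<open>A continuous majorant of the indicator of the band \<open>|Im z| \<le> \<delta>\<close>
  that vanishes for \<open>|Im z| \<ge> 2 \<delta>\<close>. Its companion \<open>clamp_Im\<close> is
  a continuous version of the sign of \<open>Im z\<close>, exact off this band.\<close>

definition axis_bump :: "real \<Rightarrow> complex \<Rightarrow> real" where
  "axis_bump \<delta> z = max 0 (2 - \<bar>Im z\<bar> / \<delta>)"

definition clamp_Im :: "real \<Rightarrow> complex \<Rightarrow> real" where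
  "clamp_Im \<delta> z = max (-1) (min 1 (Im z / \<delta>))"

lemma continuous_axis_bump: "\<delta> > 0 \<Longrightarrow> continuous_on S (axis_bump \<delta>)"
  unfolding axis_bump_def by (intro continuous_intros) auto

lemma continuous_clamp_Im: "\<delta> > 0 \<Longrightarrow> continuous_on S (clamp_Im \<delta>)"
  unfolding clamp_Im_def by (intro continuous_intros) auto

lemma circle_mean_clamp_Im:
  assumes "\<delta> > 0" shows "circle_mean (clamp_Im \<delta>) = 0"
proof -
  have "circle_mean (clamp_Im \<delta>) = circle_mean (\<lambda>z. clamp_Im \<delta> (-1 * z))"
    by (rule circle_mean_rotate[symmetric]) (auto intro!: continuous_clamp_Im assms)
  also have "(\<lambda>z. clamp_Im \<delta> (-1 * z)) = (\<lambda>z. - clamp_Im \<delta> z)"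
    by (auto simp: clamp_Im_def fun_eq_iff max_def min_def)
  also have "circle_mean \<dots> = - circle_mean (clamp_Im \<delta>)"
    by (rule circle_mean_bounded_linear[OF bounded_linear_minus[OF bounded_linear_ident]])
       (rule continuous_clamp_Im[OF assms])
  finally show ?thesis by simp
qed

lemma AE_circle_Im: "AE z in circle_measure. Im z \<noteq> 0"
proof (rule AE_I[of _ _ "{z. Im z = 0}"])
  have cl: "{z. Im z = 0} \<in> sets borel" by measurable
  then show "{z. Im z = 0} \<in> sets circle_measure" by simp
  have "{0..<2*pi} \<inter> cis -` {z. Im z = 0} \<subseteq> range (\<lambda>n::int. of_int n * pi)"
    by (auto simp: sin_zero_iff_int2)
  then have "countable ({0..<2*pi} \<inter> cis -` {z. Im z = 0})"
    by (rule countable_subset) simp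
  then show "emeasure circle_measure {z. Im z = 0} = 0"
    unfolding emeasure_circle_measure[OF cl] by (simp add: emeasure_lborel_countable)
qed auto

text \<open>Off the real axis, which is null for the circle measure, the bumps are eventually 0;
  dominated convergence applies.\<close>

lemma circle_mean_axis_bump: "(\<lambda>m. circle_mean (axis_bump (1 / real (Suc m)))) \<longlonglongrightarrow> 0"
proof -
  let ?s = "\<lambda>m z. indicator circle z *\<^sub>R axis_bump (1 / real (Suc m)) z"
  have "(\<lambda>m. LINT z|circle_measure. ?s m z) \<longlonglongrightarrow> (LINT z|circle_measure. 0)"
  proof (rule integral_dominated_convergence[where w = "\<lambda>_. 2"])
    show "?s m \<in> borel_measurable circle_measure" for m
      using borel_measurable_continuous_on_indicator[OF _ continuous_axis_bump[of "1 / real (Suc m)" circle]] by simp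
    show "AE z in circle_measure. norm (?s m z) \<le> 2" for m
      by (auto simp: indicator_def axis_bump_def)
    show "AE z in circle_measure. (\<lambda>m. ?s m z) \<longlonglongrightarrow> 0"
      using AE_circle_Im
    proof eventually_elim
      case (elim z)
      obtain N :: nat where N: "2 / \<bar>Im z\<bar> < real N" using reals_Archimedean2 by blast
      have "?s m z = 0" if "m \<ge> N" for m
      proof -
        have "2 / \<bar>Im z\<bar> < real (Suc m)" using N that by linarith
        then have "2 < \<bar>Im z\<bar> * real (Suc m)" using elim by (simp add: pos_divide_less_eq mult.commute)
        then have "axis_bump (1 / real (Suc m)) z = 0" by (simp add: axis_bump_def)
        then show ?thesis by simp
      qed
      then have "\<forall>\<^sub>F m in sequentially. ?s m z = 0" by (auto simp: eventually_sequentially)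
      then show ?case by (rule tendsto_eventually)
    qed
  qed auto
  then show ?thesis by (simp add: circle_mean_def set_lebesgue_integral_def)
qed

definition rot_coord :: "real \<Rightarrow> complex \<Rightarrow> complex" where
  "rot_coord k w = sgn (Complex (Im w) (k * Re w))"

text \<open>For small \<open>k\<close> the vector \<open>Complex (Im w) (k * Re w)\<close> points
  away from the real axis only if \<open>Im w\<close> is of order \<open>k\<close>: then
  \<open>w\<close> is near 1 or -1, according to the sign of the imaginary part. Within the band the
  trivial bounds 1 and 2 are covered by the bump, which is at least 1 there.\<close>

lemma rot_coord_bounds:
  assumes k: "k > 0" and w: "norm w = 1" and \<delta>: "\<delta> > 0"
  shows "(Im w)\<^sup>2 \<le> (k / \<delta>)\<^sup>2 + axis_bump \<delta> (rot_coord k w)"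
    and "\<bar>Re w - clamp_Im \<delta> (rot_coord k w)\<bar> \<le> (k / \<delta>)\<^sup>2 + 2 * axis_bump \<delta> (rot_coord k w)"
proof -
  define \<xi> where "\<xi> = Complex (Im w) (k * Re w)"
  define e where "e = rot_coord k w"
  have sq: "(Re w)\<^sup>2 + (Im w)\<^sup>2 = 1" using w by (simp add: cmod_def)
  have ri: "\<bar>Re w\<bar> \<le> 1" "(Im w)\<^sup>2 \<le> 1"
    using sq abs_Re_le_cmod[of w] w by (auto simp: zero_le_power2) (smt (verit) zero_le_power2)
  have "\<xi> \<noteq> 0" using sq k by (auto simp: \<xi>_def complex_eq_iff)
  then have n: "norm \<xi> > 0" by simp
  have e: "Im e = k * Re w / norm \<xi>" by (simp add: e_def rot_coord_def \<xi>_def[symmetric] Im_sgn) (simp add: \<xi>_def)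
  have b0: "axis_bump \<delta> e \<ge> 0" by (simp add: axis_bump_def)
  have c1: "\<bar>clamp_Im \<delta> e\<bar> \<le> 1" by (auto simp: clamp_Im_def)
  have "(Im w)\<^sup>2 \<le> (k / \<delta>)\<^sup>2 + axis_bump \<delta> e \<and> \<bar>Re w - clamp_Im \<delta> e\<bar> \<le> (k / \<delta>)\<^sup>2 + 2 * axis_bump \<delta> e"
  proof (cases "\<bar>Im e\<bar> \<ge> \<delta>")
    case True
    have "\<bar>Im w\<bar> \<le> norm \<xi>" using abs_Re_le_cmod[of \<xi>] by (simp add: \<xi>_def)
    moreover have "\<delta> * norm \<xi> \<le> k * \<bar>Re w\<bar>"
      using True n k by (simp add: e abs_mult pos_le_divide_eq)
    moreover have "k * \<bar>Re w\<bar> \<le> k" using ri(1) k by (simp add: mult_left_le)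
    ultimately have "\<delta> * \<bar>Im w\<bar> \<le> k" using \<delta> by (smt (verit) mult_left_mono)
    then have "\<bar>Im w\<bar> \<le> \<bar>k / \<delta>\<bar>" using \<delta> k by (simp add: pos_le_divide_eq mult.commute)
    then have I: "(Im w)\<^sup>2 \<le> (k / \<delta>)\<^sup>2" by (rule abs_le_square_iff[THEN iffD1])
    have "Re w \<noteq> 0" using True \<delta> by (auto simp: e)
    have "\<bar>Re w - clamp_Im \<delta> e\<bar> = 1 - \<bar>Re w\<bar>"
    proof (cases "Re w > 0")
      case True
      then have "Im e \<ge> \<delta>" using \<open>\<bar>Im e\<bar> \<ge> \<delta>\<close> n k by (simp add: e)
      then have "clamp_Im \<delta> e = 1" using \<delta> by (simp add: clamp_Im_def min_def max_def)
      then show ?thesis using True ri(1) by simp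
    next
      case False
      then have "Im e \<le> 0" using n k by (simp add: e divide_nonpos_pos mult_nonneg_nonpos)
      then have "Im e \<le> - \<delta>" using \<open>\<bar>Im e\<bar> \<ge> \<delta>\<close> by linarith
      then have "Im e / \<delta> \<le> -1" using \<delta> by (simp add: pos_divide_le_eq)
      then have "clamp_Im \<delta> e = -1" by (simp add: clamp_Im_def)
      then show ?thesis using False ri(1) by simp
    qed
    also have "(Re w)\<^sup>2 = \<bar>Re w\<bar> * \<bar>Re w\<bar>" by (simp add: power2_eq_square)
    then have "1 - \<bar>Re w\<bar> \<le> 1 - (Re w)\<^sup>2" using ri(1) mult_left_le[of "\<bar>Re w\<bar>" "\<bar>Re w\<bar>"] by simp
    also have "\<dots> \<le> (k / \<delta>)\<^sup>2" using sq I by linarith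
    finally show ?thesis using I b0 by linarith
  next
    case False
    then have "\<bar>Im e\<bar> / \<delta> \<le> 1" using \<delta> by simp
    then have "axis_bump \<delta> e \<ge> 1" by (simp add: axis_bump_def)
    then show ?thesis
      using ri c1 zero_le_power2[of "k / \<delta>"] abs_triangle_ineq4[of "Re w" "clamp_Im \<delta> e"]
      by (intro conjI; linarith)
  qed
  then show "(Im w)\<^sup>2 \<le> (k / \<delta>)\<^sup>2 + axis_bump \<delta> (rot_coord k w)"
    and "\<bar>Re w - clamp_Im \<delta> (rot_coord k w)\<bar> \<le> (k / \<delta>)\<^sup>2 + 2 * axis_bump \<delta> (rot_coord k w)"
    by (simp_all add: e_def)
qed

lemma rad_ge_1: assumes "\<bar>z\<bar> \<le> 1" shows "rad z \<ge> 1"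
proof -
  have "z^4 = z\<^sup>2 * z\<^sup>2" by (simp flip: power_add)
  moreover have "z\<^sup>2 \<le> 1" using assms by (simp add: abs_square_le_1)
  ultimately show ?thesis using mult_left_le[of "z\<^sup>2" "z\<^sup>2"] by (simp add: rad_def)
qed

text \<open>The new coordinate is scaled by the new height \<open>z / rad z\<close>, so the factor
  \<open>rad z\<close> in the real part of \<open>lin\<close> cancels. What remains, up to a
  positive factor, is multiplication by \<open>Complex 1 \<bar>z\<bar>\<close>.\<close>

lemma rot_coord_step:
  assumes z: "0 < \<bar>z\<bar>" "\<bar>z\<bar> \<le> 1" and w: "norm w = 1"
  shows "rot_coord \<bar>z / rad z\<bar> (sgn (lin z w)) = rot_coord \<bar>z\<bar> w * sgn (Complex 1 \<bar>z\<bar>)"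
proof -
  have r: "rad z > 0" using rad_pos z by blast
  have "w \<noteq> 0" using w by auto
  then have nz: "lin z w \<noteq> 0" using lin_nonzero z(2) by blast
  define c where "c = inverse (norm (lin z w))"
  have c: "c > 0" using nz by (simp add: c_def)
  have sg: "sgn (lin z w) = c *\<^sub>R lin z w" by (simp add: c_def sgn_div_norm)
  have "\<bar>z / rad z\<bar> * Re (sgn (lin z w)) = c * (\<bar>z\<bar> * (Re w + Im w))"
    unfolding sg using r by (simp add: lin_def)
  moreover have "Im (sgn (lin z w)) = c * (Im w - \<bar>z\<bar> * \<bar>z\<bar> * Re w)"
    unfolding sg by (simp add: lin_def power2_eq_square)
  ultimately have "Complex (Im (sgn (lin z w))) (\<bar>z / rad z\<bar> * Re (sgn (lin z w)))
      = c *\<^sub>R (Complex (Im w) (\<bar>z\<bar> * Re w) * Complex 1 \<bar>z\<bar>)"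
    by (simp add: complex_eq_iff algebra_simps)
  then show ?thesis
    unfolding rot_coord_def using c by (simp add: sgn_scaleR sgn_mult)
qed

lemma ht_T: "ht (T x) = ht x / rad (ht x)" and snd_T: "snd (T x) = sgn (lin (ht x) (snd x))"
  by (simp_all add: T_eq)

text \<open>All bounds come from the exact recursion
  \<open>1 / (k (n+1))^2 = 1 / (k n)^2 + 1 - (k n)^2\<close>. The upper bound on
  \<open>1 / (k n)^2\<close> makes \<open>1 / (n * k n)\<close> tend to 0; the lower one makes
  \<open>k n\<close> tend to 0 for starting heights below 1.\<close>

lemma height_orbit:
  assumes x: "x \<in> S2xS1" "0 < \<bar>ht x\<bar>" and k_def: "\<And>n. k n = \<bar>ht ((T ^^ n) x)\<bar>"
  shows "0 < k n" "k n \<le> 1" "k (Suc n) \<le> k n" "1 / (k n)\<^sup>2 \<le> 1 / (k 0)\<^sup>2 + real n"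
    "real n * (1 - (k 0)\<^sup>2) \<le> 1 / (k n)\<^sup>2"
proof -
  have k1: "k n \<le> 1" for n using S2xS1_ht_le_1 T_iterate_mem x(1) by (simp add: k_def)
  have kS: "k (Suc n) = k n / rad (ht ((T ^^ n) x))" for n
    using rad_pos[of "ht ((T ^^ n) x)"] k1[of n] by (simp add: k_def ht_T)
  have r1: "rad (ht ((T ^^ n) x)) \<ge> 1" for n using rad_ge_1 k1[of n] by (simp add: k_def)
  have kpos: "0 < k n" for n
  proof (induction n)
    case (Suc n)
    then show ?case using kS[of n] r1[of n] by simp
  qed (use x in \<open>simp add: k_def\<close>)
  have kmono: "k (Suc n) \<le> k n" for n
    using kS[of n] r1[of n] kpos[of n] by (simp add: pos_divide_le_eq mult_le_cancel_left1)
  have inv: "1 / (k (Suc n))\<^sup>2 = 1 / (k n)\<^sup>2 + (1 - (k n)\<^sup>2)" for n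
  proof -
    have "(rad (ht ((T ^^ n) x)))\<^sup>2 = 1 + (k n)\<^sup>2 - (k n)^4"
      using rad_sq[of "ht ((T ^^ n) x)"] k1[of n] by (simp add: k_def power4_eq_xxxx power2_eq_square abs_mult_self mult.assoc)
    then have "1 / (k (Suc n))\<^sup>2 = (1 + (k n)\<^sup>2 - (k n)^4) / (k n)\<^sup>2"
      by (simp add: kS power_divide)
    also have "\<dots> = 1 / (k n)\<^sup>2 + (1 - (k n)\<^sup>2)"
      using kpos[of n] by (simp add: field_simps power2_eq_square power4_eq_xxxx)
    finally show ?thesis .
  qed
  have k0: "k n \<le> k 0" for n by (induction n) (use kmono in \<open>auto intro: order_trans\<close>)
  show "0 < k n" "k n \<le> 1" "k (Suc n) \<le> k n" by (fact kpos k1 kmono)+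
  show "1 / (k n)\<^sup>2 \<le> 1 / (k 0)\<^sup>2 + real n"
  proof (induction n)
    case (Suc n)
    then show ?case using inv[of n] zero_le_power2[of "k n"] unfolding of_nat_Suc by linarith
  qed simp
  show "real n * (1 - (k 0)\<^sup>2) \<le> 1 / (k n)\<^sup>2"
  proof (induction n)
    case (Suc n)
    have "(k n)\<^sup>2 \<le> (k 0)\<^sup>2" using k0[of n] kpos[of n] by (simp add: power_mono)
    moreover have "real (Suc n) * (1 - (k 0)\<^sup>2) = real n * (1 - (k 0)\<^sup>2) + (1 - (k 0)\<^sup>2)"
      by (simp add: algebra_simps)
    ultimately show ?case using Suc unfolding inv[of n] by linarith
  qed simp
qed

lemma height_tendsto_0:
  assumes x: "x \<in> S2xS1" "\<bar>ht x\<bar> < 1"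
  shows "(\<lambda>n. ht ((T ^^ n) x)) \<longlonglongrightarrow> 0"
proof (cases "ht x = 0")
  case True
  have "ht ((T ^^ n) x) = 0" for n by (induction n) (simp_all add: True ht_T)
  then show ?thesis by simp
next
  case False
  define k where "k n = \<bar>ht ((T ^^ n) x)\<bar>" for n
  note h = height_orbit[of x k, OF x(1) _ k_def]
  define c where "c = 1 - (k 0)\<^sup>2"
  have "(k 0)\<^sup>2 < 1" using x(2) by (simp add: k_def abs_square_less_1)
  then have c: "c > 0" by (simp add: c_def)
  have "(\<lambda>n. (k n)\<^sup>2) \<longlonglongrightarrow> 0"
  proof (rule Lim_null_comparison[OF _ lim_const_over_n[of "1 / c"]])
    have "norm ((k n)\<^sup>2) \<le> (1 / c) / real n" if "n > 0" for n
    proof -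
      have "real n * c \<le> 1 / (k n)\<^sup>2" "0 < (k n)\<^sup>2" using h(1,5)[of n] False by (auto simp: k_def c_def)
      moreover have "0 < real n * c" using c that by simp
      ultimately have "(k n)\<^sup>2 \<le> 1 / (real n * c)" by (simp add: field_simps)
      then show ?thesis by (simp add: mult.commute)
    qed
    then show "\<forall>\<^sub>F n in sequentially. norm ((k n)\<^sup>2) \<le> (1 / c) / real n"
      using eventually_gt_at_top[of 0] by (rule eventually_mono[rotated])
  qed
  then have "(\<lambda>n. sqrt ((k n)\<^sup>2)) \<longlonglongrightarrow> sqrt 0" by (rule tendsto_real_sqrt)
  then show ?thesis by (simp add: k_def tendsto_rabs_zero_iff)
qed

text \<open>The phase \<open>e n\<close> equidistributes, and \<open>Re (w n)\<close> is within
  \<open>(k n / \<delta>)^2\<close> of the sign of \<open>Im (e n)\<close>, except in a band of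
  small mean. For fixed \<open>\<delta>\<close> the errors from \<open>k\<close> average out; the
  mean of the band is made small by the choice of \<open>\<delta>\<close>. The two half planes have
  equal mass, hence the limit 0 for \<open>Re w\<close>.\<close>

lemma base_averages:
  assumes x: "x \<in> S2xS1" "0 < \<bar>ht x\<bar>" "\<bar>ht x\<bar> < 1"
  shows "(\<lambda>n. (\<Sum>i<n. (Im (snd ((T ^^ i) x)))\<^sup>2) / real n) \<longlonglongrightarrow> 0"
    and "(\<lambda>n. (\<Sum>i<n. Re (snd ((T ^^ i) x))) / real n) \<longlonglongrightarrow> 0"
proof -
  define k where "k n = \<bar>ht ((T ^^ n) x)\<bar>" for n
  define w where "w n = snd ((T ^^ n) x)" for n
  define e where "e n = rot_coord (k n) (w n)" for n
  note k = height_orbit[of x k, OF x(1,2) k_def]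
  have w1: "norm (w n) = 1" for n using T_iterate_mem[OF x(1)] by (simp add: w_def mem_S2xS1)
  have eS: "e (Suc n) = e n * sgn (Complex 1 (k n))" for n
    using rot_coord_step[of "ht ((T ^^ n) x)" "w n"] k(1,2)[of n] w1[of n]
    by (simp add: e_def w_def k_def ht_T snd_T)
  have e1: "norm (e n) = 1" for n
  proof -
    have "Complex (Im (w n)) (k n * Re (w n)) \<noteq> 0"
    proof
      assume "Complex (Im (w n)) (k n * Re (w n)) = 0"
      then have "w n = 0" using k(1)[of n] by (simp add: complex_eq_iff)
      then show False using w1[of n] by simp
    qed
    then show ?thesis by (simp add: e_def rot_coord_def norm_sgn)
  qed
  have k0: "k \<longlonglongrightarrow> 0" using tendsto_rabs_zero[OF height_tendsto_0[OF x(1,3)]] by (simp add: k_def[abs_def])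
  have slow: "(\<lambda>n. 1 / (real n * k n)) \<longlonglongrightarrow> 0"
  proof -
    define C where "C = 1 / (k 0)\<^sup>2"
    have "(\<lambda>n. (1 / (real n * k n))\<^sup>2) \<longlonglongrightarrow> 0"
    proof (rule Lim_null_comparison)
      have "(\<lambda>n. C / real n * (1 / real n) + 1 / real n) \<longlonglongrightarrow> 0 * 0 + 0"
        by (intro tendsto_add tendsto_mult lim_const_over_n)
      then show "(\<lambda>n. C / real n * (1 / real n) + 1 / real n) \<longlonglongrightarrow> 0" by simp
      have "norm ((1 / (real n * k n))\<^sup>2) \<le> C / real n * (1 / real n) + 1 / real n" if "n > 0" for n
      proof -
        have "(1 / (real n * k n))\<^sup>2 = (1 / (k n)\<^sup>2) / (real n)\<^sup>2" by (simp add: power_divide power_mult_distrib)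
        also have "\<dots> \<le> (C + real n) / (real n)\<^sup>2"
          using k(4)[of n] by (intro divide_right_mono) (auto simp: C_def)
        also have "\<dots> = C / real n * (1 / real n) + 1 / real n"
          using that by (simp add: add_divide_distrib power2_eq_square)
        finally show ?thesis by simp
      qed
      then show "\<forall>\<^sub>F n in sequentially. norm ((1 / (real n * k n))\<^sup>2) \<le> C / real n * (1 / real n) + 1 / real n"
        using eventually_gt_at_top[of 0] by (rule eventually_mono[rotated])
    qed
    then have "(\<lambda>n. sqrt ((1 / (real n * k n))\<^sup>2)) \<longlonglongrightarrow> sqrt 0" by (rule tendsto_real_sqrt)
    moreover have "0 \<le> 1 / (real n * k n)" for n using k(1)[of n] by simp
    ultimately show ?thesis by (simp only: real_sqrt_abs abs_of_nonneg real_sqrt_zero)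
  qed
  note eq = slow_rotation_equidistribution[OF k(1,2,3) k0 slow e1 eS]
  have kk: "(\<lambda>n. (\<Sum>i<n. (k i / \<delta>)\<^sup>2) / real n) \<longlonglongrightarrow> 0" for \<delta>
  proof (rule cesaro_null)
    have "(\<lambda>n. (k n / \<delta>)\<^sup>2) \<longlonglongrightarrow> (0 / \<delta>)\<^sup>2" unfolding divide_inverse by (intro tendsto_intros k0)
    then show "(\<lambda>n. (k n / \<delta>)\<^sup>2) \<longlonglongrightarrow> 0" by simp
  qed
  have small: "\<exists>\<delta>>0. circle_mean (axis_bump \<delta>) < r" if r: "r > 0" for r
  proof -
    from order_tendstoD(2)[OF circle_mean_axis_bump r] obtain m where "circle_mean (axis_bump (1 / real (Suc m))) < r"
      by (auto simp: eventually_sequentially)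
    then show ?thesis by (intro exI[of _ "1 / real (Suc m)"]) simp
  qed
  show "(\<lambda>n. (\<Sum>i<n. (Im (snd ((T ^^ i) x)))\<^sup>2) / real n) \<longlonglongrightarrow> 0"
    unfolding w_def[symmetric]
  proof (rule tendstoI)
    fix r :: real assume r: "r > 0"
    then obtain \<delta> where \<delta>: "\<delta> > 0" "circle_mean (axis_bump \<delta>) < r" using small by blast
    have "(\<lambda>n. (\<Sum>i<n. (k i / \<delta>)\<^sup>2) / real n + (\<Sum>i<n. axis_bump \<delta> (e i)) / real n) \<longlonglongrightarrow> 0 + circle_mean (axis_bump \<delta>)"
      by (intro tendsto_add kk eq continuous_axis_bump \<delta>)
    then have "\<forall>\<^sub>F n in sequentially. (\<Sum>i<n. (k i / \<delta>)\<^sup>2) / real n + (\<Sum>i<n. axis_bump \<delta> (e i)) / real n < r"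
      using \<delta>(2) by (intro order_tendstoD) auto
    then show "\<forall>\<^sub>F n in sequentially. dist ((\<Sum>i<n. (Im (w i))\<^sup>2) / real n) 0 < r"
    proof eventually_elim
      case (elim n)
      have "(\<Sum>i<n. (Im (w i))\<^sup>2) \<le> (\<Sum>i<n. (k i / \<delta>)\<^sup>2 + axis_bump \<delta> (e i))"
        unfolding e_def by (intro sum_mono rot_coord_bounds k w1 \<delta>)
      then have "(\<Sum>i<n. (Im (w i))\<^sup>2) / real n \<le> (\<Sum>i<n. (k i / \<delta>)\<^sup>2) / real n + (\<Sum>i<n. axis_bump \<delta> (e i)) / real n"
        unfolding sum.distrib add_divide_distrib[symmetric] by (rule divide_right_mono) simp
      moreover have "0 \<le> (\<Sum>i<n. (Im (w i))\<^sup>2) / real n" by (intro divide_nonneg_nonneg sum_nonneg) auto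
      ultimately show ?case using elim by simp
    qed
  qed
  show "(\<lambda>n. (\<Sum>i<n. Re (snd ((T ^^ i) x))) / real n) \<longlonglongrightarrow> 0"
    unfolding w_def[symmetric]
  proof (rule tendstoI)
    fix r :: real assume r: "r > 0"
    then obtain \<delta> where \<delta>: "\<delta> > 0" "circle_mean (axis_bump \<delta>) < r / 4" using small[of "r / 4"] by auto
    have "(\<lambda>n. (\<Sum>i<n. (k i / \<delta>)\<^sup>2) / real n + 2 * ((\<Sum>i<n. axis_bump \<delta> (e i)) / real n)) \<longlonglongrightarrow> 0 + 2 * circle_mean (axis_bump \<delta>)"
      by (intro tendsto_add tendsto_mult tendsto_const kk eq continuous_axis_bump \<delta>)
    then have "\<forall>\<^sub>F n in sequentially. (\<Sum>i<n. (k i / \<delta>)\<^sup>2) / real n + 2 * ((\<Sum>i<n. axis_bump \<delta> (e i)) / real n) < r / 2"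
      using \<delta>(2) by (intro order_tendstoD) auto
    moreover have "\<forall>\<^sub>F n in sequentially. dist ((\<Sum>i<n. clamp_Im \<delta> (e i)) / real n) 0 < r / 2"
      using tendstoD[OF eq[OF continuous_clamp_Im[OF \<delta>(1)]], of "r / 2"] r circle_mean_clamp_Im[OF \<delta>(1)] by simp
    ultimately show "\<forall>\<^sub>F n in sequentially. dist ((\<Sum>i<n. Re (w i)) / real n) 0 < r"
    proof eventually_elim
      case (elim n)
      have "\<bar>(\<Sum>i<n. Re (w i)) - (\<Sum>i<n. clamp_Im \<delta> (e i))\<bar> \<le> (\<Sum>i<n. \<bar>Re (w i) - clamp_Im \<delta> (e i)\<bar>)"
        unfolding sum_subtractf[symmetric] by (rule sum_abs)
      also have "\<dots> \<le> (\<Sum>i<n. (k i / \<delta>)\<^sup>2 + 2 * axis_bump \<delta> (e i))"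
        unfolding e_def by (intro sum_mono rot_coord_bounds k w1 \<delta>)
      finally have "\<bar>(\<Sum>i<n. Re (w i)) - (\<Sum>i<n. clamp_Im \<delta> (e i))\<bar> / real n
          \<le> (\<Sum>i<n. (k i / \<delta>)\<^sup>2 + 2 * axis_bump \<delta> (e i)) / real n" by (rule divide_right_mono) simp
      also have "\<dots> = (\<Sum>i<n. (k i / \<delta>)\<^sup>2) / real n + 2 * ((\<Sum>i<n. axis_bump \<delta> (e i)) / real n)"
        by (simp add: sum.distrib add_divide_distrib sum_distrib_left)
      finally have "\<bar>(\<Sum>i<n. Re (w i)) - (\<Sum>i<n. clamp_Im \<delta> (e i))\<bar> / real n < r / 2" using elim(1) by linarith
      then have "\<bar>(\<Sum>i<n. Re (w i)) / real n - (\<Sum>i<n. clamp_Im \<delta> (e i)) / real n\<bar> < r / 2"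
        by (simp flip: diff_divide_distrib)
      then show ?case using elim(2) unfolding dist_real_def by linarith
    qed
  qed
qed

section \<open>The natural measure\<close>

text \<open>Over \<open>w = 1\<close> every orbit at height 0 tends to the fixed point
  \<open>PA\<close>; over \<open>w = -1\<close> the map turns the circle \<open>CI\<close> by
  \<open>lam\<close>.\<close>

definition PA :: pt3 where "PA = pt 1 0 1"
definition CI :: "complex \<Rightarrow> pt3" where "CI u = pt u 0 (-1)"

lemma PA_mem: "PA \<in> S2xS1" and CI_mem: "CI u \<in> S2xS1 \<longleftrightarrow> norm u = 1"
  by (auto simp: PA_def CI_def mem_S2xS1 abs_square_eq_1)

lemma stretch_0 [simp]: "stretch 0 = 1" and rad_0 [simp]: "rad 0 = 1"
  by (simp_all add: stretch_def rad_def)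

lemma T_PA: "T PA = PA"
proof -
  have "mob lam (par 1) 1 = 1"
    by (simp add: mob_def par_def lam_def complex_eq_iff Re_divide Im_divide power2_eq_square)
  moreover have "lin 0 1 = 1" by (simp add: lin_def complex_eq_iff)
  ultimately show ?thesis by (simp add: T_eq PA_def)
qed

lemma T_pt_1: "T (pt t 0 1) = pt (mob lam (par 1) t) 0 1"
proof -
  have "lin 0 1 = 1" by (simp add: lin_def complex_eq_iff)
  then show ?thesis by (simp add: T_eq)
qed

lemma T_CI: "T (CI u) = CI (lam * u)"
proof -
  have "lin 0 (-1) = -1" by (simp add: lin_def complex_eq_iff)
  moreover have "sgn (-1 :: complex) = -1" by (simp add: sgn_div_norm)
  ultimately show ?thesis by (simp add: T_eq CI_def mob_def par_def)
qed

lemma T_iterate_CI: "(T ^^ n) (CI u) = CI (lam ^ n * u)"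
  by (induction n) (simp_all add: T_CI mult.assoc)

lemma T_iterate_pt_1: "(T ^^ n) (pt t 0 1) = pt ((mob lam (par 1) ^^ n) t) 0 1"
  by (induction n) (simp_all add: T_pt_1)

lemma continuous_CI [continuous_intros]: "continuous_on S CI"
  unfolding CI_def[abs_def] by (intro continuous_intros)

lemma measurable_CI [measurable]: "CI \<in> borel_measurable borel"
  by (intro borel_measurable_continuous_onI continuous_intros)

definition mu :: "pt3 measure" where
  "mu = distr (measure_pmf (bernoulli_pmf (1/2)) \<Otimes>\<^sub>M circle_measure) borel
     (\<lambda>(b, u). if b then PA else CI u)"

lemma sets_mu [simp, measurable_cong]: "sets mu = sets borel" and space_mu [simp]: "space mu = UNIV"
  by (simp_all add: mu_def)

lemma measurable_mix [measurable]:
  "(\<lambda>(b, u). if b then PA else CI u) \<in> measure_pmf p \<Otimes>\<^sub>M circle_measure \<rightarrow>\<^sub>M borel"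
  by measurable

lemma prob_space_mu: "prob_space mu"
  unfolding mu_def
  by (intro prob_space.prob_space_distr prob_space_pair prob_space_measure_pmf prob_space_circle_measure) measurable

interpretation mu: prob_space mu by (rule prob_space_mu)

lemma nn_integral_mu:
  assumes [measurable]: "f \<in> borel_measurable borel"
  shows "(\<integral>\<^sup>+x. f x \<partial>mu) = (f PA + (\<integral>\<^sup>+u. f (CI u) \<partial>circle_measure)) / 2"
proof -
  have "(\<integral>\<^sup>+x. f x \<partial>mu) = (\<integral>\<^sup>+x. f (case x of (b, u) \<Rightarrow> if b then PA else CI u)
      \<partial>(measure_pmf (bernoulli_pmf (1/2)) \<Otimes>\<^sub>M circle_measure))"
    unfolding mu_def by (rule nn_integral_distr) measurable
  also have "\<dots> = (\<integral>\<^sup>+b. \<integral>\<^sup>+u. f (if b then PA else CI u) \<partial>circle_measure \<partial>measure_pmf (bernoulli_pmf (1/2)))"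
    by (subst circle.nn_integral_fst[symmetric]) (simp_all add: case_prod_beta)
  also have "\<dots> = (f PA + (\<integral>\<^sup>+u. f (CI u) \<partial>circle_measure)) / 2"
  proof -
    have "ennreal (1/2) = inverse 2" using inverse_ennreal[of 2] by (simp add: inverse_eq_divide)
    then show ?thesis
      using circle.emeasure_space_1
      by (subst nn_integral_bernoulli_pmf) (simp_all add: divide_ennreal_def distrib_right)
  qed
  finally show ?thesis .
qed

lemma emeasure_mu:
  assumes [measurable]: "A \<in> sets borel"
  shows "emeasure mu A = (indicator A PA + emeasure circle_measure (CI -` A)) / 2"
proof -
  have m: "CI -` A \<in> sets borel" using measurable_sets[OF measurable_CI assms] by simp
  have "emeasure mu A = (\<integral>\<^sup>+x. indicator A x \<partial>mu)" by simp
  also have "\<dots> = (indicator A PA + (\<integral>\<^sup>+u. indicator (CI -` A) u \<partial>circle_measure)) / 2"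
  proof -
    have "indicator (CI -` A) = (\<lambda>u. indicator A (CI u) :: ennreal)" by (auto simp: indicator_def fun_eq_iff)
    then show ?thesis by (simp only:) (rule nn_integral_mu, measurable)
  qed
  finally show ?thesis using m by simp
qed

lemma measure_mu:
  assumes "A \<in> sets borel"
  shows "measure mu A = (indicator A PA + measure circle_measure (CI -` A)) / 2"
proof -
  have "ennreal (measure mu A) = ennreal ((indicator A PA + measure circle_measure (CI -` A)) / 2)"
    using emeasure_mu[OF assms]
    by (simp add: mu.emeasure_eq_measure circle.emeasure_eq_measure ennreal_divide_numeral
        flip: ennreal_indicator ennreal_plus)
  then show ?thesis by simp
qed

lemma integral_mu:
  fixes f :: "pt3 \<Rightarrow> real"
  assumes [measurable]: "f \<in> borel_measurable borel" and B: "\<And>x. \<bar>f x\<bar> \<le> B"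
  shows "(LINT x|mu. f x) = (f PA + (LINT u|circle_measure. f (CI u))) / 2"
proof -
  let ?P = "measure_pmf (bernoulli_pmf (1/2)) \<Otimes>\<^sub>M circle_measure"
  interpret P: pair_prob_space "measure_pmf (bernoulli_pmf (1/2))" circle_measure ..
  have "(LINT x|mu. f x) = (LINT x|?P. f (case x of (b, u) \<Rightarrow> if b then PA else CI u))"
    unfolding mu_def by (rule integral_distr) measurable
  also have "\<dots> = (LINT b|measure_pmf (bernoulli_pmf (1/2)). LINT u|circle_measure. f (if b then PA else CI u))"
  proof (subst P.integral_fst'[symmetric])
    show "integrable ?P (\<lambda>x. f (case x of (b, u) \<Rightarrow> if b then PA else CI u))"
      by (rule P.integrable_const_bound[of _ B]) (use B in auto)
  qed simp
  also have "\<dots> = (f PA + (LINT u|circle_measure. f (CI u))) / 2"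
    using circle.prob_space by (simp add: integral_bernoulli_pmf add_divide_distrib)
  finally show ?thesis .
qed

lemma set_integral_mu:
  fixes f :: "pt3 \<Rightarrow> real"
  assumes f: "continuous_on S2xS1 f"
  shows "(LINT x:S2xS1|mu. f x) = (f PA + circle_mean (\<lambda>u. f (CI u))) / 2"
proof -
  have "bounded (f ` S2xS1)"
    by (intro compact_imp_bounded compact_continuous_image f compact_S2xS1)
  then obtain B where B: "\<And>x. x \<in> S2xS1 \<Longrightarrow> \<bar>f x\<bar> \<le> B" unfolding bounded_iff real_norm_def by blast
  have m: "(\<lambda>x. indicator S2xS1 x *\<^sub>R f x) \<in> borel_measurable borel"
    using borel_measurable_continuous_on_indicator[OF _ f] compact_S2xS1 borel_compact by blast
  have "(LINT x:S2xS1|mu. f x) = (indicator S2xS1 PA *\<^sub>R f PA + (LINT u|circle_measure. indicator S2xS1 (CI u) *\<^sub>R f (CI u))) / 2"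
    unfolding set_lebesgue_integral_def
    by (rule integral_mu[OF m, of "max B 0"]) (use B in \<open>auto simp: indicator_def le_max_iff_disj\<close>)
  also have "\<dots> = (f PA + circle_mean (\<lambda>u. f (CI u))) / 2"
  proof -
    have "indicator S2xS1 (CI u) = (indicator circle u :: real)" for u
      by (simp add: indicator_def CI_mem)
    then show ?thesis by (simp add: PA_mem circle_mean_def set_lebesgue_integral_def)
  qed
  finally show ?thesis .
qed

lemma T_vimage_measurable:
  assumes "A \<in> sets borel" shows "T -` A \<inter> S2xS1 \<in> sets borel"
proof -
  have X: "S2xS1 \<in> sets borel" using compact_S2xS1 by (rule borel_compact)
  have "T \<in> measurable (restrict_space borel S2xS1) borel"
    by (rule borel_measurable_continuous_on_restrict[OF continuous_on_T])
  from measurable_sets[OF this assms] show ?thesis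
    using X by (simp add: space_restrict_space sets_restrict_space_iff)
qed

lemma mu_invariant: "invariant_measure S2xS1 T mu"
  unfolding invariant_measure_def
proof
  fix A :: "pt3 set" assume A: "A \<in> sets borel"
  have m: "CI -` A \<in> sets borel" using measurable_sets[OF measurable_CI A] by simp
  have m': "CI -` (T -` A \<inter> S2xS1) \<in> sets borel"
    using measurable_sets[OF measurable_CI T_vimage_measurable[OF A]] by simp
  have ml: "(\<lambda>z. lam * z) -` (CI -` A) \<in> sets borel"
  proof -
    have "(\<lambda>z. lam * z) \<in> borel_measurable borel" by measurable
    from measurable_sets[OF this m] show ?thesis by simp
  qed
  have "emeasure circle_measure (CI -` (T -` A \<inter> S2xS1)) = emeasure circle_measure ((\<lambda>z. lam * z) -` (CI -` A))"
  proof (rule emeasure_eq_AE)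
    \<comment> \<open>The preimage is taken inside the manifold, so the two sets may differ off the
      unit circle, which is null.\<close>
    show "AE u in circle_measure. u \<in> CI -` (T -` A \<inter> S2xS1) \<longleftrightarrow> u \<in> (\<lambda>z. lam * z) -` (CI -` A)"
      using AE_circle by eventually_elim (auto simp: T_CI CI_mem)
  qed (use m' ml in auto)
  also have "\<dots> = emeasure (distr circle_measure borel (\<lambda>z. lam * z)) (CI -` A)"
    using m by (subst emeasure_distr) auto
  also have "\<dots> = emeasure circle_measure (CI -` A)" by (simp add: circle_measure_rotate)
  finally have "emeasure circle_measure (CI -` (T -` A \<inter> S2xS1)) = emeasure circle_measure (CI -` A)" .
  then show "emeasure mu (T -` A \<inter> S2xS1) = emeasure mu A"
    using A T_vimage_measurable[OF A] by (simp add: emeasure_mu indicator_def T_PA PA_mem)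
qed

section \<open>Averages on the parabolic fibre\<close>

text \<open>In the coordinate \<open>1 / (t - 1)\<close> the parabolic map is the translation by \<open>\<i> / 2\<close>.\<close>

lemma parabolic_step:
  assumes "norm t = 1" "t \<noteq> 1"
  shows "mob lam (par 1) t \<noteq> 1" "1 / (mob lam (par 1) t - 1) = 1 / (t - 1) + \<i> / 2"
proof -
  define P where "P = mob lam (par 1) t"
  \<comment> \<open>The denominator of the map after multiplication by \<open>2 - i\<close>. On the
    unit circle \<open>t * cnj t = 1\<close> makes the numerator affine in \<open>t\<close> as
    well.\<close>
  define D where "D = 2 - \<i> + \<i> * t"
  have tt: "t * cnj t = 1" using assms(1) complex_norm_square[of t] by simp
  have d: "1 - cnj (par 1) * t \<noteq> 0" using mob_denom[OF norm_par] assms(1) by simp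
  have c: "(2 - \<i>) * cnj (par 1) = - \<i>" "(2 - \<i>) * lam = 2 + \<i>" "(2 + \<i>) * par 1 = \<i>"
    by (simp_all add: par_def lam_def complex_eq_iff)
  have "(2 - \<i>) * (1 - cnj (par 1) * t) = 2 - \<i> - (2 - \<i>) * cnj (par 1) * t" by (simp add: algebra_simps)
  then have D: "D = (2 - \<i>) * (1 - cnj (par 1) * t)" unfolding c by (simp add: D_def)
  have "2 - \<i> \<noteq> 0" by (simp add: complex_eq_iff)
  then have D0: "D \<noteq> 0" unfolding D using d by simp
  have "P * (1 - cnj (par 1) * t) = lam * (t - par 1)"
    using d by (simp add: P_def mob_def tt)
  then have "P * D = ((2 - \<i>) * lam) * (t - par 1)" unfolding D by (simp add: mult_ac)
  also have "\<dots> = (2 + \<i>) * t - (2 + \<i>) * par 1" unfolding c(2) by (simp add: algebra_simps)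
  finally have "P * D = (2 + \<i>) * t - \<i>" unfolding c(3) .
  then have P: "(P - 1) * D = 2 * (t - 1)" by (simp add: D_def algebra_simps)
  have t1: "t - 1 \<noteq> 0" using assms(2) by simp
  show "mob lam (par 1) t \<noteq> 1" using P t1 by (auto simp: P_def)
  then have P1: "P - 1 \<noteq> 0" by (simp add: P_def)
  have "1 / (P - 1) = D / ((P - 1) * D)" using D0 by simp
  also have "\<dots> = (2 + \<i> * (t - 1)) / (2 * (t - 1))" unfolding P by (simp add: D_def algebra_simps)
  also have "\<dots> = 1 / (t - 1) + \<i> / 2"
  proof -
    have "(2 + \<i> * s) / (2 * s) = 1 / s + \<i> / 2" if "s \<noteq> 0" for s :: complex using that by (simp add: field_simps)
    then show ?thesis using t1 by blast
  qed
  finally show "1 / (mob lam (par 1) t - 1) = 1 / (t - 1) + \<i> / 2" by (simp add: P_def)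
qed

abbreviation pmap :: "complex \<Rightarrow> complex" where "pmap \<equiv> mob lam (par 1)"

lemma norm_pmap_iterate: "norm t = 1 \<Longrightarrow> norm ((pmap ^^ n) t) = 1"
  using norm_par[of 1] by (induction n) (simp_all add: norm_mob)

lemma pmap_iterate:
  assumes "norm t = 1" "t \<noteq> 1"
  shows "(pmap ^^ n) t \<noteq> 1 \<and> 1 / ((pmap ^^ n) t - 1) = 1 / (t - 1) + of_nat n * (\<i> / 2)"
proof (induction n)
  case (Suc n)
  then show ?case
    using parabolic_step[OF norm_pmap_iterate[OF assms(1), of n]] by (simp add: algebra_simps)
qed (use assms in simp)

lemma pmap_1: "pmap 1 = 1"
  using T_PA T_pt_1[of 1] by (metis PA_def pt_sel(1))

text \<open>The points are 1/2 apart and the window has length \<open>2 * R\<close>. What matters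
  later is that the bound depends neither on \<open>y\<close> nor on \<open>n\<close>.\<close>

lemma card_translates:
  fixes y R :: real
  assumes "R \<ge> 0"
  shows "real (card {j. j < n \<and> \<bar>y + real j / 2\<bar> \<le> R}) \<le> 4 * R + 1"
proof (cases "{j. j < n \<and> \<bar>y + real j / 2\<bar> \<le> R} = {}")
  case True
  show ?thesis unfolding True using assms by simp
next
  case False
  let ?S = "{j. j < n \<and> \<bar>y + real j / 2\<bar> \<le> R}"
  define m where "m = Min ?S"
  have fin: "finite ?S" by simp
  have m: "m \<in> ?S" using Min_in[OF fin False] by (simp add: m_def)
  have "?S \<subseteq> {m..m + nat \<lfloor>4 * R\<rfloor>}"
  proof
    fix j assume j: "j \<in> ?S"
    then have "m \<le> j" unfolding m_def using fin by simp
    moreover have "real j - real m \<le> 4 * R" using j m by (auto simp: abs_le_iff)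
    ultimately have "int (j - m) \<le> \<lfloor>4 * R\<rfloor>" by (simp add: le_floor_iff of_nat_diff)
    then show "j \<in> {m..m + nat \<lfloor>4 * R\<rfloor>}" using \<open>m \<le> j\<close> by auto
  qed
  then have "card ?S \<le> card {m..m + nat \<lfloor>4 * R\<rfloor>}" by (rule card_mono[rotated]) simp
  also have "\<dots> = nat \<lfloor>4 * R\<rfloor> + 1" by simp
  finally have "real (card ?S) \<le> real (nat \<lfloor>4 * R\<rfloor>) + 1" by simp
  also have "real (nat \<lfloor>4 * R\<rfloor>) \<le> 4 * R" using assms by (simp add: of_nat_floor)
  finally show ?thesis by simp
qed

text \<open>The iterates do not converge uniformly: an orbit may start close to 1 and still run
  around the circle. But \<open>1 / (t - 1)\<close> moves along a vertical line in steps of 1/2, so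
  the orbit is at distance at least \<open>\<delta>\<close> from 1 at no more than
  \<open>4 / \<delta> + 1\<close> times, for every starting point.\<close>

lemma parabolic_uniform:
  fixes f :: "complex \<Rightarrow> real"
  assumes f: "continuous_on circle f"
  shows "uniform_limit circle (\<lambda>n t. (\<Sum>i<n. f ((pmap ^^ i) t)) / real n) (\<lambda>_. f 1) sequentially"
  unfolding uniform_limit_iff
proof (intro allI impI)
  fix \<epsilon> :: real assume \<epsilon>: "\<epsilon> > 0"
  have "bounded (f ` circle)" by (intro compact_imp_bounded compact_continuous_image f compact_sphere)
  then obtain M where M: "\<And>t. t \<in> circle \<Longrightarrow> \<bar>f t\<bar> \<le> M" unfolding bounded_iff real_norm_def by blast
  have M0: "M \<ge> 0" using M[of 1] by simp
  have "1 \<in> circle" by simp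
  with f \<epsilon> obtain \<delta> where \<delta>: "\<delta> > 0" "\<And>t. t \<in> circle \<Longrightarrow> dist t 1 < \<delta> \<Longrightarrow> dist (f t) (f 1) < \<epsilon> / 2"
    unfolding continuous_on_iff by (metis half_gt_zero)
  define C where "C = 2 * M * (4 * (1 / \<delta>) + 1)"
  have bound: "\<bar>(\<Sum>i<n. f ((pmap ^^ i) t)) - real n * f 1\<bar> \<le> C + real n * (\<epsilon> / 2)" if t: "norm t = 1" for n t
  proof (cases "t = 1")
    case True
    have "(pmap ^^ i) 1 = 1" for i by (induction i) (simp_all add: pmap_1)
    then show ?thesis using True \<delta>(1) \<epsilon> M0 by (simp add: C_def)
  next
    case False
    define y where "y = Im (1 / (t - 1))"
    let ?S = "{j. j < n \<and> \<bar>y + real j / 2\<bar> \<le> 1 / \<delta>}"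
    have tm: "\<bar>f ((pmap ^^ j) t) - f 1\<bar> \<le> (if j \<in> ?S then 2 * M else 0) + \<epsilon> / 2" if "j < n" for j
    proof (cases "j \<in> ?S")
      case True
      have "\<bar>f ((pmap ^^ j) t)\<bar> \<le> M" "\<bar>f 1\<bar> \<le> M" using M norm_pmap_iterate[OF t] by simp_all
      then show ?thesis using True \<epsilon> by simp
    next
      case False
      note it = pmap_iterate[OF t \<open>t \<noteq> 1\<close>, of j]
      have "1 / \<delta> < \<bar>y + real j / 2\<bar>" using False that by simp
      also have "y + real j / 2 = Im (1 / ((pmap ^^ j) t - 1))" unfolding conjunct2[OF it] by (simp add: y_def)
      also have "\<bar>\<dots>\<bar> \<le> norm (1 / ((pmap ^^ j) t - 1))" by (rule abs_Im_le_cmod)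
      finally have "1 / \<delta> < 1 / norm ((pmap ^^ j) t - 1)" by (simp add: norm_divide)
      then have "norm ((pmap ^^ j) t - 1) < \<delta>"
        using \<delta>(1) it by (simp add: divide_less_cancel field_simps)
      then have "dist (f ((pmap ^^ j) t)) (f 1) < \<epsilon> / 2"
        using norm_pmap_iterate[OF t] by (intro \<delta>(2)) (auto simp: dist_norm)
      then show ?thesis using M0 by (simp add: dist_real_def)
    qed
    have "\<bar>(\<Sum>i<n. f ((pmap ^^ i) t)) - real n * f 1\<bar> = \<bar>\<Sum>i<n. f ((pmap ^^ i) t) - f 1\<bar>"
      by (simp add: sum_subtractf)
    also have "\<dots> \<le> (\<Sum>i<n. \<bar>f ((pmap ^^ i) t) - f 1\<bar>)" by (rule sum_abs)
    also have "\<dots> \<le> (\<Sum>j<n. (if j \<in> ?S then 2 * M else 0) + \<epsilon> / 2)" by (intro sum_mono tm) simp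
    also have "\<dots> = (\<Sum>j<n. if j \<in> ?S then 2 * M else 0) + real n * (\<epsilon> / 2)" by (simp add: sum.distrib)
    also have "(\<Sum>j<n. if j \<in> ?S then 2 * M else 0) = real (card ?S) * (2 * M)"
    proof -
      have "{..<n} \<inter> {j. \<bar>y + real j / 2\<bar> \<le> 1 / \<delta>} = ?S" by auto
      then show ?thesis by (simp add: sum.If_cases)
    qed
    also have "\<dots> \<le> (4 * (1 / \<delta>) + 1) * (2 * M)"
      using M0 \<delta>(1) by (intro mult_right_mono card_translates) auto
    finally show ?thesis by (simp add: C_def mult_ac)
  qed
  have "(\<lambda>n. C / real n) \<longlonglongrightarrow> 0" by (rule lim_const_over_n)
  then have "\<forall>\<^sub>F n in sequentially. C / real n < \<epsilon> / 2" using \<epsilon> by (intro order_tendstoD) auto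
  then show "\<forall>\<^sub>F n in sequentially. \<forall>t\<in>circle. dist ((\<Sum>i<n. f ((pmap ^^ i) t)) / real n) (f 1) < \<epsilon>"
    using eventually_gt_at_top[of 0]
  proof eventually_elim
    case (elim n)
    show ?case
    proof
      fix t assume "t \<in> circle"
      then have "\<bar>(\<Sum>i<n. f ((pmap ^^ i) t)) - real n * f 1\<bar> / real n \<le> (C + real n * (\<epsilon> / 2)) / real n"
        by (intro divide_right_mono bound) auto
      also have "\<dots> = C / real n + \<epsilon> / 2" using elim by (simp add: add_divide_distrib)
      also have "\<dots> < \<epsilon>" using elim(1) by linarith
      also have "\<bar>(\<Sum>i<n. f ((pmap ^^ i) t)) - real n * f 1\<bar> / real n = \<bar>(\<Sum>i<n. f ((pmap ^^ i) t)) / real n - f 1\<bar>"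
      proof -
        have "(\<Sum>i<n. f ((pmap ^^ i) t)) / real n - f 1 = ((\<Sum>i<n. f ((pmap ^^ i) t)) - real n * f 1) / real n"
          using elim by (simp add: diff_divide_distrib)
        then show ?thesis by simp
      qed
      finally show "dist ((\<Sum>i<n. f ((pmap ^^ i) t)) / real n) (f 1) < \<epsilon>" by (simp add: dist_real_def)
    qed
  qed
qed

lemma sum_shift_bound:
  fixes g :: "nat \<Rightarrow> real"
  assumes "\<And>i. \<bar>g i\<bar> \<le> M"
  shows "\<bar>(\<Sum>i<n. g (i + j)) - (\<Sum>i<n. g i)\<bar> \<le> 2 * real j * M"
proof (induction j)
  case (Suc j)
  have "(\<Sum>i<n. g (i + Suc j)) - (\<Sum>i<n. g (i + j)) = g (n + j) - g j"
    using sum_lessThan_telescope[of "\<lambda>i. g (i + j)" n] by (simp add: sum_subtractf)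
  moreover have "\<bar>g (n + j)\<bar> \<le> M" "\<bar>g j\<bar> \<le> M" using assms by blast+
  ultimately show ?case using Suc by (simp add: algebra_simps)
qed simp

text \<open>
  The time average \<open>F\<close> over a window of length \<open>L\<close> is close to a constant on each of the two limit fibres;
  an orbit spends asymptotically half of its time near each of them.
\<close>

lemma birkhoff_limit:
  fixes f :: "pt3 \<Rightarrow> real"
  assumes x: "x \<in> S2xS1" "0 < \<bar>ht x\<bar>" "\<bar>ht x\<bar> < 1" and f: "continuous_on S2xS1 f"
  shows "(\<lambda>n. (1 / real n) * (\<Sum>i<n. f ((T ^^ i) x))) \<longlonglongrightarrow> (f PA + circle_mean (\<lambda>u. f (CI u))) / 2"
proof (rule tendstoI)
  fix r :: real assume r: "r > 0"
  define \<epsilon> where "\<epsilon> = r / 6"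
  have \<epsilon>: "\<epsilon> > 0" using r by (simp add: \<epsilon>_def)
  define c1 where "c1 = f PA"
  define c2 where "c2 = circle_mean (\<lambda>u. f (CI u))"
  have bnd: "\<exists>B\<ge>0. \<forall>x\<in>S2xS1. \<bar>g x\<bar> \<le> B" if "continuous_on S2xS1 g" for g :: "pt3 \<Rightarrow> real"
  proof -
    have "bounded (g ` S2xS1)"
      by (intro compact_imp_bounded compact_continuous_image that compact_S2xS1)
    then obtain B where "\<And>x. x \<in> S2xS1 \<Longrightarrow> \<bar>g x\<bar> \<le> B" unfolding bounded_iff real_norm_def by blast
    then show ?thesis by (intro exI[of _ "max B 0"]) (simp add: le_max_iff_disj)
  qed
  obtain M where M: "M \<ge> 0" "\<And>x. x \<in> S2xS1 \<Longrightarrow> \<bar>f x\<bar> \<le> M" using bnd[OF f] by blast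
  have c: "continuous_on circle (\<lambda>u. f (CI u))"
    by (rule continuous_on_compose2[OF f continuous_CI]) (auto simp: CI_mem)
  have c': "continuous_on circle (\<lambda>t. f (pt t 0 1))"
    by (rule continuous_on_compose2[OF f]) (auto simp: mem_S2xS1 intro!: continuous_intros)
  have av1: "\<forall>\<^sub>F n in sequentially. \<forall>u\<in>circle. dist ((\<Sum>i<n. f (CI (lam ^ i * u))) / real n) c2 < \<epsilon>"
    using uniform_limitD[OF rotation_equidistribution[OF c] \<epsilon>] by (simp add: c2_def)
  have av2: "\<forall>\<^sub>F n in sequentially. \<forall>t\<in>circle. dist ((\<Sum>i<n. f (pt ((pmap ^^ i) t) 0 1)) / real n) c1 < \<epsilon>"
    using uniform_limitD[OF parabolic_uniform[OF c'] \<epsilon>] by (simp add: c1_def PA_def)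
  \<comment> \<open>One window length for all starting points on both limit circles.\<close>
  obtain L where L: "L > 0"
    "\<And>u. norm u = 1 \<Longrightarrow> \<bar>(\<Sum>i<L. f (CI (lam ^ i * u))) / real L - c2\<bar> < \<epsilon>"
    "\<And>t. norm t = 1 \<Longrightarrow> \<bar>(\<Sum>i<L. f (pt ((pmap ^^ i) t) 0 1)) / real L - c1\<bar> < \<epsilon>"
    using eventually_happens'[OF sequentially_bot eventually_conj[OF eventually_gt_at_top[of "0::nat"] eventually_conj[OF av1 av2]]]
    by (auto simp: dist_real_def)
  define F where "F y = (\<Sum>i<L. f ((T ^^ i) y)) / real L" for y
  \<comment> \<open>Interpolates in \<open>Re w\<close> between the two fibre averages, so its time
    average depends on the mean of \<open>Re w\<close> alone, which tends to 0.\<close>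
  define I where "I w = (1 + Re w) / 2 * c1 + (1 - Re w) / 2 * c2" for w
  define E where "E y = F y - I (snd y)" for y
  define g where "g y = (ht y)\<^sup>2 + (Im (snd y))\<^sup>2" for y
  have cF: "continuous_on S2xS1 F"
    unfolding F_def
    by (intro continuous_intros continuous_on_compose2[OF f continuous_on_T_iterate]) (use L(1) T_iterate_mem in auto)
  have cE: "continuous_on S2xS1 E"
    unfolding E_def I_def by (intro continuous_intros cF) simp_all
  have cg: "continuous_on S2xS1 g" unfolding g_def by (intro continuous_intros)
  obtain N where N: "N \<ge> 0" "\<And>x. x \<in> S2xS1 \<Longrightarrow> \<bar>E x\<bar> \<le> N" using bnd[OF cE] by blast
  have fibres: "\<bar>E y\<bar> < \<epsilon>" if y: "y \<in> S2xS1" "g y = 0" for y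
  proof -
    have h: "ht y = 0" "Im (snd y) = 0" using y(2) by (simp_all add: g_def add_nonneg_eq_0_iff)
    have l: "norm (lon y) = 1" and w: "norm (snd y) = 1"
      using y(1) h by (simp_all add: mem_S2xS1 abs_square_eq_1)
    have yy: "y = pt (lon y) 0 (snd y)" using pt_collapse[of y] h by simp
    have "\<bar>Re (snd y)\<bar> = 1" using w h by (simp add: cmod_def)
    then consider "snd y = 1" | "snd y = -1" using h by (auto simp: complex_eq_iff abs_if split: if_splits)
    then show ?thesis
    proof cases
      case 1
      then have "F y = (\<Sum>i<L. f (pt ((pmap ^^ i) (lon y)) 0 1)) / real L"
        using yy by (metis (no_types, lifting) F_def T_iterate_pt_1 sum.cong)
      then show ?thesis using L(3)[OF l] 1 by (simp add: E_def I_def)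
    next
      case 2
      then have "y = CI (lon y)" using yy by (simp add: CI_def)
      then have "F y = (\<Sum>i<L. f (CI (lam ^ i * lon y))) / real L"
        by (metis (no_types, lifting) F_def T_iterate_CI sum.cong)
      then show ?thesis using L(2)[OF l] 2 by (simp add: E_def I_def)
    qed
  qed
  \<comment> \<open>On the manifold \<open>g\<close> vanishes exactly on the two limit fibres, where
    the error is below \<open>\<epsilon>\<close>. The points with a larger error form a compact set,
    on which \<open>g\<close> has a positive minimum; so the excess is linear in \<open>g\<close>,
    whose time average tends to 0.\<close>
  have "\<exists>K\<ge>0. \<forall>y\<in>S2xS1. \<bar>E y\<bar> \<le> \<epsilon> + K * g y"
  proof -
    let ?S = "{y\<in>S2xS1. \<epsilon> \<le> \<bar>E y\<bar>}"
    have "compact ?S"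
    proof -
      have "closed ?S"
        by (intro continuous_on_closed_Collect_le continuous_intros cE compact_imp_closed compact_S2xS1)
      then have "compact (S2xS1 \<inter> ?S)" by (rule compact_Int_closed[OF compact_S2xS1])
      moreover have "S2xS1 \<inter> ?S = ?S" by blast
      ultimately show ?thesis by simp
    qed
    show ?thesis
    proof (cases "?S = {}")
      case True
      then show ?thesis by (intro exI[of _ 0]) (auto simp: not_le less_imp_le)
    next
      case False
      have "continuous_on ?S g" by (rule continuous_on_subset[OF cg]) auto
      from continuous_attains_inf[OF \<open>compact ?S\<close> False this]
      obtain y0 where y0: "y0 \<in> ?S" "\<And>y. y \<in> ?S \<Longrightarrow> g y0 \<le> g y" by blast
      have "g y0 \<noteq> 0" using fibres[of y0] y0(1) by auto
      moreover have "g y0 \<ge> 0" by (simp add: g_def)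
      ultimately have pos: "g y0 > 0" by simp
      have "\<bar>E y\<bar> \<le> \<epsilon> + N / g y0 * g y" if y: "y \<in> S2xS1" for y
      proof (cases "y \<in> ?S")
        case True
        have "N * g y0 \<le> N * g y" using y0(2)[OF True] N(1) by (rule mult_left_mono)
        then have "N \<le> N / g y0 * g y" using pos by (simp add: pos_le_divide_eq)
        then show ?thesis using N(2)[OF y] \<epsilon> by linarith
      next
        case False
        then have "\<bar>E y\<bar> < \<epsilon>" using y by auto
        moreover have "0 \<le> N / g y0 * g y" using N(1) pos by (simp add: g_def)
        ultimately show ?thesis by linarith
      qed
      then show ?thesis using N(1) pos by (intro exI[of _ "N / g y0"]) auto
    qed
  qed
  then obtain K where K: "K \<ge> 0" "\<And>y. y \<in> S2xS1 \<Longrightarrow> \<bar>E y\<bar> \<le> \<epsilon> + K * g y" by blast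
  define X where "X i = (T ^^ i) x" for i
  have X: "X i \<in> S2xS1" for i using T_iterate_mem[OF x(1)] by (simp add: X_def)
  define R where "R n = (\<Sum>i<n. Re (snd (X i))) / real n" for n
  define G where "G n = (\<Sum>i<n. g (X i)) / real n" for n
  have R0: "R \<longlonglongrightarrow> 0" using base_averages(2)[OF x] by (simp add: R_def[abs_def] X_def)
  have G0: "G \<longlonglongrightarrow> 0"
  proof -
    have "(\<lambda>n. (ht (X n))\<^sup>2) \<longlonglongrightarrow> 0\<^sup>2"
      unfolding X_def by (intro tendsto_power height_tendsto_0 x)
    then have "(\<lambda>n. (ht (X n))\<^sup>2) \<longlonglongrightarrow> 0" by simp
    from tendsto_add[OF cesaro_null[OF this] base_averages(1)[OF x, folded X_def]]
    have "(\<lambda>n. (\<Sum>i<n. (ht (X i))\<^sup>2) / real n + (\<Sum>i<n. (Im (snd (X i)))\<^sup>2) / real n) \<longlonglongrightarrow> 0 + 0" .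
    then show ?thesis by (simp add: G_def[abs_def] g_def sum.distrib add_divide_distrib)
  qed
  \<comment> \<open>Replacing \<open>f\<close> by its window averages changes the sum only at the
    two ends of the orbit segment, at a cost independent of \<open>n\<close>.\<close>
  have shift: "\<bar>(\<Sum>i<n. f (X i)) - (\<Sum>i<n. F (X i))\<bar> \<le> 2 * real L * M" for n
  proof -
    have "(\<Sum>i<n. F (X i)) = (\<Sum>j<L. \<Sum>i<n. f (X (i + j))) / real L"
      unfolding F_def X_def sum_divide_distrib[symmetric]
      by (subst sum.swap) (simp add: funpow_add add.commute)
    then have "real L * ((\<Sum>i<n. f (X i)) - (\<Sum>i<n. F (X i))) = (\<Sum>j<L. (\<Sum>i<n. f (X i)) - (\<Sum>i<n. f (X (i + j))))"
      using L(1) by (simp add: sum_subtractf right_diff_distrib)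
    also have "\<bar>\<dots>\<bar> \<le> (\<Sum>j<L. \<bar>(\<Sum>i<n. f (X i)) - (\<Sum>i<n. f (X (i + j)))\<bar>)" by (rule sum_abs)
    also have "\<dots> \<le> (\<Sum>j<L. 2 * real L * M)"
    proof (rule sum_mono)
      fix j assume "j \<in> {..<L}"
      have "\<bar>(\<Sum>i<n. f (X i)) - (\<Sum>i<n. f (X (i + j)))\<bar> \<le> 2 * real j * M"
        using sum_shift_bound[of "\<lambda>i. f (X i)" M j n] M(2) X by (simp add: abs_minus_commute)
      also have "\<dots> \<le> 2 * real L * M" using \<open>j \<in> {..<L}\<close> M(1) by (intro mult_right_mono) auto
      finally show "\<bar>(\<Sum>i<n. f (X i)) - (\<Sum>i<n. f (X (i + j)))\<bar> \<le> 2 * real L * M" .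
    qed
    finally have "real L * \<bar>(\<Sum>i<n. f (X i)) - (\<Sum>i<n. F (X i))\<bar> \<le> real L * (2 * real L * M)"
      by (simp add: abs_mult)
    then show ?thesis using L(1) by simp
  qed
  have key: "\<bar>(\<Sum>i<n. f (X i)) / real n - (c1 + c2) / 2\<bar>
      \<le> 2 * real L * M / real n + (\<epsilon> + K * G n) + \<bar>R n\<bar> * \<bar>c1 - c2\<bar> / 2" if n: "n > 0" for n
  proof -
    have "\<bar>(\<Sum>i<n. f (X i)) - (\<Sum>i<n. F (X i))\<bar> / real n \<le> 2 * real L * M / real n"
      by (intro divide_right_mono shift) simp
    then have 1: "\<bar>(\<Sum>i<n. f (X i)) / real n - (\<Sum>i<n. F (X i)) / real n\<bar> \<le> 2 * real L * M / real n"
      by (simp flip: diff_divide_distrib)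
    have "\<bar>(\<Sum>i<n. F (X i)) - (\<Sum>i<n. I (snd (X i)))\<bar> \<le> (\<Sum>i<n. \<bar>E (X i)\<bar>)"
      unfolding E_def sum_subtractf[symmetric] by (rule sum_abs)
    also have "\<dots> \<le> (\<Sum>i<n. \<epsilon> + K * g (X i))" by (intro sum_mono K X)
    also have "\<dots> = real n * \<epsilon> + K * (\<Sum>i<n. g (X i))" by (simp add: sum.distrib sum_distrib_left)
    finally have "\<bar>(\<Sum>i<n. F (X i)) - (\<Sum>i<n. I (snd (X i)))\<bar> / real n \<le> (real n * \<epsilon> + K * (\<Sum>i<n. g (X i))) / real n"
      by (rule divide_right_mono) simp
    then have 2: "\<bar>(\<Sum>i<n. F (X i)) / real n - (\<Sum>i<n. I (snd (X i))) / real n\<bar> \<le> \<epsilon> + K * G n"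
      using n by (simp add: G_def add_divide_distrib flip: diff_divide_distrib)
    have "(\<Sum>i<n. I (snd (X i))) = (\<Sum>i<n. (c1 + c2) / 2 + Re (snd (X i)) * ((c1 - c2) / 2))"
      by (intro sum.cong) (simp_all add: I_def field_simps)
    also have "\<dots> = real n * ((c1 + c2) / 2) + (\<Sum>i<n. Re (snd (X i))) * ((c1 - c2) / 2)"
      by (simp add: sum.distrib sum_distrib_right)
    finally have "(\<Sum>i<n. I (snd (X i))) / real n = (c1 + c2) / 2 + R n * ((c1 - c2) / 2)"
      using n by (simp add: R_def add_divide_distrib)
    then have 3: "\<bar>(\<Sum>i<n. I (snd (X i))) / real n - (c1 + c2) / 2\<bar> = \<bar>R n\<bar> * \<bar>c1 - c2\<bar> / 2"
      by (simp add: abs_mult)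
    show ?thesis using 1 2 3 by linarith
  qed
  have "(\<lambda>n. 2 * real L * M / real n + (\<epsilon> + K * G n) + \<bar>R n\<bar> * \<bar>c1 - c2\<bar> / 2) \<longlonglongrightarrow> 0 + (\<epsilon> + K * 0) + \<bar>0\<bar> * \<bar>c1 - c2\<bar> / 2"
    by (intro tendsto_add tendsto_mult tendsto_divide tendsto_const tendsto_rabs lim_const_over_n G0 R0) simp
  then have "\<forall>\<^sub>F n in sequentially. 2 * real L * M / real n + (\<epsilon> + K * G n) + \<bar>R n\<bar> * \<bar>c1 - c2\<bar> / 2 < r"
    by (rule order_tendstoD) (use r in \<open>simp add: \<epsilon>_def\<close>)
  then show "\<forall>\<^sub>F n in sequentially. dist ((1 / real n) * (\<Sum>i<n. f ((T ^^ i) x))) ((f PA + circle_mean (\<lambda>u. f (CI u))) / 2) < r"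
    using eventually_gt_at_top[of 0]
  proof eventually_elim
    case (elim n)
    then show ?case using key[of n] by (simp add: dist_real_def X_def c1_def c2_def)
  qed
qed

text \<open>The whole torus at height 0, which is larger than the support of \<open>mu\<close>. Its
  basin is everything except the two polar circles.\<close>

definition attr :: "pt3 set" where "attr = {x\<in>S2xS1. ht x = 0}"

lemma norm_pt: "(norm (pt \<zeta> z w))\<^sup>2 = (norm \<zeta>)\<^sup>2 + z\<^sup>2 + (norm w)\<^sup>2"
  by (simp add: pt_def norm_Pair norm_vec_def L2_set_def sum_3 cmod_def)

lemma diff_pt: "pt \<zeta> z w - pt \<zeta>' z' w' = pt (\<zeta> - \<zeta>') (z - z') (w - w')"
  by (simp add: pt_eq algebra_simps)

lemma ht_lipschitz: "\<bar>ht x - ht y\<bar> \<le> dist x y"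
proof -
  have "ht x - ht y = fst (x - y) $ 3" by (simp add: ht_def)
  then have "\<bar>ht x - ht y\<bar> \<le> norm (fst (x - y))" using component_le_norm_cart[of "fst (x - y)" 3] by simp
  also have "\<dots> \<le> norm (x - y)" by (metis norm_fst_le prod.collapse)
  finally show ?thesis by (simp add: dist_norm)
qed

text \<open>The comparison point lies on the equator, on the same meridian;
  \<open>1 - norm (lon x)\<close> is at most \<open>(ht x)^2\<close>.\<close>

lemma infdist_attr_le:
  assumes x: "x \<in> S2xS1" "\<bar>ht x\<bar> < 1" shows "infdist x attr \<le> 2 * \<bar>ht x\<bar>"
proof -
  have sq: "(norm (lon x))\<^sup>2 + (ht x)\<^sup>2 = 1" using x(1) by (simp add: mem_S2xS1)
  have "(ht x)\<^sup>2 < 1" using x(2) by (simp add: abs_square_less_1)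
  then have nz: "lon x \<noteq> 0" using sq by auto
  define y where "y = pt (sgn (lon x)) 0 (snd x)"
  have "y \<in> attr" using x(1) nz by (simp add: attr_def y_def mem_S2xS1 norm_sgn)
  have n1: "norm (lon x) \<le> 1" using S2xS1_ht_le_1 x(1) by blast
  have "norm (lon x - sgn (lon x)) = 1 - norm (lon x)"
  proof -
    have "lon x - sgn (lon x) = (norm (lon x) - 1) *\<^sub>R sgn (lon x)"
      using nz by (simp add: sgn_div_norm scaleR_diff_left left_diff_distrib)
    then show ?thesis using nz n1 by (simp add: norm_sgn)
  qed
  also have "\<dots> \<le> (ht x)\<^sup>2"
    using sq n1 mult_left_le[of "norm (lon x)" "norm (lon x)"] by (simp add: power2_eq_square)
  also have "\<dots> \<le> \<bar>ht x\<bar>" using x(2) mult_left_le[of "\<bar>ht x\<bar>" "\<bar>ht x\<bar>"] by (simp add: power2_eq_square flip: abs_mult)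
  finally have a: "norm (lon x - sgn (lon x)) \<le> \<bar>ht x\<bar>" .
  have "x - y = pt (lon x - sgn (lon x)) (ht x) 0"
    using diff_pt[of "lon x" "ht x" "snd x" "sgn (lon x)" 0 "snd x"] by (simp add: y_def)
  then have "(dist x y)\<^sup>2 = (norm (lon x - sgn (lon x)))\<^sup>2 + (ht x)\<^sup>2" by (simp add: dist_norm norm_pt)
  also have "\<dots> \<le> \<bar>ht x\<bar>\<^sup>2 + (ht x)\<^sup>2" using a by (intro add_right_mono power_mono) auto
  also have "\<dots> \<le> (2 * \<bar>ht x\<bar>)\<^sup>2" by (simp add: power_mult_distrib)
  finally have "dist x y \<le> 2 * \<bar>ht x\<bar>" by (rule power2_le_imp_le) simp
  with infdist_le[OF \<open>y \<in> attr\<close>, of x] show ?thesis by linarith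
qed

lemma basin_attr: "basin S2xS1 T attr = {x\<in>S2xS1. \<bar>ht x\<bar> < 1}"
proof (intro set_eqI iffI)
  fix x assume "x \<in> {x\<in>S2xS1. \<bar>ht x\<bar> < 1}"
  then have x: "x \<in> S2xS1" "\<bar>ht x\<bar> < 1" by auto
  have h: "\<bar>ht ((T ^^ n) x)\<bar> < 1" for n
  proof (induction n)
    case (Suc n)
    have "rad (ht ((T ^^ n) x)) \<ge> 1" using Suc rad_ge_1 by simp
    then have "\<bar>ht ((T ^^ n) x)\<bar> / rad (ht ((T ^^ n) x)) \<le> \<bar>ht ((T ^^ n) x)\<bar>"
      by (simp add: pos_divide_le_eq mult_le_cancel_left1)
    then show ?case using Suc \<open>rad (ht ((T ^^ n) x)) \<ge> 1\<close> by (simp add: ht_T)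
  qed (use x in simp)
  have "(\<lambda>n. infdist ((T ^^ n) x) attr) \<longlonglongrightarrow> 0"
  proof (rule Lim_null_comparison)
    show "\<forall>\<^sub>F n in sequentially. norm (infdist ((T ^^ n) x) attr) \<le> 2 * \<bar>ht ((T ^^ n) x)\<bar>"
      using infdist_attr_le[OF T_iterate_mem[OF x(1)] h] by (simp add: infdist_nonneg)
    have "(\<lambda>n. 2 * \<bar>ht ((T ^^ n) x)\<bar>) \<longlonglongrightarrow> 2 * 0"
      by (intro tendsto_mult tendsto_const tendsto_rabs_zero height_tendsto_0 x)
    then show "(\<lambda>n. 2 * \<bar>ht ((T ^^ n) x)\<bar>) \<longlonglongrightarrow> 0" by simp
  qed
  then show "x \<in> basin S2xS1 T attr" using x(1) by (simp add: basin_def)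
next
  fix x assume "x \<in> basin S2xS1 T attr"
  then have x: "x \<in> S2xS1" and lim: "(\<lambda>n. infdist ((T ^^ n) x) attr) \<longlonglongrightarrow> 0" by (auto simp: basin_def)
  \<comment> \<open>The poles keep height 1 or -1, as \<open>rad\<close> is 1 there, and so stay at
    distance at least 1 from \<open>attr\<close>.\<close>
  have "\<bar>ht x\<bar> \<noteq> 1"
  proof
    assume 1: "\<bar>ht x\<bar> = 1"
    have h: "\<bar>ht ((T ^^ n) x)\<bar> = 1" for n
    proof (induction n)
      case (Suc n)
      then have "(ht ((T ^^ n) x))\<^sup>2 = 1" by (simp add: abs_square_eq_1)
      moreover from this have "(ht ((T ^^ n) x))^4 = 1" using power_mult[of "ht ((T ^^ n) x)" 2 2] by simp
      ultimately have "rad (ht ((T ^^ n) x)) = 1" by (simp add: rad_def)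
      then show ?case using Suc by (simp add: ht_T)
    qed (use 1 in simp)
    have "PA \<in> attr" using PA_mem by (simp add: attr_def) (simp add: PA_def)
    then have ne: "attr \<noteq> {}" by blast
    have "1 \<le> infdist ((T ^^ n) x) attr" for n
      unfolding infdist_notempty[OF ne]
    proof (rule cINF_greatest[OF ne])
      fix y assume "y \<in> attr"
      then show "1 \<le> dist ((T ^^ n) x) y" using ht_lipschitz[of "(T ^^ n) x" y] h[of n] by (simp add: attr_def)
    qed
    then have "1 \<le> (0::real)" by (intro LIMSEQ_le_const[OF lim]) auto
    then show False by simp
  qed
  then show "x \<in> {x\<in>S2xS1. \<bar>ht x\<bar> < 1}" using x S2xS1_ht_le_1(1)[OF x] by auto
qed

lemma attractor_attr: "attractor S2xS1 T attr"
  unfolding attractor_def basin_attr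
proof (intro conjI)
  have "closed {x. ht x = 0}" by (intro closed_Collect_eq continuous_intros)
  then have "compact (S2xS1 \<inter> {x. ht x = 0})" by (intro compact_Int_closed compact_S2xS1)
  then show "compact attr" by (simp add: attr_def Collect_conj_eq)
  show "T ` attr \<subseteq> attr" using T_mem by (auto simp: attr_def ht_T)
  have "open {x::pt3. \<bar>ht x\<bar> < 1}" by (intro open_Collect_less continuous_intros)
  then have "openin (top_of_set S2xS1) (S2xS1 \<inter> {x. \<bar>ht x\<bar> < 1})" by blast
  then show "openin (top_of_set S2xS1) {x\<in>S2xS1. \<bar>ht x\<bar> < 1}" by (simp add: Collect_conj_eq)
qed (auto simp: attr_def)

text \<open>Points of height 0 lie in the basin, but their phase does not rotate and
  \<open>birkhoff_limit\<close> does not cover them. They have polar angle \<open>pi / 2\<close>,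
  which is a null set.\<close>

lemma AE_volume_ht: "AE x in S2xS1_volume. ht x \<noteq> 0"
proof -
  have "AE p in restrict_space lborel ({0..pi} \<times> {0..2*pi}). fst p \<noteq> (pi/2::real)"
  proof -
    have "{pi/2} \<times> UNIV \<in> null_sets (lborel :: (real \<times> real) measure)"
      unfolding lborel_prod[symmetric] null_sets_def
      by (auto simp: lborel.emeasure_pair_measure_Times)
    then have "AE p in (lborel :: (real \<times> real) measure). fst p \<noteq> pi/2"
      by (rule AE_I') auto
    moreover have "{0..pi} \<times> {0..2*pi} \<inter> space lborel \<in> sets lborel"
      by (simp add: borel_closed closed_Times)
    ultimately show ?thesis by (subst AE_restrict_space_iff) (auto elim!: eventually_mono)
  qed
  then have "AE p in restrict_space lborel ({0..pi} \<times> {0..2*pi}). cos (fst p) \<noteq> 0"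
  proof (rule AE_mp, intro AE_I2 impI)
    fix p :: "real \<times> real"
    assume p: "p \<in> space (restrict_space lborel ({0..pi} \<times> {0..2*pi}))" "fst p \<noteq> pi / 2"
    then have "0 \<le> fst p" "fst p \<le> pi" by (auto simp: space_restrict_space)
    then show "cos (fst p) \<noteq> 0" using p(2) cos_inj_pi[of "fst p" "pi/2"] by auto
  qed
  moreover have "(\<lambda>(\<theta>, \<phi>). ennreal (sin \<theta>)) \<in> borel_measurable (borel :: (real \<times> real) measure)"
    unfolding case_prod_beta
    by (intro measurable_compose[OF _ measurable_ennreal] borel_measurable_continuous_onI continuous_intros)
  ultimately have "AE p in density (restrict_space lborel ({0..pi} \<times> {0..2*pi})) (\<lambda>(\<theta>, \<phi>). ennreal (sin \<theta>)).
      sphere_coords p $ 3 \<noteq> 0"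
    by (subst AE_density) (auto simp: sphere_coords_def case_prod_beta vector_3 elim!: eventually_mono
        intro!: measurable_restrict_space1)
  then have "AE v in S2_area. v $ 3 \<noteq> 0"
    unfolding S2_area_def
    by (subst AE_distr_iff) (auto intro!: measurable_restrict_space1)
  then have null: "emeasure S2_area {v. v $ 3 = 0} = 0"
    by (subst (asm) AE_iff_measurable[OF _ refl]) (auto simp: S2_area_def)
  interpret S1: finite_measure S1_length
    unfolding S1_length_def
    by (intro finite_measure.finite_measure_distr finite_measureI measurable_restrict_space1)
       (auto simp: emeasure_restrict_space space_restrict_space)
  have "emeasure S2xS1_volume ({v. v $ 3 = 0} \<times> UNIV) = 0"
    unfolding S2xS1_volume_def
    by (subst S1.emeasure_pair_measure_Times) (use null in \<open>auto simp: S2_area_def S1_length_def\<close>)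
  moreover have "{v :: real^3. v $ 3 = 0} \<times> (UNIV :: complex set) \<in> sets borel" by (auto intro!: borel_closed closed_Times closed_Collect_eq continuous_intros)
  ultimately have "{v. v $ 3 = 0} \<times> UNIV \<in> null_sets S2xS1_volume" by auto
  then show ?thesis by (rule AE_I') (auto simp: ht_def)
qed

lemma natural_measure_mu: "natural_measure S2xS1_volume S2xS1 T mu"
  unfolding natural_measure_def natural_measure_on_def
proof (intro exI conjI)
  show "attractor S2xS1 T attr" by (rule attractor_attr)
  have cl: "attr \<in> sets borel" using attractor_attr by (auto simp: attractor_def intro: borel_compact)
  have "CI -` attr = circle" by (auto simp: attr_def CI_mem) (simp_all add: CI_def)
  moreover have "PA \<in> attr" using PA_mem by (simp add: attr_def) (simp add: PA_def)
  ultimately show "emeasure mu attr = 1" by (simp add: emeasure_mu[OF cl] emeasure_circle)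
  show "invariant_measure S2xS1 T mu" by (rule mu_invariant)
  show "AE x in S2xS1_volume. x \<in> basin S2xS1 T attr \<longrightarrow>
      (\<forall>f. continuous_on S2xS1 f \<longrightarrow>
        (\<lambda>n. (1 / real n) * (\<Sum>i<n. f ((T ^^ i) x))) \<longlonglongrightarrow> (LINT z:S2xS1|mu. f z))"
    using AE_volume_ht
  proof eventually_elim
    case (elim x)
    show ?case
    proof (intro impI allI)
      fix f :: "pt3 \<Rightarrow> real" assume "x \<in> basin S2xS1 T attr" "continuous_on S2xS1 f"
      then show "(\<lambda>n. (1 / real n) * (\<Sum>i<n. f ((T ^^ i) x))) \<longlonglongrightarrow> (LINT z:S2xS1|mu. f z)"
        using birkhoff_limit[of x f] elim by (simp add: basin_attr set_integral_mu)
    qed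
  qed
qed (auto simp: prob_space_mu)

section \<open>Information dimension\<close>

lemma dist_CI: "dist (CI u) (CI v) = dist u v"
proof -
  have "CI u - CI v = pt (u - v) 0 0" using diff_pt[of u 0 "-1" v 0 "-1"] by (simp add: CI_def)
  then have "(dist (CI u) (CI v))\<^sup>2 = (dist u v)\<^sup>2" by (simp add: dist_norm norm_pt)
  then show ?thesis by simp
qed

text \<open>The \<open>w\<close>-coordinates are antipodal. Therefore a ball of radius below 1 about
  a point of the support sees only one of the two parts of \<open>mu\<close>.\<close>

lemma dist_CI_PA: "dist (CI u) PA \<ge> 2"
proof -
  have "CI u - PA = pt (u - 1) 0 (-2)" using diff_pt[of u 0 "-1" 1 0 1] by (simp add: CI_def PA_def)
  then have "(dist (CI u) PA)\<^sup>2 = (norm (u - 1))\<^sup>2 + 2\<^sup>2" by (simp add: dist_norm norm_pt)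
  then have "2\<^sup>2 \<le> (dist (CI u) PA)\<^sup>2" by simp
  then show ?thesis by (rule power2_le_imp_le) simp
qed

lemma measure_circle_ball_rotate:
  assumes "norm u = 1" shows "measure circle_measure (ball u \<epsilon>) = measure circle_measure (ball 1 \<epsilon>)"
proof -
  have "measure circle_measure (ball u \<epsilon>) = measure (distr circle_measure borel (\<lambda>z. u * z)) (ball u \<epsilon>)"
    by (simp add: circle_measure_rotate assms)
  also have "\<dots> = measure circle_measure ((\<lambda>z. u * z) -` ball u \<epsilon>)"
    by (subst measure_distr) auto
  also have "(\<lambda>z. u * z) -` ball u \<epsilon> = ball 1 \<epsilon>"
  proof -
    have "dist u (u * z) = dist 1 z" for z
    proof -
      have "u - u * z = u * (1 - z)" by (simp add: algebra_simps)
      then show ?thesis using assms by (simp add: dist_norm norm_mult)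
    qed
    then show ?thesis by auto
  qed
  finally show ?thesis .
qed

lemma measure_circle_measure:
  assumes "A \<in> sets borel"
  shows "measure circle_measure A = measure lborel ({0..<2*pi} \<inter> cis -` A) / (2*pi)"
proof -
  have "emeasure lborel ({0..<2*pi} \<inter> cis -` A) \<le> emeasure lborel {0..<2*pi}"
    by (rule emeasure_mono) auto
  also have "\<dots> < \<infinity>" by simp
  finally have "emeasure lborel ({0..<2*pi} \<inter> cis -` A) = ennreal (measure lborel ({0..<2*pi} \<inter> cis -` A))"
    by (intro emeasure_eq_ennreal_measure) auto
  then show ?thesis
    unfolding measure_def[of circle_measure] emeasure_circle_measure[OF assms]
    by (simp only:) (simp add: divide_ennreal)
qed

lemma norm_cis_diff_1: "norm (cis t - 1) = 2 * \<bar>sin (t / 2)\<bar>"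
  using dist_exp_i_1[of t] by (simp add: cis_conv_exp)

text \<open>After rotation to 1, the arc on one side, with parameters
  \<open>{0..<\<epsilon>}\<close>, already has this measure.\<close>

lemma measure_circle_ball_ge:
  assumes "norm u = 1" "0 < \<epsilon>" "\<epsilon> \<le> 1"
  shows "\<epsilon> / (2 * pi) \<le> measure circle_measure (ball u \<epsilon>)"
proof -
  have "{0..<\<epsilon>} \<subseteq> {0..<2*pi} \<inter> cis -` ball 1 \<epsilon>"
  proof
    fix t assume t: "t \<in> {0..<\<epsilon>}"
    have "norm (cis t - 1) \<le> t"
      using abs_sin_x_le_abs_x[of "t / 2"] t by (simp add: norm_cis_diff_1)
    then have "dist 1 (cis t) < \<epsilon>" using t by (simp add: dist_norm norm_minus_commute)
    then show "t \<in> {0..<2*pi} \<inter> cis -` ball 1 \<epsilon>" using t assms(3) pi_gt3 by auto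
  qed
  moreover have "{0..<2*pi} \<inter> cis -` ball 1 \<epsilon> \<in> sets lborel"
    using measurable_sets[OF measurable_cis, of "ball 1 \<epsilon>"] by simp
  moreover have "emeasure lborel ({0..<2*pi} \<inter> cis -` ball 1 \<epsilon>) \<noteq> \<infinity>"
    using emeasure_mono[of "{0..<2*pi} \<inter> cis -` ball 1 \<epsilon>" "{0..<2*pi}" lborel] by (auto simp: top_unique)
  ultimately have "measure lborel {0..<\<epsilon>} \<le> measure lborel ({0..<2*pi} \<inter> cis -` ball 1 \<epsilon>)"
    by (intro measure_mono_fmeasurable) (auto simp: fmeasurable_def less_top)
  then have "\<epsilon> \<le> measure lborel ({0..<2*pi} \<inter> cis -` ball 1 \<epsilon>)" using assms(2) by simp
  then show ?thesis
    using measure_circle_ball_rotate[OF assms(1)] by (simp add: measure_circle_measure divide_right_mono)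
qed

text \<open>A crude constant suffices, since constant factors in the mass of a ball vanish after
  division by \<open>ln \<epsilon>\<close>. Beyond 1, monotonicity and
  \<open>sin 1 \<ge> 5/6\<close> give the bound because \<open>x \<le> 2\<close>.\<close>

lemma sin_ge_quarter:
  assumes "0 \<le> x" "x \<le> pi / 2" shows "x / 4 \<le> sin x"
proof (cases "x \<le> 1")
  case True
  have "\<bar>sin x - (\<Sum>m<3. sin_coeff m * x ^ m)\<bar> \<le> inverse (fact 3) * \<bar>x\<bar> ^ 3" by (rule Maclaurin_sin_bound)
  then have "\<bar>sin x - x\<bar> \<le> \<bar>x\<bar> ^ 3 / 6"
    by (simp add: eval_nat_numeral sin_coeff_def fact_reduce)
  moreover have "\<bar>x\<bar> ^ 3 \<le> x"
    using True assms(1) power_decreasing[of 1 3 x] by simp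
  ultimately show ?thesis using assms(1) by linarith
next
  case False
  have "\<bar>sin 1 - (\<Sum>m<3. sin_coeff m * 1 ^ m)\<bar> \<le> inverse (fact 3) * \<bar>1::real\<bar> ^ 3" by (rule Maclaurin_sin_bound)
  then have "\<bar>sin 1 - (1::real)\<bar> \<le> 1 / 6"
    by (simp add: eval_nat_numeral sin_coeff_def fact_reduce)
  moreover have "sin 1 \<le> sin x" using False assms by (intro sin_monotone_2pi_le) auto
  moreover have "x \<le> 2" using assms(2) pi_less_4 by simp
  ultimately show ?thesis by linarith
qed

lemma measure_circle_ball_le:
  assumes "0 < \<epsilon>" "\<epsilon> < 1"
  shows "measure circle_measure (ball 1 \<epsilon>) \<le> 8 * \<epsilon> / (2 * pi)"
proof -
  have "{0..<2*pi} \<inter> cis -` ball 1 \<epsilon> \<subseteq> {0..4*\<epsilon>} \<union> {2*pi-4*\<epsilon>..2*pi}"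
  proof
    fix t assume t: "t \<in> {0..<2*pi} \<inter> cis -` ball 1 \<epsilon>"
    have s: "2 * \<bar>sin (t / 2)\<bar> < \<epsilon>"
      using t by (simp add: norm_cis_diff_1[symmetric] dist_norm norm_minus_commute)
    show "t \<in> {0..4*\<epsilon>} \<union> {2*pi-4*\<epsilon>..2*pi}"
    proof (cases "t \<le> pi")
      case True
      then show ?thesis using sin_ge_quarter[of "t / 2"] s t by auto
    next
      case False
      have "sin (pi - t / 2) = sin (t / 2)" by (rule sin_pi_minus)
      then show ?thesis using sin_ge_quarter[of "pi - t / 2"] s t False by auto
    qed
  qed
  then have "measure lborel ({0..<2*pi} \<inter> cis -` ball 1 \<epsilon>) \<le> measure lborel ({0..4*\<epsilon>} \<union> {2*pi-4*\<epsilon>..2*pi})"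
    using measurable_sets[OF measurable_cis, of "ball 1 \<epsilon>"] 
    by (intro measure_mono_fmeasurable fmeasurable.Un fmeasurableI) (auto simp: emeasure_lborel_Icc_eq)
  also have "\<dots> \<le> measure lborel {0..4*\<epsilon>} + measure lborel {2*pi-4*\<epsilon>..2*pi}"
    by (intro measure_Un_le) auto
  also have "\<dots> = 8 * \<epsilon>" using assms(1) by simp
  finally have "measure lborel ({0..<2*pi} \<inter> cis -` ball 1 \<epsilon>) / (2 * pi) \<le> 8 * \<epsilon> / (2 * pi)"
    by (rule divide_right_mono) simp
  then show ?thesis unfolding measure_circle_measure[OF borel_open[OF open_ball]] .
qed

lemma measure_mu_ball_CI:
  assumes "norm u = 1" "0 < \<epsilon>" "\<epsilon> < 1"
  shows "measure mu (ball (CI u) \<epsilon>) = measure circle_measure (ball 1 \<epsilon>) / 2"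
proof -
  have "CI -` ball (CI u) \<epsilon> = ball u \<epsilon>" by (rule set_eqI) (simp add: dist_CI)
  moreover have "PA \<notin> ball (CI u) \<epsilon>" using dist_CI_PA[of u] assms(3) by auto
  ultimately show ?thesis using measure_circle_ball_rotate[OF assms(1)] by (simp add: measure_mu)
qed

lemma measure_mu_ball_PA:
  assumes "0 < \<epsilon>" "\<epsilon> < 1"
  shows "measure mu (ball PA \<epsilon>) = 1 / 2"
proof -
  have "dist PA (CI u) \<ge> 2" for u using dist_CI_PA[of u] by (simp add: dist_commute)
  then have "\<not> dist PA (CI u) < \<epsilon>" for u using assms(2) by (smt (verit))
  then have "CI -` ball PA \<epsilon> = {}" by (intro equals0I) simp
  then show ?thesis using assms by (simp add: measure_mu)
qed

lemma closed_msupport: "closed (msupport (\<mu> :: 'a::metric_space measure))" if "sets \<mu> = sets borel"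
  unfolding closed_def open_contains_ball
proof
  fix x assume "x \<in> - msupport \<mu>"
  then obtain \<epsilon> where \<epsilon>: "\<epsilon> > 0" "emeasure \<mu> (ball x \<epsilon>) = 0" by (auto simp: msupport_def)
  have "ball x (\<epsilon> / 2) \<subseteq> - msupport \<mu>"
  proof
    fix y assume y: "y \<in> ball x (\<epsilon> / 2)"
    have "ball y (\<epsilon> / 2) \<subseteq> ball x \<epsilon>"
    proof
      fix z assume "z \<in> ball y (\<epsilon> / 2)"
      then show "z \<in> ball x \<epsilon>" using y dist_triangle[of x z y] by simp
    qed
    then have "emeasure \<mu> (ball y (\<epsilon> / 2)) \<le> emeasure \<mu> (ball x \<epsilon>)" using that by (intro emeasure_mono) auto
    then show "y \<in> - msupport \<mu>" using \<epsilon> by (auto simp: msupport_def intro!: exI[of _ "\<epsilon> / 2"])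
  qed
  then show "\<exists>e>0. ball x e \<subseteq> - msupport \<mu>" using \<epsilon>(1) by (intro exI[of _ "\<epsilon> / 2"]) auto
qed

lemma msupport_mu: "PA \<in> msupport mu" "norm u = 1 \<Longrightarrow> CI u \<in> msupport mu"
proof -
  have *: "x \<in> msupport mu" if x: "\<And>\<epsilon>. 0 < \<epsilon> \<Longrightarrow> \<epsilon> < 1 \<Longrightarrow> measure mu (ball x \<epsilon>) > 0" for x
    unfolding msupport_def
  proof (intro CollectI allI impI)
    fix \<epsilon> :: real assume "\<epsilon> > 0"
    then have "0 < measure mu (ball x (min \<epsilon> (1/2)))" by (intro x) auto
    also have "\<dots> \<le> measure mu (ball x \<epsilon>)" by (intro mu.finite_measure_mono) auto
    finally show "0 < emeasure mu (ball x \<epsilon>)" by (simp add: mu.emeasure_eq_measure)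
  qed
  show "PA \<in> msupport mu" by (rule *) (simp add: measure_mu_ball_PA)
  show "CI u \<in> msupport mu" if "norm u = 1"
  proof (rule *)
    fix \<epsilon> :: real assume e: "0 < \<epsilon>" "\<epsilon> < 1"
    then have "0 < \<epsilon> / (2 * pi)" by simp
    also have "\<dots> \<le> measure circle_measure (ball 1 \<epsilon>)" using e by (intro measure_circle_ball_ge) auto
    finally show "0 < measure mu (ball (CI u) \<epsilon>)" using measure_mu_ball_CI[OF that e] by simp
  qed
qed

lemma AE_mu: "AE x in mu. x = PA \<or> x \<in> CI ` circle"
proof -
  have "compact (insert PA (CI ` circle))"
    by (intro compact_insert compact_continuous_image continuous_CI compact_sphere)
  then have S: "insert PA (CI ` circle) \<in> sets borel" by (rule borel_compact)
  have "CI -` insert PA (CI ` circle) = circle"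
  proof -
    have "CI u = CI v \<Longrightarrow> u = v" for u v using dist_CI[of u v] by simp
    then have "inj CI" by (intro injI) blast
    then have "CI u \<in> CI ` circle \<longleftrightarrow> u \<in> circle" for u by (rule inj_image_mem_iff)
    moreover have "CI u \<noteq> PA" for u using dist_CI_PA[of u] by auto
    ultimately show ?thesis by (intro set_eqI) (simp only: vimage_eq insert_iff simp_thms)
  qed
  then have "emeasure mu (insert PA (CI ` circle)) = 1"
    by (simp add: emeasure_mu[OF S] emeasure_circle)
  then have "AE x in mu. x \<in> insert PA (CI ` circle)"
    using mu.AE_in_set_eq_1[of "insert PA (CI ` circle)"] S by (simp add: measure_def)
  then show ?thesis by eventually_elim auto
qed

lemma measurable_measure_ball:
  "(\<lambda>x. measure mu (ball x \<epsilon>)) \<in> borel_measurable borel"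
proof -
  have "open {p :: pt3 \<times> pt3. dist (fst p) (snd p) < \<epsilon>}" by (intro open_Collect_less continuous_intros)
  then have "{p :: pt3 \<times> pt3. dist (fst p) (snd p) < \<epsilon>} \<in> sets (borel \<Otimes>\<^sub>M borel)"
    unfolding borel_prod by (rule borel_open)
  also have "sets (borel \<Otimes>\<^sub>M borel) = sets (borel \<Otimes>\<^sub>M mu)" by (intro sets_pair_measure_cong) simp_all
  finally have "(\<lambda>x. emeasure mu (Pair x -` {p :: pt3 \<times> pt3. dist (fst p) (snd p) < \<epsilon>})) \<in> borel_measurable borel"
    by (rule mu.measurable_emeasure_Pair)
  also have "(\<lambda>x. emeasure mu (Pair x -` {p :: pt3 \<times> pt3. dist (fst p) (snd p) < \<epsilon>})) = (\<lambda>x. emeasure mu (ball x \<epsilon>))"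
    by (intro ext arg_cong[where f = "emeasure mu"]) auto
  finally have "(\<lambda>x. emeasure mu (ball x \<epsilon>)) \<in> borel_measurable borel" .
  then show ?thesis unfolding measure_def by measurable
qed

text \<open>By rotation invariance the integrand takes only two values up to a null set. As
  \<open>\<epsilon>\<close> tends to 0, the value at the point tends to 0 and the value on the
  circle to 1.\<close>

lemma ID_integral_mu:
  assumes "0 < \<epsilon>" "\<epsilon> < 1"
  shows "ID_integral mu \<epsilon> = (ln (1/2) / ln \<epsilon> + ln (measure circle_measure (ball 1 \<epsilon>) / 2) / ln \<epsilon>) / 2"
proof -
  define a b where "a = ln (1/2) / ln \<epsilon>" and "b = ln (measure circle_measure (ball 1 \<epsilon>) / 2) / ln \<epsilon>"
  let ?g = "\<lambda>x. if x = PA then a else b"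
  have mg: "?g \<in> borel_measurable borel" by measurable
  have ms: "msupport mu \<in> sets borel" using closed_msupport[of mu] by (simp add: borel_closed)
  have mf: "(\<lambda>x. indicator (msupport mu) x *\<^sub>R (ln (measure mu (ball x \<epsilon>)) / ln \<epsilon>)) \<in> borel_measurable borel"
    using ms measurable_measure_ball[of \<epsilon>] by measurable
  have "ID_integral mu \<epsilon> = (LINT x|mu. ?g x)"
    unfolding ID_integral_def set_lebesgue_integral_def
  proof (rule integral_cong_AE)
    show "AE x in mu. indicator (msupport mu) x *\<^sub>R (ln (measure mu (ball x \<epsilon>)) / ln \<epsilon>) = ?g x"
      using AE_mu
    proof eventually_elim
      case (elim x)
      have "CI u \<noteq> PA" for u using dist_CI_PA[of u] by auto
      then show ?case
        using elim assms by (auto simp: msupport_mu measure_mu_ball_PA measure_mu_ball_CI a_def b_def)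
    qed
  qed (use mf mg in auto)
  also have "\<dots> = (?g PA + (LINT u|circle_measure. ?g (CI u))) / 2"
    by (rule integral_mu[OF mg, of "max \<bar>a\<bar> \<bar>b\<bar>"]) auto
  also have "(LINT u|circle_measure. ?g (CI u)) = (LINT u|circle_measure. b)"
  proof -
    have "CI u \<noteq> PA" for u using dist_CI_PA[of u] by auto
    then show ?thesis by simp
  qed
  finally show ?thesis using circle.prob_space by (simp add: a_def b_def)
qed

lemma has_ID_mu: "has_ID mu (ereal (1/2))"
proof -
  define m where "m \<epsilon> = measure circle_measure (ball 1 \<epsilon>)" for \<epsilon> :: real
  have inv: "((\<lambda>\<epsilon>. c / ln \<epsilon>) \<longlongrightarrow> 0) (at_right 0)" for c :: real
    by (intro tendsto_divide_0[OF tendsto_const] filterlim_at_bot_imp_at_infinity ln_at_0)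
  have small: "\<forall>\<^sub>F \<epsilon> in at_right (0::real). 0 < \<epsilon> \<and> \<epsilon> < 1"
    using eventually_at_right_real[of 0 1] by simp
  have "((\<lambda>\<epsilon>. ln (m \<epsilon> / 2) / ln \<epsilon>) \<longlongrightarrow> 1) (at_right 0)"
  proof (rule tendsto_sandwich)
    \<comment> \<open>The mass \<open>m \<epsilon> / 2\<close> lies between
      \<open>\<epsilon> / (4 * pi)\<close> and \<open>2 * \<epsilon> / pi\<close>. Since
      \<open>ln \<epsilon>\<close> is negative, the upper bound for the mass gives the lower bound
      for the quotient.\<close>
    show "((\<lambda>\<epsilon>. 1 + ln (2 / pi) / ln \<epsilon>) \<longlongrightarrow> 1) (at_right 0)"
      using tendsto_add[OF tendsto_const inv, of 1 "ln (2 / pi)"] by simp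
    show "((\<lambda>\<epsilon>. 1 + ln (1 / (4 * pi)) / ln \<epsilon>) \<longlongrightarrow> 1) (at_right 0)"
      using tendsto_add[OF tendsto_const inv, of 1 "ln (1 / (4 * pi))"] by simp
    have bounds: "1 + ln (2 / pi) / ln \<epsilon> \<le> ln (m \<epsilon> / 2) / ln \<epsilon> \<and> ln (m \<epsilon> / 2) / ln \<epsilon> \<le> 1 + ln (1 / (4 * pi)) / ln \<epsilon>"
      if e: "0 < \<epsilon> \<and> \<epsilon> < 1" for \<epsilon>
    proof -
      have neg: "ln \<epsilon> < 0" using e by simp
      have lo: "\<epsilon> / (2 * pi) \<le> m \<epsilon>" unfolding m_def using e by (intro measure_circle_ball_ge) auto
      have hi: "m \<epsilon> \<le> 8 * \<epsilon> / (2 * pi)" unfolding m_def using e by (intro measure_circle_ball_le) auto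
      have "0 < \<epsilon> / (2 * pi)" using e by simp
      then have mp: "m \<epsilon> > 0" using lo by linarith
      have "1 + ln c / ln \<epsilon> = ln (c * \<epsilon>) / ln \<epsilon>" if "c > 0" for c
        using that e neg by (simp add: ln_mult add_divide_distrib)
      then have "1 + ln (2 / pi) / ln \<epsilon> = ln (2 / pi * \<epsilon>) / ln \<epsilon>" "1 + ln (1 / (4 * pi)) / ln \<epsilon> = ln (1 / (4 * pi) * \<epsilon>) / ln \<epsilon>"
        by simp_all
      moreover have "ln (m \<epsilon> / 2) \<le> ln (2 / pi * \<epsilon>)" using hi mp by (intro ln_mono) auto
      moreover have "ln (1 / (4 * pi) * \<epsilon>) \<le> ln (m \<epsilon> / 2)" using lo mp e by (intro ln_mono) auto
      ultimately show ?thesis using neg by (simp add: divide_right_mono_neg)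
    qed
    show "\<forall>\<^sub>F \<epsilon> in at_right 0. 1 + ln (2 / pi) / ln \<epsilon> \<le> ln (m \<epsilon> / 2) / ln \<epsilon>"
      "\<forall>\<^sub>F \<epsilon> in at_right 0. ln (m \<epsilon> / 2) / ln \<epsilon> \<le> 1 + ln (1 / (4 * pi)) / ln \<epsilon>"
      using small by (eventually_elim, use bounds in blast)+
  qed
  then have "((\<lambda>\<epsilon>. (ln (1/2) / ln \<epsilon> + ln (m \<epsilon> / 2) / ln \<epsilon>) / 2) \<longlongrightarrow> (0 + 1) / 2) (at_right 0)"
    by (intro tendsto_divide tendsto_add tendsto_const inv) auto
  moreover have "\<forall>\<^sub>F \<epsilon> in at_right 0. (ln (1/2) / ln \<epsilon> + ln (m \<epsilon> / 2) / ln \<epsilon>) / 2 = ID_integral mu \<epsilon>"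
    using small by eventually_elim (simp add: ID_integral_mu m_def)
  ultimately have "(ID_integral mu \<longlongrightarrow> 1 / 2) (at_right 0)"
    using tendsto_cong by fastforce
  then have "((\<lambda>\<epsilon>. ereal (ID_integral mu \<epsilon>)) \<longlongrightarrow> ereal (1/2)) (at_right 0)" by simp
  then show ?thesis
    unfolding has_ID_def lower_ID_def upper_ID_def
    by (auto intro!: lim_imp_Liminf lim_imp_Limsup)
qed

section \<open>Non-predictable points\<close>

lemma circle_mean_pos:
  assumes f: "continuous_on circle f" and nonneg: "\<And>z. norm z = 1 \<Longrightarrow> f z \<ge> (0::real)"
    and v: "norm v = 1" "f v > 0"
  shows "circle_mean f > 0"
proof -
  define \<eta> where "\<eta> = f v / 2"
  have \<eta>: "\<eta> > 0" using v by (simp add: \<eta>_def)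
  have vc: "v \<in> circle" using v by simp
  obtain d where d: "d > 0" "\<And>z. z \<in> circle \<Longrightarrow> dist z v < d \<Longrightarrow> dist (f z) (f v) < \<eta>"
    using f vc \<eta> unfolding continuous_on_iff by blast
  define e where "e = min d 1"
  have e: "0 < e" "e \<le> 1" "e \<le> d" using d by (auto simp: e_def)
  have lower: "indicator (ball v e) z * \<eta> \<le> indicator circle z *\<^sub>R f z" if "z \<in> circle" for z
  proof (cases "z \<in> ball v e")
    case True
    then have "dist (f z) (f v) < \<eta>" using that e by (intro d) (auto simp: dist_commute)
    then have "\<eta> \<le> f z" unfolding \<eta>_def dist_real_def by linarith
    then show ?thesis using True that by simp
  next
    case False
    then show ?thesis using nonneg[of z] that by simp
  qed
  have "0 < \<eta> * (e / (2 * pi))" using \<eta> e by simp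
  also have "\<dots> \<le> \<eta> * measure circle_measure (ball v e)"
    using \<eta> v e by (intro mult_left_mono measure_circle_ball_ge) auto
  also have "\<dots> = (LINT z|circle_measure. indicator (ball v e) z * \<eta>)" by simp
  also have "\<dots> \<le> circle_mean f"
    unfolding circle_mean_def set_lebesgue_integral_def
  proof (rule integral_mono_AE)
    show "integrable circle_measure (\<lambda>z. indicator (ball v e) z * \<eta>)"
      by (rule circle.integrable_const_bound[of _ \<eta>]) (use \<eta> in \<open>auto simp: indicator_def\<close>)
    show "integrable circle_measure (\<lambda>z. indicator circle z *\<^sub>R f z)"
      using set_integrable_circle[OF f] by (simp add: set_integrable_def)
    show "AE z in circle_measure. indicator (ball v e) z * \<eta> \<le> indicator circle z *\<^sub>R f z"
      using AE_circle by eventually_elim (rule lower)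
  qed
  finally show ?thesis .
qed

text \<open>An irrational rotation has no non-constant continuous factor on an interval, since a map of an interval has a fixed point.\<close>

lemma rotation_not_determined:
  fixes F :: "complex \<Rightarrow> real"
  assumes F: "continuous_on circle F"
    and det: "\<And>u v. norm u = 1 \<Longrightarrow> norm v = 1 \<Longrightarrow> F u = F v \<Longrightarrow> F (lam * u) = F (lam * v)"
    and uv: "norm u = 1" "norm v = 1"
  shows "F u = F v"
proof -
  have ne: "circle \<noteq> {}" using uv(1) by auto
  \<comment> \<open>The fixed point of the induced interval map is found without constructing that
    map: \<open>\<psi>\<close> is nonnegative at the minimum of \<open>F\<close> and nonpositive at
    its maximum.\<close>
  define \<psi> where "\<psi> z = F (lam * z) - F z" for z
  have c: "continuous_on circle (\<lambda>z. F (lam * z))"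
    by (rule continuous_on_compose2[OF F]) (auto simp: norm_mult intro!: continuous_intros)
  have c\<psi>: "continuous_on circle \<psi>" unfolding \<psi>_def by (intro continuous_intros c F)
  obtain a where a: "a \<in> circle" "\<And>z. z \<in> circle \<Longrightarrow> F a \<le> F z"
    using continuous_attains_inf[OF compact_sphere ne F] by blast
  obtain b where b: "b \<in> circle" "\<And>z. z \<in> circle \<Longrightarrow> F z \<le> F b"
    using continuous_attains_sup[OF compact_sphere ne F] by blast
  have "\<psi> a \<ge> 0" "\<psi> b \<le> 0"
    using a(2)[of "lam * a"] b(2)[of "lam * b"] a(1) b(1) by (simp_all add: \<psi>_def norm_mult)
  moreover have "connected (\<psi> ` circle)"
    by (intro connected_continuous_image c\<psi> connected_sphere) simp
  ultimately have "0 \<in> \<psi> ` circle"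
    using a(1) b(1) connectedD_interval[of "\<psi> ` circle" "\<psi> b" "\<psi> a" 0] by blast
  then obtain z where z: "norm z = 1" "F (lam * z) = F z" by (auto simp: \<psi>_def)
  have orbit: "F (lam ^ n * z) = F z" for n
  proof (induction n)
    case (Suc n)
    then have "F (lam * (lam ^ n * z)) = F (lam * z)" using z(1) by (intro det) (auto simp: norm_mult norm_power)
    then show ?case using z(2) by (simp add: mult.assoc)
  qed simp
  \<comment> \<open>The orbit of \<open>z\<close> lies in one level set of \<open>F\<close>, so by
    equidistribution \<open>g\<close> has mean 0; being continuous and nonnegative, it vanishes on
    the circle.\<close>
  define g where "g y = \<bar>F y - F z\<bar>" for y
  have cg: "continuous_on circle g" unfolding g_def by (intro continuous_intros F)
  have "(\<lambda>n. (\<Sum>i<n. g (lam ^ i * z)) / real n) \<longlonglongrightarrow> circle_mean g"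
    by (rule tendsto_uniform_limitI[OF rotation_equidistribution[OF cg]]) (use z in simp)
  then have "circle_mean g = 0" by (simp add: g_def orbit LIMSEQ_const_iff)
  then have "F y = F z" if "norm y = 1" for y
    using circle_mean_pos[OF cg, of y] that by (auto simp: g_def)
  then show ?thesis using uv by simp
qed

text \<open>By the intermediate value theorem \<open>f\<close> takes all values slightly above the
  common level near \<open>t1\<close>, and also near \<open>t2\<close>: so near that
  \<open>g\<close> moves by less than half the gap between \<open>g t1\<close> and
  \<open>g t2\<close>.\<close>

lemma level_pair_up:
  fixes f g :: "real \<Rightarrow> real"
  assumes f: "continuous_on UNIV f" and g: "continuous_on UNIV g"
    and up: "\<And>\<eta>. \<eta> > 0 \<Longrightarrow> \<exists>s. \<bar>s - t1\<bar> < \<eta> \<and> f s > f t1" "\<And>\<eta>. \<eta> > 0 \<Longrightarrow> \<exists>s. \<bar>s - t2\<bar> < \<eta> \<and> f s > f t2"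
    and t: "f t1 = f t2" "g t1 \<noteq> g t2"
  shows "\<exists>b > f t1. \<forall>y\<in>{f t1..b}. \<exists>s1 s2. f s1 = y \<and> f s2 = y \<and> g s1 \<noteq> g s2"
proof -
  define d where "d = \<bar>g t1 - g t2\<bar> / 2"
  have d: "d > 0" using t by (simp add: d_def)
  have "\<exists>\<eta>>0. \<forall>s. \<bar>s - r\<bar> < \<eta> \<longrightarrow> \<bar>g s - g r\<bar> < d" for r
    using g d unfolding continuous_on_iff dist_real_def by auto
  then obtain \<eta>1 \<eta>2 where \<eta>: "\<eta>1 > 0" "\<And>s. \<bar>s - t1\<bar> < \<eta>1 \<Longrightarrow> \<bar>g s - g t1\<bar> < d"
    "\<eta>2 > 0" "\<And>s. \<bar>s - t2\<bar> < \<eta>2 \<Longrightarrow> \<bar>g s - g t2\<bar> < d" by metis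
  obtain s1 where s1: "\<bar>s1 - t1\<bar> < \<eta>1" "f s1 > f t1" using up(1)[OF \<eta>(1)] by blast
  obtain s2 where s2: "\<bar>s2 - t2\<bar> < \<eta>2" "f s2 > f t2" using up(2)[OF \<eta>(3)] by blast
  have hit: "\<exists>x. f x = y \<and> \<bar>x - r\<bar> \<le> \<bar>s - r\<bar>" if "f r \<le> y" "y \<le> f s" for r s y
  proof -
    have "continuous_on (closed_segment r s) f" by (rule continuous_on_subset[OF f]) simp
    then have "connected (f ` closed_segment r s)" by (intro connected_continuous_image) auto
    then have "y \<in> f ` closed_segment r s"
      by (rule connectedD_interval[of _ "f r" "f s"]) (use that in auto)
    then obtain x where "x \<in> closed_segment r s" "f x = y" by blast
    then show ?thesis by (intro exI[of _ x]) (auto simp: closed_segment_eq_real_ivl split: if_splits)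
  qed
  show ?thesis
  proof (rule exI[of _ "min (f s1) (f s2)"], intro conjI ballI)
    show "f t1 < min (f s1) (f s2)" using s1 s2 t by simp
    fix y assume y: "y \<in> {f t1..min (f s1) (f s2)}"
    obtain x1 where x1: "f x1 = y" "\<bar>x1 - t1\<bar> \<le> \<bar>s1 - t1\<bar>" using hit[of t1 y s1] y by auto
    obtain x2 where x2: "f x2 = y" "\<bar>x2 - t2\<bar> \<le> \<bar>s2 - t2\<bar>" using hit[of t2 y s2] y t by auto
    have "\<bar>g x1 - g t1\<bar> < d" "\<bar>g x2 - g t2\<bar> < d"
      using x1 x2 s1 s2 by (auto intro: \<eta>)
    then have "g x1 \<noteq> g x2" unfolding d_def by (simp add: abs_if split: if_splits)
    then show "\<exists>s1 s2. f s1 = y \<and> f s2 = y \<and> g s1 \<noteq> g s2" using x1 x2 by blast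
  qed
qed

text \<open>
  If the level of \<open>t1\<close> is approached from above and that of \<open>t2\<close> from below, a crossing of this level,
  which is approached from both sides, can replace one of them.
\<close>

lemma level_pair_interval:
  fixes f g :: "real \<Rightarrow> real"
  assumes f: "continuous_on UNIV f" and g: "continuous_on UNIV g"
    and per: "\<And>t. f (t + 2 * pi) = f t"
    and nc: "\<And>a b. a < b \<Longrightarrow> \<exists>s\<in>{a..b}. \<exists>t\<in>{a..b}. f s \<noteq> f t"
    and t: "f t1 = f t2" "g t1 \<noteq> g t2"
  shows "\<exists>a b. a < b \<and> (\<forall>y\<in>{a..b}. \<exists>s1 s2. f s1 = y \<and> f s2 = y \<and> g s1 \<noteq> g s2)"
proof -
  define up where "up t \<longleftrightarrow> (\<forall>\<eta>>0. \<exists>s. \<bar>s - t\<bar> < \<eta> \<and> f s > f t)" for t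
  define down where "down t \<longleftrightarrow> (\<forall>\<eta>>0. \<exists>s. \<bar>s - t\<bar> < \<eta> \<and> f s < f t)" for t
  have ud: "up t \<or> down t" for t
  proof (rule ccontr)
    assume "\<not> (up t \<or> down t)"
    then have "\<not> up t" "\<not> down t" by simp_all
    from \<open>\<not> up t\<close> obtain \<eta> where \<eta>: "\<eta> > 0" "\<forall>s. \<bar>s - t\<bar> < \<eta> \<longrightarrow> \<not> f s > f t"
      unfolding up_def by blast
    from \<open>\<not> down t\<close> obtain \<eta>' where \<eta>': "\<eta>' > 0" "\<forall>s. \<bar>s - t\<bar> < \<eta>' \<longrightarrow> \<not> f s < f t"
      unfolding down_def by blast
    define r where "r = min \<eta> \<eta>' / 2"
    have r: "0 < r" "r < \<eta>" "r < \<eta>'" using \<eta>(1) \<eta>'(1) by (auto simp: r_def)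
    have c: "f s = f t" if "s \<in> {t..t + r}" for s
      using \<eta>(2)[rule_format, of s] \<eta>'(2)[rule_format, of s] that r by simp
    obtain s s' where "s \<in> {t..t + r}" "s' \<in> {t..t + r}" "f s \<noteq> f s'" using nc[of t "t + r"] r(1) by auto
    with c[of s] c[of s'] show False by simp
  qed
  have case_up: ?thesis if "up t1" "up t2" "f t1 = f t2" "g t1 \<noteq> g t2" for t1 t2
  proof -
    have "\<exists>b > f t1. \<forall>y\<in>{f t1..b}. \<exists>s1 s2. f s1 = y \<and> f s2 = y \<and> g s1 \<noteq> g s2"
      by (rule level_pair_up[OF f g _ _ that(3,4)]) (use that(1,2) in \<open>simp_all add: up_def\<close>)
    then obtain b where b: "b > f t1" "\<forall>y\<in>{f t1..b}. \<exists>s1 s2. f s1 = y \<and> f s2 = y \<and> g s1 \<noteq> g s2" by blast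
    show ?thesis by (rule exI[of _ "f t1"], rule exI[of _ b]) (rule conjI[OF b])
  qed
  have case_down: ?thesis if dn: "down t1" "down t2" "f t1 = f t2" "g t1 \<noteq> g t2" for t1 t2
  proof -
    have cm: "continuous_on UNIV (\<lambda>x. - f x)" by (intro continuous_intros f)
    have "\<exists>b > - f t1. \<forall>y\<in>{- f t1..b}. \<exists>s1 s2. - f s1 = y \<and> - f s2 = y \<and> g s1 \<noteq> g s2"
      by (rule level_pair_up[OF cm g _ _ _ dn(4)]) (use dn(1-3) in \<open>simp_all add: down_def\<close>)
    then obtain b where b: "b > - f t1"
      "\<forall>y\<in>{- f t1..b}. \<exists>s1 s2. - f s1 = y \<and> - f s2 = y \<and> g s1 \<noteq> g s2" by blast
    have bad: "\<exists>s1 s2. f s1 = y \<and> f s2 = y \<and> g s1 \<noteq> g s2" if "y \<in> {-b..f t1}" for y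
    proof -
      have "- y \<in> {- f t1..b}" using that by auto
      with b(2) obtain s1 s2 where "- f s1 = - y" "- f s2 = - y" "g s1 \<noteq> g s2" by blast
      then show ?thesis by auto
    qed
    have "-b < f t1" using b(1) by linarith
    then show ?thesis using bad by blast
  qed
  have case_mixed: ?thesis if mx: "up t1" "down t2" "f t1 = f t2" "g t1 \<noteq> g t2" for t1 t2
  proof -
    define y where "y = f t1"
    obtain s1 where s1: "f s1 > y" using mx(1)[unfolded up_def, rule_format, OF zero_less_one] by (auto simp: y_def)
    obtain s2 where s2: "f s2 < y" using mx(2)[unfolded down_def, rule_format, OF zero_less_one] mx(3) by (auto simp: y_def)
    have perk: "f (t + of_nat k * (2 * pi)) = f t" for t k
    proof (induction k)
      case (Suc k)
      then show ?case using per[of "t + of_nat k * (2 * pi)"] by (simp add: algebra_simps)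
    qed simp
    \<comment> \<open>Periodicity moves a point above the level to the right of
      \<open>s2\<close>.\<close>
    obtain k :: nat where "(s2 - s1) / (2 * pi) < real k" using reals_Archimedean2 by blast
    then have "s2 < s1 + of_nat k * (2 * pi)" by (simp add: pos_divide_less_eq)
    moreover have "f (s1 + of_nat k * (2 * pi)) > y" unfolding perk by (rule s1)
    ultimately obtain s3 where s3: "f s3 > y" "s2 < s3" by blast
    \<comment> \<open>The infimum \<open>c\<close> of \<open>A\<close> is the crossing: before it
      \<open>f\<close> is at most \<open>y\<close>, with values below \<open>y\<close> arbitrarily
      near as \<open>f\<close> is constant on no interval, and values above \<open>y\<close> occur
      arbitrarily near on its right.\<close>
    define A where "A = {t\<in>{s2..s3}. f t > y}"
    define c where "c = Inf A"
    have A: "s3 \<in> A" "bdd_below A" using s3 by (auto simp: A_def intro!: bdd_belowI[of _ s2])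
    have cA: "c \<le> t" if "t \<in> A" for t unfolding c_def by (rule cInf_lower[OF that A(2)])
    have c2: "s2 \<le> c" unfolding c_def using A(1) by (intro cInf_greatest) (auto simp: A_def)
    have cle: "f t \<le> y" if "s2 \<le> t" "t < c" for t
    proof (rule ccontr)
      assume "\<not> f t \<le> y"
      then have "t \<in> A" using that cA[OF A(1)] by (auto simp: A_def)
      then show False using cA[of t] that(2) by simp
    qed
    have near: "\<exists>t\<in>A. t < c + \<eta>" if "\<eta> > 0" for \<eta>
      using cInf_lessD[of A "c + \<eta>"] A that by (auto simp: c_def)
    have cont: "\<exists>\<eta>>0. \<forall>s. \<bar>s - c\<bar> < \<eta> \<longrightarrow> \<bar>f s - f c\<bar> < e" if "e > 0" for e
      using f that unfolding continuous_on_iff dist_real_def by auto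
    have ge: "f c \<ge> y"
    proof (rule ccontr)
      assume "\<not> f c \<ge> y"
      then obtain \<eta> where \<eta>: "\<eta> > 0" "\<And>s. \<bar>s - c\<bar> < \<eta> \<Longrightarrow> \<bar>f s - f c\<bar> < y - f c" using cont[of "y - f c"] by auto
      obtain t where t: "t \<in> A" "t < c + \<eta>" using near[OF \<eta>(1)] by blast
      then have "\<bar>f t - f c\<bar> < y - f c" using cA[of t] by (intro \<eta>) auto
      then show False using t(1) by (auto simp: A_def)
    qed
    then have c2': "s2 < c" using c2 s2 by (cases "c = s2") auto
    have le: "f c \<le> y"
    proof (rule ccontr)
      assume "\<not> f c \<le> y"
      then obtain \<eta> where \<eta>: "\<eta> > 0" "\<And>s. \<bar>s - c\<bar> < \<eta> \<Longrightarrow> \<bar>f s - f c\<bar> < f c - y" using cont[of "f c - y"] by auto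
      define t where "t = max s2 (c - \<eta> / 2)"
      have t: "s2 \<le> t" "t < c" "\<bar>t - c\<bar> < \<eta>" using \<eta>(1) c2' by (auto simp: t_def)
      show False using cle[OF t(1,2)] \<eta>(2)[OF t(3)] by linarith
    qed
    have fc: "f c = y" using ge le by simp
    have "up c" unfolding up_def
    proof (intro allI impI)
      fix \<eta> :: real assume "\<eta> > 0"
      then obtain t where "t \<in> A" "t < c + \<eta>" using near by blast
      then show "\<exists>s. \<bar>s - c\<bar> < \<eta> \<and> f s > f c" using cA[of t] fc by (intro exI[of _ t]) (auto simp: A_def)
    qed
    have "down c" unfolding down_def
    proof (intro allI impI)
      fix \<eta> :: real assume \<eta>: "\<eta> > 0"
      define r where "r = max s2 (c - \<eta> / 2)"
      have r: "s2 \<le> r" "r < c" "c - r < \<eta>" using \<eta> c2' by (auto simp: r_def)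
      obtain s t where st: "s \<in> {r..(r + c) / 2}" "t \<in> {r..(r + c) / 2}" "f s \<noteq> f t" using nc[of r "(r + c) / 2"] r by auto
      have *: "\<exists>s. \<bar>s - c\<bar> < \<eta> \<and> f s < f c" if "x \<in> {r..(r + c) / 2}" "f x \<noteq> y" for x
      proof -
        have "s2 \<le> x" "x < c" "\<bar>x - c\<bar> < \<eta>" using that(1) r by auto
        then show ?thesis using cle[of x] that(2) fc by (intro exI[of _ x]) auto
      qed
      show "\<exists>s. \<bar>s - c\<bar> < \<eta> \<and> f s < f c" using *[of s] *[of t] st by (cases "f s = y") auto
    qed
    show ?thesis
    \<comment> \<open>\<open>g c\<close> differs from at least one of \<open>g t1\<close> and
      \<open>g t2\<close>, and the crossing is paired with that point.\<close>
    proof (cases "g c = g t1")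
      case False
      then show ?thesis using case_up[of c t1] \<open>up c\<close> mx fc by (simp add: y_def)
    next
      case True
      then show ?thesis using case_down[of c t2] \<open>down c\<close> mx fc by (simp add: y_def)
    qed
  qed
  show ?thesis
    using ud[of t1] ud[of t2] case_up[of t1 t2] case_down[of t1 t2] case_mixed[of t1 t2] case_mixed[of t2 t1] t by auto
qed

section \<open>Conditional deviations and the local mass of the law\<close>

definition law :: "lip_obs \<Rightarrow> real measure" where "law h = distr mu borel (obs h)"

lemma sets_law [simp, measurable_cong]: "sets (law h) = sets borel" and space_law [simp]: "space (law h) = UNIV"
  by (simp_all add: law_def)

lemma prob_space_law: "prob_space (law h)"
  unfolding law_def by (rule mu.prob_space_distr) measurable

definition tube :: "lip_obs \<Rightarrow> real \<Rightarrow> real \<Rightarrow> pt3 set" where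
  "tube h y \<epsilon> = {x\<in>S2xS1. obs h x \<in> ball y \<epsilon>}"

lemma measurable_tube [measurable]: "tube h y \<epsilon> \<in> sets borel"
proof -
  have "tube h y \<epsilon> = S2xS1 \<inter> obs h -` ball y \<epsilon>" by (auto simp: tube_def)
  moreover have "obs h -` ball y \<epsilon> \<in> sets borel"
    using measurable_sets[OF borel_measurable_obs, of "ball y \<epsilon>" h] by simp
  ultimately show ?thesis using borel_compact[OF compact_S2xS1] by auto
qed

lemma AE_mu_S2xS1: "AE x in mu. x \<in> S2xS1"
  using AE_mu by eventually_elim (auto simp: PA_mem CI_mem)

lemma measure_law_ball: "measure (law h) (ball y \<epsilon>) = measure mu (tube h y \<epsilon>)"
proof -
  have m: "obs h -` ball y \<epsilon> \<in> sets borel"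
    using measurable_sets[OF borel_measurable_obs, of "ball y \<epsilon>" h] by simp
  have "measure (law h) (ball y \<epsilon>) = measure mu (obs h -` ball y \<epsilon>)"
    unfolding law_def by (subst measure_distr) auto
  also have "\<dots> = measure mu (tube h y \<epsilon>)"
  proof (rule mu.finite_measure_eq_AE)
    show "AE x in mu. x \<in> obs h -` ball y \<epsilon> \<longleftrightarrow> x \<in> tube h y \<epsilon>"
      using AE_mu_S2xS1 by eventually_elim (simp add: tube_def)
  qed (use m in simp_all)
  finally show ?thesis .
qed

text \<open>The Lipschitz bound sends the arc of radius \<open>\<epsilon> / L\<close> about
  \<open>u\<close> into the tube. Its circle measure is at least
  \<open>\<epsilon> / (2 * pi * L)\<close>, and \<open>mu\<close> gives the circle half of its
  mass.\<close>

lemma tube_ge: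
  assumes L: "L-lipschitz_on S2xS1 (obs h)" "L \<ge> 1" and u: "norm u = 1" "obs h (CI u) = y" and \<epsilon>: "0 < \<epsilon>" "\<epsilon> \<le> 1"
  shows "norm v = 1 \<Longrightarrow> v \<in> ball u (\<epsilon> / L) \<Longrightarrow> CI v \<in> tube h y \<epsilon>"
    and "\<epsilon> / (4 * pi * L) \<le> measure mu (tube h y \<epsilon>)"
proof -
  show in_tube: "CI v \<in> tube h y \<epsilon>" if v: "norm v = 1" "v \<in> ball u (\<epsilon> / L)" for v
  proof -
    have "dist (obs h (CI u)) (obs h (CI v)) \<le> L * dist (CI u) (CI v)"
      using u v by (intro lipschitz_onD[OF L(1)]) (auto simp: CI_mem)
    also have "\<dots> = L * dist u v" by (simp add: dist_CI)
    also have "\<dots> < \<epsilon>" using v(2) L(2) by (simp add: pos_less_divide_eq mult.commute)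
    finally show ?thesis using u v by (simp add: tube_def CI_mem)
  qed
  have r: "0 < \<epsilon> / L" "\<epsilon> / L \<le> 1" using \<epsilon> L(2) by auto
  have m: "CI -` tube h y \<epsilon> \<in> sets borel" using measurable_sets[OF measurable_CI measurable_tube] by simp
  have "\<epsilon> / L / (2 * pi) \<le> measure circle_measure (ball u (\<epsilon> / L))"
    by (rule measure_circle_ball_ge[OF u(1) r])
  also have "\<dots> \<le> measure circle_measure (CI -` tube h y \<epsilon>)"
  proof (rule circle.finite_measure_mono_AE)
    show "AE v in circle_measure. v \<in> ball u (\<epsilon> / L) \<longrightarrow> v \<in> CI -` tube h y \<epsilon>"
      using AE_circle by eventually_elim (use in_tube in auto)
  qed (use m in auto)
  also have "\<dots> \<le> 2 * measure mu (tube h y \<epsilon>)" by (simp add: measure_mu)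
  finally show "\<epsilon> / (4 * pi * L) \<le> measure mu (tube h y \<epsilon>)" by (simp add: field_simps)
qed

text \<open>The two next values are \<open>4 \<eta>\<close> apart, so the conditional mean, whatever
  it is, misses one of them by \<open>2 \<eta>\<close>. Around the corresponding preimage the next
  values vary by at most \<open>\<epsilon> \<le> \<eta>\<close> on an arc of mass at least
  \<open>\<epsilon> / (4 pi L)\<close>. There the deviation is at least \<open>\<eta>\<close>, and
  this arc is at least the share \<open>1 / (4 pi L K)\<close> of the tube.\<close>

lemma pred_dev_lower:
  assumes L: "L-lipschitz_on S2xS1 (obs h)" "L \<ge> 1"
    and u1: "norm u1 = 1" "obs h (CI u1) = y" and u2: "norm u2 = 1" "obs h (CI u2) = y"
    and \<epsilon>: "0 < \<epsilon>" "\<epsilon> \<le> 1" "4 * \<epsilon> \<le> \<bar>obs h (CI (lam * u1)) - obs h (CI (lam * u2))\<bar>"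
    and K: "measure mu (tube h y \<epsilon>) \<le> K * \<epsilon>" "K > 0"
  shows "sqrt ((\<bar>obs h (CI (lam * u1)) - obs h (CI (lam * u2))\<bar> / 4)\<^sup>2 / (4 * pi * L * K)) \<le> pred_dev S2xS1 T mu (obs h) \<epsilon> y"
proof -
  define \<eta> where "\<eta> = \<bar>obs h (CI (lam * u1)) - obs h (CI (lam * u2))\<bar> / 4"
  have \<eta>: "\<epsilon> \<le> \<eta>" "0 < \<eta>" using \<epsilon> by (auto simp: \<eta>_def)
  define ctr where "ctr = pred_mean S2xS1 T mu (obs h) \<epsilon> y"
  obtain u where u: "norm u = 1" "obs h (CI u) = y" "2 * \<eta> \<le> \<bar>obs h (CI (lam * u)) - ctr\<bar>"
  proof -
    have "2 * \<eta> \<le> \<bar>obs h (CI (lam * u1)) - ctr\<bar> \<or> 2 * \<eta> \<le> \<bar>obs h (CI (lam * u2)) - ctr\<bar>"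
    proof (rule ccontr)
      assume "\<not> ?thesis"
      then have "\<bar>obs h (CI (lam * u1)) - ctr\<bar> < 2 * \<eta>" "\<bar>obs h (CI (lam * u2)) - ctr\<bar> < 2 * \<eta>" by simp_all
      moreover have "4 * \<eta> \<le> \<bar>obs h (CI (lam * u1)) - ctr\<bar> + \<bar>obs h (CI (lam * u2)) - ctr\<bar>"
        using abs_triangle_ineq4[of "obs h (CI (lam * u1)) - ctr" "obs h (CI (lam * u2)) - ctr"] by (simp add: \<eta>_def)
      ultimately show False by linarith
    qed
    then show ?thesis using that u1 u2 by blast
  qed
  define G where "G x = indicator (tube h y \<epsilon>) x *\<^sub>R \<bar>obs h (T x) - ctr\<bar>\<^sup>2" for x
  have cT: "continuous_on S2xS1 (\<lambda>x. \<bar>obs h (T x) - ctr\<bar>\<^sup>2)"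
    by (intro continuous_intros continuous_on_compose2[OF continuous_on_obs continuous_on_T]) (auto simp: T_mem)
  have mG: "G \<in> borel_measurable borel"
  proof -
    have X: "(\<lambda>x. indicator S2xS1 x *\<^sub>R \<bar>obs h (T x) - ctr\<bar>\<^sup>2) \<in> borel_measurable borel"
      by (rule borel_measurable_continuous_on_indicator[OF borel_compact[OF compact_S2xS1] cT])
    have "G = (\<lambda>x. indicator (tube h y \<epsilon>) x *\<^sub>R (indicator S2xS1 x *\<^sub>R \<bar>obs h (T x) - ctr\<bar>\<^sup>2))"
      by (auto simp: G_def tube_def indicator_def fun_eq_iff)
    then show ?thesis using X by simp
  qed
  have G0: "G x \<ge> 0" for x by (simp add: G_def)
  define B where "B = (lip_sup h + \<bar>ctr\<bar>)\<^sup>2"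
  have GB: "\<bar>G x\<bar> \<le> B" for x
  proof -
    have "\<bar>obs h (T x) - ctr\<bar> \<le> lip_sup h + \<bar>ctr\<bar>" using lip_sup_upper[of h "T x"] by linarith
    then have "\<bar>obs h (T x) - ctr\<bar>\<^sup>2 \<le> B" unfolding B_def by (rule power_mono) simp
    then show ?thesis by (auto simp: G_def B_def indicator_def)
  qed
  have low: "indicator (ball u (\<epsilon> / L)) v * \<eta>\<^sup>2 \<le> G (CI v)" if v: "norm v = 1" for v
  proof (cases "v \<in> ball u (\<epsilon> / L)")
    case True
    have "dist (obs h (CI (lam * u))) (obs h (CI (lam * v))) \<le> L * dist (CI (lam * u)) (CI (lam * v))"
      using u v by (intro lipschitz_onD[OF L(1)]) (auto simp: CI_mem norm_mult)
    also have "dist (CI (lam * u)) (CI (lam * v)) = dist u v"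
      unfolding dist_CI by (simp add: dist_norm norm_mult flip: right_diff_distrib)
    also have "L * dist u v \<le> \<epsilon>" using True L(2) by (simp add: pos_less_divide_eq mult.commute less_imp_le)
    finally have "\<eta> \<le> \<bar>obs h (CI (lam * v)) - ctr\<bar>" using u(3) \<eta>(1) unfolding dist_real_def by linarith
    then have "\<eta>\<^sup>2 \<le> \<bar>obs h (CI (lam * v)) - ctr\<bar>\<^sup>2" using \<eta>(2) by (intro power_mono) auto
    then show ?thesis using tube_ge(1)[OF L u(1,2) \<epsilon>(1,2) v True] True by (simp add: G_def T_CI)
  next
    case False
    then show ?thesis using G0 by simp
  qed
  have r: "0 < \<epsilon> / L" "\<epsilon> / L \<le> 1" using \<epsilon> L(2) by auto
  have iG: "(LINT x:tube h y \<epsilon>|mu. \<bar>obs h (T x) - ctr\<bar>\<^sup>2) = (G PA + (LINT v|circle_measure. G (CI v))) / 2"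
    unfolding set_lebesgue_integral_def using integral_mu[OF mG GB] by (simp add: G_def)
  have "\<eta>\<^sup>2 * (\<epsilon> / L / (2 * pi)) \<le> \<eta>\<^sup>2 * measure circle_measure (ball u (\<epsilon> / L))"
    by (intro mult_left_mono measure_circle_ball_ge[OF u(1) r]) simp
  also have "\<dots> = (LINT v|circle_measure. indicator (ball u (\<epsilon> / L)) v * \<eta>\<^sup>2)" by simp
  also have "\<dots> \<le> (LINT v|circle_measure. G (CI v))"
  proof (rule integral_mono_AE)
    show "integrable circle_measure (\<lambda>v. indicator (ball u (\<epsilon> / L)) v * \<eta>\<^sup>2)"
      by (rule circle.integrable_const_bound[of _ "\<eta>\<^sup>2"]) (auto simp: indicator_def)
    show "integrable circle_measure (\<lambda>v. G (CI v))"
    proof (rule circle.integrable_const_bound[of _ B])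
      show "(\<lambda>v. G (CI v)) \<in> borel_measurable circle_measure"
        using measurable_compose[OF measurable_CI mG] by simp
    qed (use GB in auto)
    show "AE v in circle_measure. indicator (ball u (\<epsilon> / L)) v * \<eta>\<^sup>2 \<le> G (CI v)"
      using AE_circle by eventually_elim (use low in auto)
  qed
  finally have "\<eta>\<^sup>2 * (\<epsilon> / L / (2 * pi)) \<le> (LINT v|circle_measure. G (CI v))" .
  then have int: "\<eta>\<^sup>2 * (\<epsilon> / L / (2 * pi)) / 2 \<le> (LINT x:tube h y \<epsilon>|mu. \<bar>obs h (T x) - ctr\<bar>\<^sup>2)"
    unfolding iG by (intro divide_right_mono add_increasing G0) simp_all
  have "0 < \<epsilon> / (4 * pi * L)" using \<epsilon> L(2) by simp
  also have "\<dots> \<le> measure mu (tube h y \<epsilon>)" by (rule tube_ge(2)[OF L u(1,2) \<epsilon>(1,2)])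
  finally have pos: "0 < measure mu (tube h y \<epsilon>)" .
  have "\<eta>\<^sup>2 / (4 * pi * L * K) = (1 / (K * \<epsilon>)) * (\<eta>\<^sup>2 * (\<epsilon> / L / (2 * pi)) / 2)"
    using \<epsilon> K L(2) by (simp add: field_simps)
  also have "\<dots> \<le> (1 / measure mu (tube h y \<epsilon>)) * (LINT x:tube h y \<epsilon>|mu. \<bar>obs h (T x) - ctr\<bar>\<^sup>2)"
    using pos K \<epsilon> L(2) int by (intro mult_mono divide_left_mono) auto
  finally have "sqrt (\<eta>\<^sup>2 / (4 * pi * L * K)) \<le> sqrt ((1 / measure mu (tube h y \<epsilon>)) * (LINT x:tube h y \<epsilon>|mu. \<bar>obs h (T x) - ctr\<bar>\<^sup>2))"
    by (rule real_sqrt_le_mono)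
  then show ?thesis unfolding pred_dev_def ctr_def tube_def \<eta>_def .
qed

text \<open>Convergence of the deviations to 0 is refuted along infinitely many scales
  \<open>1 / (n + 1)\<close>; so a finite lower density of the law at \<open>y\<close> is
  enough.\<close>

lemma nonpredictableI:
  assumes u1: "norm u1 = 1" "obs h (CI u1) = y" and u2: "norm u2 = 1" "obs h (CI u2) = y"
    and ne: "obs h (CI (lam * u1)) \<noteq> obs h (CI (lam * u2))"
    and dens: "\<exists>\<^sub>F n in sequentially. measure (law h) (ball y (1 / real (Suc n))) \<le> K / real (Suc n)"
  shows "y \<in> nonpredictable_points S2xS1 T mu (obs h)"
proof -
  obtain L0 where L0: "L0-lipschitz_on S2xS1 (obs h)" using obs_lipschitz by blast
  define L where "L = max L0 1"
  have L: "L-lipschitz_on S2xS1 (obs h)" "L \<ge> 1"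
    using lipschitz_on_le[OF L0, of L] by (auto simp: L_def)
  define K' where "K' = max K 1"
  have K': "K' > 0" "K \<le> K'" by (auto simp: K'_def)
  define d where "d = \<bar>obs h (CI (lam * u1)) - obs h (CI (lam * u2))\<bar>"
  have d: "d > 0" using ne by (simp add: d_def)
  define c where "c = sqrt ((d / 4)\<^sup>2 / (4 * pi * L * K'))"
  have c: "c > 0" using d L(2) K'(1) by (simp add: c_def)
  have supp: "y \<in> msupport (distr mu borel (obs h))"
    unfolding msupport_def law_def[symmetric]
  proof (intro CollectI allI impI)
    interpret law: prob_space "law h" by (rule prob_space_law)
    fix \<epsilon> :: real assume e: "\<epsilon> > 0"
    have "0 < min \<epsilon> 1 / (4 * pi * L)" using e L(2) by simp
    also have "\<dots> \<le> measure mu (tube h y (min \<epsilon> 1))" by (rule tube_ge(2)[OF L u1]) (use e in auto)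
    also have "\<dots> \<le> measure (law h) (ball y \<epsilon>)"
      unfolding measure_law_ball[symmetric] by (intro law.finite_measure_mono) auto
    finally show "0 < emeasure (law h) (ball y \<epsilon>)" by (simp add: law.emeasure_eq_measure)
  qed
  have "\<not> ((\<lambda>\<epsilon>. pred_dev S2xS1 T mu (obs h) \<epsilon> y) \<longlongrightarrow> 0) (at_right 0)"
  proof
    assume lim: "((\<lambda>\<epsilon>. pred_dev S2xS1 T mu (obs h) \<epsilon> y) \<longlongrightarrow> 0) (at_right 0)"
    have z: "(\<lambda>n. 1 / real (Suc n)) \<longlonglongrightarrow> 0" using LIMSEQ_inverse_real_of_nat by (simp add: inverse_eq_divide)
    then have "filterlim (\<lambda>n. 1 / real (Suc n)) (at_right 0) sequentially"
      by (auto simp: filterlim_at)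
    from filterlim_compose[OF lim this] have "(\<lambda>n. pred_dev S2xS1 T mu (obs h) (1 / real (Suc n)) y) \<longlonglongrightarrow> 0" .
    then have "\<forall>\<^sub>F n in sequentially. pred_dev S2xS1 T mu (obs h) (1 / real (Suc n)) y < c"
      using c by (rule order_tendstoD)
    moreover have "\<forall>\<^sub>F n in sequentially. 1 / real (Suc n) < d / 4"
      using z d by (intro order_tendstoD) auto
    ultimately have "\<forall>\<^sub>F n in sequentially. \<not> measure (law h) (ball y (1 / real (Suc n))) \<le> K / real (Suc n)"
    proof eventually_elim
      case (elim n)
      show ?case
      proof
        assume a: "measure (law h) (ball y (1 / real (Suc n))) \<le> K / real (Suc n)"
        also have "\<dots> \<le> K' * (1 / real (Suc n))" using K'(2) by (simp add: divide_right_mono)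
        finally have "measure mu (tube h y (1 / real (Suc n))) \<le> K' * (1 / real (Suc n))" by (simp only: measure_law_ball)
        from pred_dev_lower[OF L u1 u2 _ _ _ this K'(1)] elim(2)
        have "c \<le> pred_dev S2xS1 T mu (obs h) (1 / real (Suc n)) y" by (simp add: c_def d_def)
        then show False using elim(1) by simp
      qed
    qed
    then show False using dens by (simp add: frequently_def)
  qed
  then show ?thesis using supp by (simp add: nonpredictable_points_def predictable_points_def)
qed

section \<open>Finite lower density and sets of positive mass\<close>

text \<open>Fubini and Fatou bound the integral of the lower density by twice the total mass.\<close>

lemma AE_lower_density_finite:
  fixes \<nu> :: "real measure"
  assumes fin: "finite_measure \<nu>" and sets: "sets \<nu> = sets borel"
  defines "f \<equiv> \<lambda>n y. ennreal (real (Suc n)) * emeasure \<nu> (ball y (1 / real (Suc n)))"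
  shows "(\<lambda>y. liminf (\<lambda>n. f n y)) \<in> borel_measurable borel"
    and "AE y in lborel. liminf (\<lambda>n. f n y) \<noteq> \<infinity>"
proof -
  interpret nu: finite_measure \<nu> by fact
  interpret P: pair_sigma_finite lborel \<nu> ..
  have sp: "space \<nu> = UNIV" using sets_eq_imp_space_eq[OF sets] by simp
  let ?Q = "\<lambda>r. {p :: real \<times> real. dist (fst p) (snd p) < r}"
  have Q: "?Q r \<in> sets (lborel \<Otimes>\<^sub>M \<nu>)" for r
  proof -
    have "open (?Q r)" by (intro open_Collect_less continuous_intros)
    then have "?Q r \<in> sets (borel \<Otimes>\<^sub>M borel)" unfolding borel_prod by (rule borel_open)
    also have "sets (borel \<Otimes>\<^sub>M borel) = sets (lborel \<Otimes>\<^sub>M \<nu>)" by (intro sets_pair_measure_cong) (simp_all add: sets)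
    finally show ?thesis .
  qed
  have sec: "Pair y -` ?Q r = ball y r" "(\<lambda>y. (y, z)) -` ?Q r = ball z r" for y z r by (auto simp: dist_commute)
  have mb: "(\<lambda>y. emeasure \<nu> (ball y r)) \<in> borel_measurable lborel" for r
    using nu.measurable_emeasure_Pair[OF Q[of r]] unfolding sec .
  have mf: "f n \<in> borel_measurable lborel" for n unfolding f_def using mb by measurable
  then show "(\<lambda>y. liminf (\<lambda>n. f n y)) \<in> borel_measurable borel" by simp
  have int: "(\<integral>\<^sup>+y. f n y \<partial>lborel) = 2 * emeasure \<nu> UNIV" for n
  proof -
    let ?r = "1 / real (Suc n)"
    have "(\<integral>\<^sup>+y. emeasure \<nu> (ball y ?r) \<partial>lborel) = emeasure (lborel \<Otimes>\<^sub>M \<nu>) (?Q ?r)"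
      by (rule nu.emeasure_pair_measure_alt[OF Q[of ?r], unfolded sec, symmetric])
    also have "\<dots> = (\<integral>\<^sup>+z. emeasure lborel (ball z ?r) \<partial>\<nu>)"
      by (rule P.emeasure_pair_measure_alt2[OF Q[of ?r], unfolded sec])
    also have "\<dots> = (\<integral>\<^sup>+z. ennreal (2 * ?r) \<partial>\<nu>)"
      by (intro nn_integral_cong) (simp add: ball_eq_greaterThanLessThan)
    also have "\<dots> = ennreal (2 * ?r) * emeasure \<nu> UNIV" by (simp add: sp)
    finally have "(\<integral>\<^sup>+y. f n y \<partial>lborel) = ennreal (real (Suc n)) * (ennreal (2 * ?r) * emeasure \<nu> UNIV)"
      unfolding f_def by (subst nn_integral_cmult[OF mb]) simp
    also have "\<dots> = ennreal (real (Suc n) * (2 * ?r)) * emeasure \<nu> UNIV"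
    proof -
      have "ennreal (real (Suc n)) * ennreal (2 * ?r) = ennreal (real (Suc n) * (2 * ?r))"
        by (rule ennreal_mult[symmetric]) simp_all
      then show ?thesis by (simp only: mult.assoc[symmetric])
    qed
    also have "real (Suc n) * (2 * ?r) = 2" by (simp del: of_nat_Suc)
    finally show ?thesis by simp
  qed
  have "(\<integral>\<^sup>+y. liminf (\<lambda>n. f n y) \<partial>lborel) \<le> liminf (\<lambda>n. \<integral>\<^sup>+y. f n y \<partial>lborel)"
    by (rule nn_integral_liminf) (rule mf)
  also have "\<dots> = 2 * emeasure \<nu> UNIV" by (simp add: int Liminf_const)
  also have "\<dots> < \<infinity>" using nu.emeasure_finite[of UNIV] by (auto simp: ennreal_mult_eq_top_iff less_top[symmetric])
  finally show "AE y in lborel. liminf (\<lambda>n. f n y) \<noteq> \<infinity>"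
    by (intro nn_integral_PInf_AE) (use mf in auto)
qed

lemma liminf_finite_imp_frequently:
  fixes m :: "nat \<Rightarrow> real"
  assumes "liminf (\<lambda>n. ennreal (real (Suc n)) * ennreal (m n)) \<noteq> \<infinity>" "\<And>n. m n \<ge> 0"
  shows "\<exists>K. \<exists>\<^sub>F n in sequentially. m n \<le> K / real (Suc n)"
proof (rule ccontr)
  assume "\<not> ?thesis"
  then have ev: "\<forall>\<^sub>F n in sequentially. K / real (Suc n) < m n" for K by (auto simp: frequently_def not_le)
  have "of_nat K \<le> liminf (\<lambda>n. ennreal (real (Suc n)) * ennreal (m n))" for K
  proof (rule Liminf_bounded)
    show "\<forall>\<^sub>F n in sequentially. of_nat K \<le> ennreal (real (Suc n)) * ennreal (m n)"
      using ev[of "real K"]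
    proof eventually_elim
      case (elim n)
      then have "real K \<le> real (Suc n) * m n" by (simp add: pos_divide_less_eq mult.commute del: of_nat_Suc)
      then have "ennreal (real K) \<le> ennreal (real (Suc n) * m n)" by (rule ennreal_leI)
      then show ?case using assms(2)[of n] by (simp add: ennreal_mult ennreal_of_nat_eq_real_of_nat del: of_nat_Suc)
    qed
  qed
  then have "liminf (\<lambda>n. ennreal (real (Suc n)) * ennreal (m n)) = \<infinity>"
    by (metis ennreal_Ex_less_of_nat infinity_ennreal_def less_top not_le)
  then show False using assms(1) by simp
qed

text \<open>Lipschitz maps preserve null sets, so a set of positive length in the range has positive mass.\<close>

lemma law_positive:
  assumes A: "A \<in> sets borel" "emeasure lborel A \<noteq> 0" and range: "A \<subseteq> (\<lambda>t. obs h (CI (cis t))) ` UNIV"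
  shows "0 < emeasure (law h) A"
proof (rule ccontr)
  assume "\<not> 0 < emeasure (law h) A"
  then have 0: "emeasure (law h) A = 0" by simp
  define g where "g t = obs h (CI (cis t))" for t
  have hA: "obs h -` A \<in> sets borel" using measurable_sets[OF borel_measurable_obs A(1)] by simp
  have C: "CI -` (obs h -` A) \<in> sets borel" using measurable_sets[OF measurable_CI hA] by simp
  have "emeasure (law h) A = emeasure mu (obs h -` A)" unfolding law_def using A by (subst emeasure_distr) auto
  then have "emeasure circle_measure (CI -` (obs h -` A)) = 0" using 0 by (simp add: emeasure_mu[OF hA] ennreal_divide_eq_0_iff)
  then have "emeasure lborel ({0..<2*pi} \<inter> cis -` (CI -` (obs h -` A))) = 0"
    unfolding emeasure_circle_measure[OF C] by (simp only: ennreal_divide_eq_0_iff) simp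
  moreover have "cis -` (CI -` (obs h -` A)) = g -` A" by (auto simp: g_def)
  ultimately have null: "emeasure lborel ({0..<2*pi} \<inter> g -` A) = 0" by simp
  have mg: "g -` A \<in> sets borel"
  proof -
    have "g = (obs h \<circ> CI) \<circ> cis" by (simp add: g_def fun_eq_iff)
    then have "g \<in> borel_measurable borel"
      by (metis borel_measurable_obs measurable_CI measurable_cis measurable_comp)
    from measurable_sets[OF this A(1)] show ?thesis by simp
  qed
  have "{0..<2*pi} \<inter> g -` A \<in> null_sets lborel" using null mg by auto
  then have neg: "negligible ({0..<2*pi} \<inter> g -` A)"
    by (simp add: negligible_iff_null_sets null_sets_completionI)
  obtain L where L: "L-lipschitz_on S2xS1 (obs h)" using obs_lipschitz by blast
  have lip: "norm (g s - g t) \<le> L * norm (s - t)" for s t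
  proof -
    have "dist (g s) (g t) \<le> L * dist (CI (cis s)) (CI (cis t))"
      unfolding g_def by (intro lipschitz_onD[OF L]) (auto simp: CI_mem)
    also have "dist (CI (cis s)) (CI (cis t)) = norm (cis s - cis t)" unfolding dist_CI by (rule dist_norm)
    also have "cis s - cis t = cis t * (cis (s - t) - 1)" by (simp add: right_diff_distrib cis_mult)
    also have "norm \<dots> = 2 * \<bar>sin ((s - t) / 2)\<bar>" by (simp add: norm_mult norm_cis_diff_1)
    also have "L * (2 * \<bar>sin ((s - t) / 2)\<bar>) \<le> L * \<bar>s - t\<bar>"
      using abs_sin_x_le_abs_x[of "(s - t) / 2"] lipschitz_on_nonneg[OF L] by (intro mult_left_mono) auto
    finally show ?thesis by (simp add: dist_real_def)
  qed
  have "negligible (g ` ({0..<2*pi} \<inter> g -` A))"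
  proof (rule negligible_locally_Lipschitz_image[OF _ neg])
    fix x
    show "\<exists>U B. open U \<and> x \<in> U \<and> (\<forall>y\<in>({0..<2*pi} \<inter> g -` A) \<inter> U. norm (g y - g x) \<le> B * norm (y - x))"
      using lip by (intro exI[of _ UNIV] exI[of _ L]) auto
  qed simp
  moreover have "A \<subseteq> g ` ({0..<2*pi} \<inter> g -` A)"
  proof
    fix y assume y: "y \<in> A"
    then obtain t where t: "g t = y" using range by (auto simp: g_def)
    define s where "s = Arg2pi (cis t)"
    have "cis s = cis t" using Arg2pi_eq[of "cis t"] by (simp add: s_def cis_conv_exp)
    then have "g s = y" using t by (simp add: g_def)
    moreover have "s \<in> {0..<2*pi}" using Arg2pi_ge_0 Arg2pi_lt_2pi by (simp add: s_def)
    ultimately show "y \<in> g ` ({0..<2*pi} \<inter> g -` A)" using y by blast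
  qed
  ultimately have "negligible A" by (rule negligible_subset)
  then have "emeasure lebesgue A = 0" by (simp add: negligible_iff_null_sets null_sets_def)
  then show False using A by (simp add: emeasure_completion)
qed

lemma nonpredictable_positive:
  assumes nc: "\<And>a b. a < b \<Longrightarrow> \<exists>s\<in>{a..b}. \<exists>t\<in>{a..b}. obs h (CI (cis s)) \<noteq> obs h (CI (cis t))"
  shows "\<exists>A\<in>sets borel. A \<subseteq> nonpredictable_points S2xS1 T mu (obs h) \<and> 0 < emeasure (law h) A"
proof -
  define F where "F u = obs h (CI u)" for u
  have cF: "continuous_on circle F"
    unfolding F_def by (rule continuous_on_compose2[OF continuous_on_obs continuous_CI]) (auto simp: CI_mem)
  obtain u1 u2 where u: "norm u1 = 1" "norm u2 = 1" "F u1 = F u2" "F (lam * u1) \<noteq> F (lam * u2)"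
  proof -
    obtain s t where "F (cis s) \<noteq> F (cis t)" using nc[of 0 1] by (auto simp: F_def)
    then show ?thesis using rotation_not_determined[OF cF, of "cis s" "cis t"] that by auto
  qed
  obtain t1 t2 where t: "u1 = cis t1" "u2 = cis t2"
    using u cis_Arg by (metis norm_zero sgn_eq div_by_1 of_real_1 zero_neq_one)
  define f where "f t = F (cis t)" for t
  define g where "g t = F (lam * cis t)" for t
  have cf: "continuous_on UNIV f" unfolding f_def
    by (rule continuous_on_compose2[OF cF]) (auto intro!: continuous_intros)
  have cg: "continuous_on UNIV g" unfolding g_def
    by (rule continuous_on_compose2[OF cF]) (auto simp: norm_mult intro!: continuous_intros)
  have "f (t + 2 * pi) = f t" for t by (simp add: f_def cis_mult[symmetric])
  moreover have "\<exists>s\<in>{a..b}. \<exists>t\<in>{a..b}. f s \<noteq> f t" if "a < b" for a b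
    using nc[OF that] by (simp add: f_def F_def)
  ultimately obtain a b where ab: "a < b" "\<And>y. y \<in> {a..b} \<Longrightarrow> \<exists>s1 s2. f s1 = y \<and> f s2 = y \<and> g s1 \<noteq> g s2"
    using level_pair_interval[OF cf cg, of t1 t2] u t by (auto simp: f_def g_def)
  interpret law: prob_space "law h" by (rule prob_space_law)
  define l where "l y = liminf (\<lambda>n. ennreal (real (Suc n)) * emeasure (law h) (ball y (1 / real (Suc n))))" for y
  have ml: "l \<in> borel_measurable borel" and ael: "AE y in lborel. l y \<noteq> \<infinity>"
    using AE_lower_density_finite[OF law.finite_measure_axioms sets_law] by (simp_all add: l_def[abs_def])
  \<comment> \<open>The interval of values with two different continuations, without those of
    infinite lower density. The latter have length 0, so \<open>A\<close> has positive length and,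
    by \<open>law_positive\<close>, positive mass.\<close>
  define A where "A = {y\<in>{a..b}. l y \<noteq> \<infinity>}"
  have A: "A \<in> sets borel"
  proof -
    have "l -` (UNIV - {\<infinity>}) \<in> sets borel" using measurable_sets[OF ml, of "UNIV - {\<infinity>}"] by simp
    moreover have "A = {a..b} \<inter> l -` (UNIV - {\<infinity>})" by (auto simp: A_def)
    ultimately show ?thesis by simp
  qed
  have "emeasure lborel A = emeasure lborel {a..b}"
    by (rule emeasure_eq_AE) (use ael A in \<open>auto simp: A_def elim!: eventually_mono\<close>)
  then have "emeasure lborel A \<noteq> 0" using ab(1) by simp
  moreover have "A \<subseteq> (\<lambda>t. obs h (CI (cis t))) ` UNIV"
    using ab(2) by (fastforce simp: A_def f_def F_def)
  ultimately have "0 < emeasure (law h) A" by (intro law_positive A)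
  moreover have "A \<subseteq> nonpredictable_points S2xS1 T mu (obs h)"
  proof
    fix y assume y: "y \<in> A"
    then have "y \<in> {a..b}" by (simp add: A_def)
    then obtain s1 s2 where s: "f s1 = y" "f s2 = y" "g s1 \<noteq> g s2" using ab(2) by blast
    have "liminf (\<lambda>n. ennreal (real (Suc n)) * ennreal (measure (law h) (ball y (1 / real (Suc n))))) \<noteq> \<infinity>"
      using y by (simp add: A_def l_def law.emeasure_eq_measure)
    then obtain K where "\<exists>\<^sub>F n in sequentially. measure (law h) (ball y (1 / real (Suc n))) \<le> K / real (Suc n)"
      using liminf_finite_imp_frequently[of "\<lambda>n. measure (law h) (ball y (1 / real (Suc n)))"] by auto
    then show "y \<in> nonpredictable_points S2xS1 T mu (obs h)"
      using s by (intro nonpredictableI[of "cis s1" h y "cis s2"]) (auto simp: f_def g_def F_def)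
  qed
  ultimately show ?thesis using A by blast
qed

section \<open>Prevalence\<close>

lemma abs_obs_le_norm: "\<bar>obs h x\<bar> \<le> norm h"
proof -
  have "0 \<le> lip_const h" using lip_const_lipschitz[of h] by (rule lipschitz_on_nonneg)
  then show ?thesis using lip_sup_upper[of h x] by (simp add: norm_lip_obs_def)
qed

lemma continuous_obs_at: "continuous_on UNIV (\<lambda>h. obs h x)"
proof (rule continuous_onI)
  fix h :: lip_obs and e :: real assume "e > 0"
  have le: "dist (obs h' x) (obs h x) \<le> dist h' h" for h'
    using abs_obs_le_norm[of "h' - h" x] by (simp add: dist_norm minus_lip_obs.rep_eq)
  show "\<exists>d>0. \<forall>h'\<in>UNIV. dist h' h < d \<longrightarrow> dist (obs h' x) (obs h x) \<le> e"
  proof (rule exI[of _ e], intro conjI ballI impI)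
    fix h' assume "dist h' h < e"
    then show "dist (obs h' x) (obs h x) \<le> e" using le[of h'] by linarith
  qed fact
qed

text \<open>Rational endpoints make this a countable intersection of open sets, hence Borel; density
  of the rationals recovers all intervals.\<close>

definition nowhere_constant :: "lip_obs set" where
  "nowhere_constant = (\<Inter>(a, b)\<in>{p \<in> \<rat> \<times> \<rat>. fst p < snd p}.
     {h. \<exists>s\<in>{a..b}. \<exists>t\<in>{a..b}. obs h (CI (cis s)) \<noteq> obs h (CI (cis t))})"

lemma nowhere_constant_nonconstant:
  assumes "h \<in> nowhere_constant" "a < b"
  shows "\<exists>s\<in>{a..b}. \<exists>t\<in>{a..b}. obs h (CI (cis s)) \<noteq> obs h (CI (cis t))"
proof -
  obtain c where c: "c \<in> \<rat>" "a < c" "c < b" using Rats_dense_in_real[OF assms(2)] by blast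
  obtain d where d: "d \<in> \<rat>" "c < d" "d < b" using Rats_dense_in_real[OF c(3)] by blast
  have "(c, d) \<in> {p \<in> \<rat> \<times> \<rat>. fst p < snd p}" using c d by simp
  from INT_D[OF assms(1)[unfolded nowhere_constant_def] this]
  have "\<exists>s\<in>{c..d}. \<exists>t\<in>{c..d}. obs h (CI (cis s)) \<noteq> obs h (CI (cis t))" by simp
  then obtain s t where st: "s \<in> {c..d}" "t \<in> {c..d}" "obs h (CI (cis s)) \<noteq> obs h (CI (cis t))" by blast
  have "s \<in> {a..b}" "t \<in> {a..b}" using st c d by auto
  then show ?thesis using st(3) by blast
qed

lemma countable_rat_pairs: "countable {p \<in> \<rat> \<times> \<rat>. fst p < (snd p :: real)}"
  by (rule countable_subset[of _ "\<rat> \<times> \<rat>"]) (auto intro: countable_rat)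

lemma borel_nowhere_constant: "nowhere_constant \<in> sets borel"
  unfolding nowhere_constant_def
proof (rule sets.countable_INT'')
  show "UNIV \<in> sets (borel :: lip_obs measure)" by simp
  show "countable {p \<in> \<rat> \<times> \<rat>. fst p < (snd p :: real)}" by (rule countable_rat_pairs)
  fix p :: "real \<times> real"
  have "open (\<Union>s\<in>{fst p..snd p}. \<Union>t\<in>{fst p..snd p}. {h. obs h (CI (cis s)) \<noteq> obs h (CI (cis t))})"
    by (intro open_UN ballI open_Collect_neq continuous_obs_at)
  also have "(\<Union>s\<in>{fst p..snd p}. \<Union>t\<in>{fst p..snd p}. {h. obs h (CI (cis s)) \<noteq> obs h (CI (cis t))})
      = (case p of (a, b) \<Rightarrow> {h. \<exists>s\<in>{a..b}. \<exists>t\<in>{a..b}. obs h (CI (cis s)) \<noteq> obs h (CI (cis t))})"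
    by (auto split: prod.splits)
  finally show "(case p of (a, b) \<Rightarrow> {h. \<exists>s\<in>{a..b}. \<exists>t\<in>{a..b}. obs h (CI (cis s)) \<noteq> obs h (CI (cis t))}) \<in> sets borel"
    by (rule borel_open)
qed

text \<open>Spans the line of perturbations that witnesses prevalence. Along
  \<open>CI (cis t)\<close> it is the cosine of \<open>t\<close>, which is constant on no
  interval.\<close>

definition probe :: lip_obs where
  "probe = Abs_lip_obs (\<lambda>x. if x \<in> S2xS1 then Re (lon x) else 0)"

lemma obs_probe: "obs probe x = (if x \<in> S2xS1 then Re (lon x) else 0)"
proof -
  have "1-lipschitz_on S2xS1 (\<lambda>x. if x \<in> S2xS1 then Re (lon x) else 0)"
  proof (rule lipschitz_onI)
    fix x y :: pt3 assume "x \<in> S2xS1" "y \<in> S2xS1"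
    have "Re (lon x) - Re (lon y) = fst (x - y) $ 1" by (simp add: lon_def)
    then have "\<bar>Re (lon x) - Re (lon y)\<bar> \<le> norm (fst (x - y))" using component_le_norm_cart[of "fst (x - y)" 1] by simp
    also have "\<dots> \<le> norm (x - y)" by (metis norm_fst_le prod.collapse)
    finally show "dist (if x \<in> S2xS1 then Re (lon x) else 0) (if y \<in> S2xS1 then Re (lon y) else 0) \<le> 1 * dist x y"
      using \<open>x \<in> S2xS1\<close> \<open>y \<in> S2xS1\<close> by (simp add: dist_norm)
  qed simp
  then show ?thesis unfolding probe_def by (subst Abs_lip_obs_inverse) auto
qed

lemma obs_probe_CI: "obs probe (CI (cis t)) = cos t"
  by (simp add: obs_probe CI_mem) (simp add: CI_def)

text \<open>The level sets of the cosine are countable, an interval is not.\<close>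

lemma cos_nonconstant:
  assumes "a < b" shows "\<exists>s\<in>{a..b}. \<exists>t\<in>{a..b}. cos s \<noteq> (cos t :: real)"
proof (rule ccontr)
  assume "\<not> ?thesis"
  then have all: "\<forall>s\<in>{a..b}. \<forall>t\<in>{a..b}. cos s = cos t" by blast
  have c: "cos s = cos a" if "s \<in> {a..b}" for s using all[rule_format, OF that, of a] assms by simp
  have "\<exists>z. a < z \<and> z < b \<and> cos z \<noteq> cos a"
  proof -
    define S where "S = {s. cos s = cos a}"
    have "countable S"
    proof -
      have "S \<subseteq> (\<Union>n\<in>\<int>. {a + 2 * n * pi, - a + 2 * n * pi})"
        by (auto simp: S_def cos_eq)
      then show ?thesis by (rule countable_subset) (auto simp: Ints_def)
    qed
    then have "\<not> {a<..<b} \<subseteq> S" using uncountable_open_interval[of a b] assms countable_subset by blast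
    then show ?thesis by (auto simp: S_def)
  qed
  then obtain z where "a < z" "z < b" "cos z \<noteq> cos a" by blast
  then show False using c[of z] by simp
qed

text \<open>On each interval at most one multiple of the probe makes the perturbed observable constant.\<close>

lemma AE_probe: "AE c in lborel. v + c *\<^sub>R probe \<in> nowhere_constant"
proof -
  have "AE c in lborel. \<forall>p\<in>{p \<in> \<rat> \<times> \<rat>. fst p < snd p}.
      \<exists>s\<in>{fst p..snd p}. \<exists>t\<in>{fst p..snd p}. obs (v + c *\<^sub>R probe) (CI (cis s)) \<noteq> obs (v + c *\<^sub>R probe) (CI (cis t))"
  proof (subst AE_ball_countable[OF countable_rat_pairs], intro ballI)
    fix p :: "real \<times> real" assume "p \<in> {p \<in> \<rat> \<times> \<rat>. fst p < snd p}"
    then obtain s t where st: "s \<in> {fst p..snd p}" "t \<in> {fst p..snd p}" "cos s \<noteq> cos t"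
      using cos_nonconstant[of "fst p" "snd p"] by auto
    define c0 where "c0 = (obs v (CI (cis t)) - obs v (CI (cis s))) / (cos s - cos t)"
    have "AE c in lborel. c \<noteq> c0" by (rule AE_lborel_singleton)
    then show "AE c in lborel. \<exists>s\<in>{fst p..snd p}. \<exists>t\<in>{fst p..snd p}.
        obs (v + c *\<^sub>R probe) (CI (cis s)) \<noteq> obs (v + c *\<^sub>R probe) (CI (cis t))"
    proof eventually_elim
      case (elim c)
      have "obs v (CI (cis s)) + c * cos s \<noteq> obs v (CI (cis t)) + c * cos t"
      proof
        assume "obs v (CI (cis s)) + c * cos s = obs v (CI (cis t)) + c * cos t"
        then have "c * (cos s - cos t) = obs v (CI (cis t)) - obs v (CI (cis s))" by (simp add: algebra_simps)
        then have "c = c0" using st(3) by (simp add: c0_def nonzero_eq_divide_eq)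
        then show False using elim by simp
      qed
      then show ?case using st(1,2)
        by (intro bexI[of _ s] bexI[of _ t]) (simp_all add: plus_lip_obs.rep_eq scaleR_lip_obs.rep_eq obs_probe_CI)
    qed
  qed
  then show ?thesis by eventually_elim (auto simp: nowhere_constant_def)
qed

lemma measurable_scaled_probe: "(\<lambda>c. c *\<^sub>R probe) \<in> borel_measurable borel"
  by (intro borel_measurable_continuous_onI continuous_intros)

lemma borel_prevalent_nowhere_constant: "borel_prevalent nowhere_constant"
  unfolding borel_prevalent_def
proof (intro conjI)
  show "nowhere_constant \<in> sets borel" by (rule borel_nowhere_constant)
  \<comment> \<open>The test measure is Lebesgue measure on the line spanned by the probe; the
    segment \<open>K\<close> has mass 1.\<close>
  define \<rho> where "\<rho> = distr (lborel :: real measure) borel (\<lambda>c. c *\<^sub>R probe)"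
  define K where "K = (\<lambda>c. c *\<^sub>R probe) ` {0..1}"
  have K: "compact K" unfolding K_def by (intro compact_continuous_image continuous_intros) auto
  have pos: "probe \<noteq> 0"
  proof
    assume "probe = 0"
    then have "obs probe (CI (cis 0)) = 0" by (simp add: zero_lip_obs.rep_eq)
    then show False unfolding obs_probe_CI by simp
  qed
  have "emeasure \<rho> K = emeasure lborel ((\<lambda>c. c *\<^sub>R probe) -` K)"
    unfolding \<rho>_def using K measurable_scaled_probe by (subst emeasure_distr) (auto intro: borel_compact)
  also have "(\<lambda>c. c *\<^sub>R probe) -` K = {0..1}" using pos by (auto simp: K_def)
  finally have "emeasure \<rho> K = 1" by simp
  moreover have "AE e in \<rho>. v + e \<in> nowhere_constant" for v
  proof -
    have "(\<lambda>e. v + e) \<in> borel_measurable borel" by (intro borel_measurable_continuous_onI continuous_intros)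
    then have "{e. v + e \<in> nowhere_constant} \<in> sets borel"
      using measurable_sets[OF _ borel_nowhere_constant] by (fastforce simp: vimage_def)
    then show ?thesis
      unfolding \<rho>_def using AE_probe[of v] measurable_scaled_probe by (subst AE_distr_iff) auto
  qed
  moreover have "sets \<rho> = sets borel" by (simp add: \<rho>_def)
  ultimately show "\<exists>\<rho>. sets \<rho> = sets borel \<and> (\<exists>K. compact K \<and> 0 < emeasure \<rho> K \<and> emeasure \<rho> K < \<infinity>) \<and>
      (\<forall>v. AE e in \<rho>. v + e \<in> nowhere_constant)"
    using K by (intro exI[of _ \<rho>] conjI exI[of _ K] allI) auto
qed

text \<open>The factor \<^typ>\<open>real\<close> is second countable, so no countability assumption on the other factor is needed.\<close>

lemma open_in_pair_borel:
  fixes Q :: "(real \<times> 'v::topological_space) set"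
  assumes "open Q"
  shows "Q \<in> sets ((borel :: real measure) \<Otimes>\<^sub>M (borel :: 'v measure))"
proof -
  obtain \<B> :: "real set set" where \<B>: "countable \<B>" "topological_basis \<B>" using ex_countable_basis by blast
  \<comment> \<open>The largest open set whose product with \<open>U\<close> stays in
    \<open>Q\<close>. Taking it over a countable basis exhausts \<open>Q\<close> by countably many
    boxes.\<close>
  define V where "V U = \<Union>{W. open W \<and> U \<times> W \<subseteq> Q}" for U
  have eq: "Q = (\<Union>U\<in>\<B>. U \<times> V U)"
  proof (rule equalityI)
    show "Q \<subseteq> (\<Union>U\<in>\<B>. U \<times> V U)"
    proof (rule subsetI)
      fix p assume "p \<in> Q"
      then obtain A W where AW: "open A" "open W" "fst p \<in> A" "snd p \<in> W" "A \<times> W \<subseteq> Q"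
        using assms by (elim open_prod_elim) auto
      obtain U where U: "U \<in> \<B>" "fst p \<in> U" "U \<subseteq> A"
        using topological_basisE[OF \<B>(2) AW(1,3)] by blast
      then have "snd p \<in> V U" using AW unfolding V_def by blast
      then show "p \<in> (\<Union>U\<in>\<B>. U \<times> V U)" using U by (auto simp: mem_Times_iff)
    qed
  qed (auto simp: V_def)
  show ?thesis
  proof (subst eq, rule sets.countable_UN'[OF \<B>(1)], rule image_subsetI)
    fix U assume "U \<in> \<B>"
    then have "open U" using \<B>(2) by (simp add: topological_basis_open)
    moreover have "open (V U)" unfolding V_def by blast
    ultimately show "U \<times> V U \<in> sets (borel \<Otimes>\<^sub>M borel)" by (intro pair_measureI borel_open)
  qed
qed

text \<open>
  A set that is avoided by almost every point of each line in a fixed direction is not prevalent: by Fubini, on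
  the product of this direction with the test measure, it would have both full and zero measure.
\<close>

lemma not_prevalent_if_null_lines:
  fixes e :: "'v::real_normed_vector"
  assumes "\<And>v. AE c in lborel. v + c *\<^sub>R e \<notin> S"
  shows "\<not> prevalent S"
proof
  assume "prevalent S"
  then obtain B where "B \<subseteq> S" "borel_prevalent B" unfolding prevalent_def by blast
  then obtain \<rho> K where B: "B \<in> sets borel" "sets \<rho> = sets borel" "compact K" "0 < emeasure \<rho> K" "emeasure \<rho> K < \<infinity>"
    "\<And>v. AE x in \<rho>. v + x \<in> B" unfolding borel_prevalent_def by blast
  have Kb: "K \<in> sets \<rho>" using B(2,3) by (simp add: borel_compact)
  \<comment> \<open>The test measure is only known to be finite on \<open>K\<close>; its restriction
    to \<open>K\<close> is finite, as Fubini requires.\<close>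
  define \<sigma> where "\<sigma> = density \<rho> (indicator K)"
  have s\<sigma>: "sets \<sigma> = sets borel" by (simp add: \<sigma>_def B(2))
  have sp: "space \<sigma> = UNIV" using sets_eq_imp_space_eq[OF s\<sigma>] by simp
  have tot: "emeasure \<sigma> UNIV = emeasure \<rho> K"
  proof -
    have "UNIV \<in> sets \<rho>" using B(2) by simp
    then show ?thesis unfolding \<sigma>_def using Kb by (subst emeasure_density) auto
  qed
  interpret \<sigma>: finite_measure \<sigma> by (rule finite_measureI) (use tot B(5) sp in auto)
  interpret P: pair_sigma_finite "lborel :: real measure" \<sigma> ..
  define M where "M = (\<lambda>p::real \<times> 'v. snd p + fst p *\<^sub>R e) -` B"
  have M: "M \<in> sets (lborel \<Otimes>\<^sub>M \<sigma>)"
  proof -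
    have "(\<lambda>p::real \<times> 'v. snd p + fst p *\<^sub>R e) \<in> borel_measurable (borel \<Otimes>\<^sub>M borel)"
    proof (rule borel_measurableI)
      fix W :: "'v set" assume "open W"
      moreover have "continuous_on UNIV (\<lambda>p::real \<times> 'v. snd p + fst p *\<^sub>R e)" by (intro continuous_intros)
      ultimately have "open ((\<lambda>p::real \<times> 'v. snd p + fst p *\<^sub>R e) -` W)" by (simp add: open_vimage)
      then show "(\<lambda>p::real \<times> 'v. snd p + fst p *\<^sub>R e) -` W \<inter> space (borel \<Otimes>\<^sub>M borel) \<in> sets (borel \<Otimes>\<^sub>M borel)"
        using open_in_pair_borel by (simp add: space_pair_measure)
    qed
    from measurable_sets[OF this B(1)] have "M \<in> sets (borel \<Otimes>\<^sub>M borel)" by (simp add: M_def space_pair_measure)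
    also have "sets (borel \<Otimes>\<^sub>M borel) = sets (lborel \<Otimes>\<^sub>M \<sigma>)" by (intro sets_pair_measure_cong) (simp_all add: s\<sigma>)
    finally show ?thesis .
  qed
  have full: "emeasure \<sigma> (Pair c -` M) = emeasure \<rho> K" for c
  proof -
    have "AE x in \<rho>. x \<in> Pair c -` M" using B(6)[of "c *\<^sub>R e"] by (simp add: M_def add.commute)
    then have "AE x in \<sigma>. x \<in> Pair c -` M" unfolding \<sigma>_def using Kb by (subst AE_density) auto
    then have "emeasure \<sigma> (Pair c -` M) = emeasure \<sigma> UNIV"
      using sets_Pair1[OF M, of c] sp by (intro emeasure_eq_AE) (auto simp: s\<sigma>)
    then show ?thesis by (simp add: tot)
  qed
  have "emeasure (lborel \<Otimes>\<^sub>M \<sigma>) M = (\<integral>\<^sup>+x. emeasure lborel ((\<lambda>c. (c, x)) -` M) \<partial>\<sigma>)"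
    by (rule P.emeasure_pair_measure_alt2[OF M])
  also have "\<dots> = (\<integral>\<^sup>+x. 0 \<partial>\<sigma>)"
  proof (rule nn_integral_cong)
    fix x
    have m: "(\<lambda>c. (c, x)) -` M \<in> sets lborel" by (rule sets_Pair2[OF M])
    have "AE c in lborel. c \<notin> (\<lambda>c. (c, x)) -` M"
      using assms[of x] by eventually_elim (use \<open>B \<subseteq> S\<close> in \<open>auto simp: M_def\<close>)
    then show "emeasure lborel ((\<lambda>c. (c, x)) -` M) = 0"
      using m by (subst (asm) AE_iff_measurable[OF m]) auto
  qed
  finally have "emeasure (lborel \<Otimes>\<^sub>M \<sigma>) M = 0" by simp
  \<comment> \<open>Every section over the line has the full mass of \<open>K\<close>, and the line
    has infinite length, so this integral is infinite and not 0.\<close>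
  moreover have "emeasure (lborel \<Otimes>\<^sub>M \<sigma>) M = (\<integral>\<^sup>+c. emeasure \<rho> K \<partial>(lborel :: real measure))"
    using \<sigma>.emeasure_pair_measure_alt[OF M] by (simp add: full)
  ultimately show False using B(4) by (simp add: ennreal_mult_eq_top_iff)
qed

theorem theorem1p11:
  shows "\<exists>(T :: (real^3) \<times> complex \<Rightarrow> (real^3) \<times> complex) (\<mu> :: ((real^3) \<times> complex) measure).
    smooth_diffeo_on S2xS1 T \<and>
    natural_measure S2xS1_volume S2xS1 T \<mu> \<and>
    (\<exists>d<1. has_ID \<mu> d) \<and>
    prevalent {h :: lip_obs.
      \<exists>A\<in>sets borel. A \<subseteq> nonpredictable_points S2xS1 T \<mu> (obs h) \<and>
        0 < emeasure (distr \<mu> borel (obs h)) A} \<and>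
    \<not> prevalent {h :: lip_obs.
      AE y in distr \<mu> borel (obs h). y \<in> predictable_points S2xS1 T \<mu> (obs h)}"
proof (intro exI conjI)
  show "smooth_diffeo_on S2xS1 T" by (rule smooth_diffeo_T)
  show "natural_measure S2xS1_volume S2xS1 T mu" by (rule natural_measure_mu)
  show "ereal (1/2) < 1" by simp
  show "has_ID mu (ereal (1/2))" by (rule has_ID_mu)
  have pos: "\<exists>A\<in>sets borel. A \<subseteq> nonpredictable_points S2xS1 T mu (obs h) \<and> 0 < emeasure (distr mu borel (obs h)) A"
    if "h \<in> nowhere_constant" for h
    using nonpredictable_positive[OF nowhere_constant_nonconstant[OF that]] by (simp add: law_def)
  then show "prevalent {h :: lip_obs. \<exists>A\<in>sets borel. A \<subseteq> nonpredictable_points S2xS1 T mu (obs h) \<and>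
      0 < emeasure (distr mu borel (obs h)) A}"
    unfolding prevalent_def using borel_prevalent_nowhere_constant by blast
  have not_AE: "\<not> (AE y in distr mu borel (obs h). y \<in> predictable_points S2xS1 T mu (obs h))"
    if h: "h \<in> nowhere_constant" for h
  proof
    assume ae: "AE y in distr mu borel (obs h). y \<in> predictable_points S2xS1 T mu (obs h)"
    obtain A where A: "A \<in> sets borel" "A \<subseteq> nonpredictable_points S2xS1 T mu (obs h)"
      "0 < emeasure (distr mu borel (obs h)) A" using pos[OF h] by blast
    have "AE y in distr mu borel (obs h). y \<notin> A"
      using ae by eventually_elim (use A(2) in \<open>auto simp: nonpredictable_points_def\<close>)
    then have "emeasure (distr mu borel (obs h)) A = 0"
      using A(1) by (subst (asm) AE_iff_measurable[of A]) auto
    then show False using A(3) by simp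
  qed
  show "\<not> prevalent {h :: lip_obs. AE y in distr mu borel (obs h). y \<in> predictable_points S2xS1 T mu (obs h)}"
  proof (rule not_prevalent_if_null_lines)
    fix v
    show "AE c in lborel. v + c *\<^sub>R probe \<notin> {h. AE y in distr mu borel (obs h). y \<in> predictable_points S2xS1 T mu (obs h)}"
      using AE_probe[of v] by eventually_elim (use not_AE in blast)
  qed
qed

end
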